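(* Assume that the QBD with transition matrix $P$ is positive recurrent, that $\sum_{k=0}^\infty\rho(R)^k\|\boldsymbol g_k\|<\infty$ for some (equivalently, any) vector norm, and that $\boldsymbol\pi_0^T\sum_{k=0}^\infty R^k\boldsymbol g_k=0$, where $\boldsymbol g_k\in\mathbb C^m$, $k\ge 0$. For $r\ge0$ let $$\boldsymbol\omega_r=G^r\boldsymbol\gamma+\boldsymbol y_r+c\boldsymbol 1,$$ where $c$ is an arbitrary constant, $$\boldsymbol\gamma=(I-P_* )^{\#}\sum_{k=0}^\infty R^k\boldsymbol g_k,\qquad \boldsymbol y_r=-\sum_{k=0}^\infty\sum_{j=0}^{r-1}G^j(U-I)^{-1}R^k\boldsymbol g_{r+k-j}.$$ Then $\boldsymbol\omega_r$ may be written as $$\boldsymbol\omega_r=G^r\boldsymbol x+LV_1^{-r}\boldsymbol y^*+\boldsymbol\sigma_r,\qquad r\ge0,$$ where $\boldsymbol y^*=-\sum_{k=1}^\infty V_1^kEW\boldsymbol g_k$, $$\boldsymbol x=(I-P_* )^{\#}\left(\left((B-I)\widehat G+A_1\right)\left(\boldsymbol\sigma_1+LV_1^{-1}\boldsymbol y^*\right)+\boldsymbol g_0\right)+\alpha\boldsymbol 1$$ for a suitable constant $\alpha$ (independent of $r$, corresponding to the arbitrary constant $c$), and $$\boldsymbol\sigma_r=-\sum_{k=1}^{r}\left(G^{r-k}-LV_1^{k-r}E\right)W\boldsymbol g_k-\sum_{j=1}^{\nu-1}KV_0^jFW\boldsymbol g_{j+r},\qquad r\ge 0.$$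
   Context: QBD process. Let $m\ge1$ be an integer and let $B,A_{-1},A_0,A_1$ be nonnegative $m\times m$ matrices such that the infinite block tridiagonal matrix $P=(P_{i,j})_{i,j\ge 0}$ with $m\times m$ blocks $P_{0,0}=B$, $P_{i,i}=A_0$ for $i\ge1$, $P_{i,i+1}=A_1$ for $i\ge 0$, $P_{i,i-1}=A_{-1}$ for $i\ge1$, and all other blocks zero, is row-stochastic. $P$ is the transition matrix of a discrete-time Markov chain (a QBD) on $\mathbb N\times\mathcal E$, $\mathcal E=\{1,\dots,m\}$; "positive recurrent" refers to this chain. $\boldsymbol 1$ is the all-ones vector and $\rho(\cdot)$ is the spectral radius. Standing assumptions: $P$ is irreducible; $A_{-1}+A_0+A_1$ is irreducible; and the doubly infinite QBD on $\mathbb Z\times\mathcal E$ (with transition blocks $A_{-1},A_0,A_1$ for level changes $-1,0,+1$) has only one final class $\mathbb Z\times\mathcal E_*$, with $\emptyset\ne\mathcal E_*\subseteq\mathcal E$, and every other state is on a path to the final class. $G$, $\widehat G$, $R$ are the minimal nonnegative solutions of $A_{-1}+(A_0-I)X+A_1X^2=0$, $A_1+(A_0-I)X+A_{-1}X^2=0$ and $A_1+X(A_0-I)+X^2A_{-1}=0$, respectively. Put $U=A_0+RA_{-1}$ (equivalently $U=A_0+A_1G$), $P_*=B+A_1G$, and $W=\sum_{j=0}^\infty G^j(U-I)^{-1}R^j$, which converges when the QBD is not null recurrent. $M$ is a nonsingular matrix such that $\widehat GM=MJ$ with $J=\mathrm{diag}(V_1,V_0)$, where $V_1$ is a nonsingular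 $p\times p$ matrix, $0\le p\le m$, and $V_0$ is an $(m-p)\times(m-p)$ matrix with spectral radius $0$. Write $M=[\,L\mid K\,]$ with $L$ of size $m\times p$ and $K$ of size $m\times(m-p)$, and $M^{-1}=\begin{bmatrix}E\\ F\end{bmatrix}$ with $E$ of size $p\times m$ and $F$ of size $(m-p)\times m$. $\nu$ is the smallest positive integer with $V_0^\nu=0$. (Terms involving empty blocks are absent when $p=0$ or $p=m$.) $\boldsymbol\pi=(\boldsymbol\pi_i)_{i\ge0}$ is the stationary distribution of $P$ in blocks of length $m$; $\boldsymbol\pi_i^T=\boldsymbol\pi_0^TR^i$. In the recurrent case $P_*$ is an irreducible stochastic matrix. The group inverse $H^\#$ of a square matrix $H$, when it exists, is the matrix satisfying $HH^\#=H^\#H$, $HH^\#H=H$, $H^\#HH^\#=H^\#$; it exists for $H=I-P_*$ when $P_*$ is an irreducible finite stochastic matrix. *)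

theory Defs
  imports
    "HOL-Analysis.Infinite_Sum"
    "Jordan_Normal_Form.Spectral_Radius"
    "Jordan_Normal_Form.Gauss_Jordan_Elimination"
begin

text \<open>A chain is given by its state space \<open>S\<close> and its transition probabilities \<open>p\<close>;
  the values of \<open>p\<close> outside \<open>S\<close> are irrelevant.\<close>

definition stochastic_on :: "'s set \<Rightarrow> ('s \<Rightarrow> 's \<Rightarrow> real) \<Rightarrow> bool" where
  "stochastic_on S p \<longleftrightarrow>
     (\<forall>s\<in>S. \<forall>t\<in>S. 0 \<le> p s t) \<and> (\<forall>s\<in>S. (p s has_sum 1) S)"

definition reaches :: "'s set \<Rightarrow> ('s \<Rightarrow> 's \<Rightarrow> real) \<Rightarrow> 's \<Rightarrow> 's \<Rightarrow> bool" where
  "reaches S p s t \<longleftrightarrow> (s, t) \<in> {(u, v). u \<in> S \<and> v \<in> S \<and> 0 < p u v}\<^sup>*"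

definition irreducible_on :: "'s set \<Rightarrow> ('s \<Rightarrow> 's \<Rightarrow> real) \<Rightarrow> bool" where
  "irreducible_on S p \<longleftrightarrow> (\<forall>s\<in>S. \<forall>t\<in>S. reaches S p s t)"

definition final_class :: "'s set \<Rightarrow> ('s \<Rightarrow> 's \<Rightarrow> real) \<Rightarrow> 's set \<Rightarrow> bool" where
  "final_class S p C \<longleftrightarrow> C \<noteq> {} \<and> C \<subseteq> S \<and> (\<forall>s\<in>C. {t. reaches S p s t} = C)"

text \<open>\<open>first_passage S p t n s\<close> is the probability that the chain started in \<open>s\<close> is in \<open>t\<close>
  at time \<open>n + 1\<close> but at none of the times \<open>1, \<dots>, n\<close>.\<close>

primrec first_passage :: "'s set \<Rightarrow> ('s \<Rightarrow> 's \<Rightarrow> real) \<Rightarrow> 's \<Rightarrow> nat \<Rightarrow> 's \<Rightarrow> real" where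
  "first_passage S p t 0 = (\<lambda>s. p s t)"
| "first_passage S p t (Suc n) = (\<lambda>s. \<Sum>\<^sub>\<infinity>u\<in>S - {t}. p s u * first_passage S p t n u)"

definition positive_recurrent :: "'s set \<Rightarrow> ('s \<Rightarrow> 's \<Rightarrow> real) \<Rightarrow> bool" where
  "positive_recurrent S p \<longleftrightarrow>
     (\<forall>s\<in>S. (\<lambda>n. first_passage S p s n s) sums 1 \<and>
            summable (\<lambda>n. real (Suc n) * first_passage S p s n s))"

definition stationary_distribution ::
    "'s set \<Rightarrow> ('s \<Rightarrow> 's \<Rightarrow> real) \<Rightarrow> ('s \<Rightarrow> real) \<Rightarrow> bool" where
  "stationary_distribution S p \<mu> \<longleftrightarrow>
     (\<forall>s\<in>S. 0 \<le> \<mu> s) \<and> (\<mu> has_sum 1) S \<and>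
     (\<forall>t\<in>S. ((\<lambda>s. \<mu> s * p s t) has_sum \<mu> t) S)"

text \<open>States are pairs (level, phase), with phases \<open>0, \<dots>, m - 1\<close>. The matrices \<open>Am\<close>, \<open>A0\<close>,
  \<open>A1\<close> belong to the level changes \<open>-1\<close>, \<open>0\<close>, \<open>1\<close>, and \<open>B\<close> is the diagonal block of level 0.\<close>

definition qbd_trans ::
    "real mat \<Rightarrow> real mat \<Rightarrow> real mat \<Rightarrow> real mat \<Rightarrow> nat \<times> nat \<Rightarrow> nat \<times> nat \<Rightarrow> real" where
  "qbd_trans B Am A0 A1 = (\<lambda>(i, a) (j, b).
     if i = 0 \<and> j = 0 then B $$ (a, b)
     else if j = i then A0 $$ (a, b)
     else if j = i + 1 then A1 $$ (a, b)
     else if i = j + 1 then Am $$ (a, b)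
     else 0)"

definition doubly_infinite_qbd_trans ::
    "real mat \<Rightarrow> real mat \<Rightarrow> real mat \<Rightarrow> int \<times> nat \<Rightarrow> int \<times> nat \<Rightarrow> real" where
  "doubly_infinite_qbd_trans Am A0 A1 = (\<lambda>(i, a) (j, b).
     if j = i then A0 $$ (a, b)
     else if j = i + 1 then A1 $$ (a, b)
     else if j = i - 1 then Am $$ (a, b)
     else 0)"

definition single_final_class ::
    "nat \<Rightarrow> real mat \<Rightarrow> real mat \<Rightarrow> real mat \<Rightarrow> nat set \<Rightarrow> bool" where
  "single_final_class m Am A0 A1 Es \<longleftrightarrow>
     (let S = UNIV \<times> {..<m}; q = doubly_infinite_qbd_trans Am A0 A1 in
      Es \<noteq> {} \<and> Es \<subseteq> {..<m} \<and> {C. final_class S q C} = {UNIV \<times> Es} \<and>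
      (\<forall>s \<in> S - UNIV \<times> Es. \<exists>t \<in> UNIV \<times> Es. reaches S q s t))"

text \<open>Minimality is with respect to the entrywise order.\<close>

definition minimal_nonneg_solution :: "nat \<Rightarrow> (real mat \<Rightarrow> real mat) \<Rightarrow> real mat \<Rightarrow> bool" where
  "minimal_nonneg_solution m \<Phi> X \<longleftrightarrow>
     0\<^sub>m m m \<le> X \<and> \<Phi> X = 0\<^sub>m m m \<and>
     (\<forall>Y. 0\<^sub>m m m \<le> Y \<longrightarrow> \<Phi> Y = 0\<^sub>m m m \<longrightarrow> X \<le> Y)"

abbreviation cmat :: "real mat \<Rightarrow> complex mat" where
  "cmat \<equiv> map_mat complex_of_real"

text \<open>Only to be used for nonsingular matrices.\<close>

abbreviation mat_inv :: "'a :: field mat \<Rightarrow> 'a mat" where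
  "mat_inv A \<equiv> the (mat_inverse A)"

definition is_group_inverse :: "'a :: field mat \<Rightarrow> 'a mat \<Rightarrow> bool" where
  "is_group_inverse H X \<longleftrightarrow>
     X \<in> carrier_mat (dim_row H) (dim_row H) \<and> H * X = X * H \<and> H * X * H = H \<and> X * H * X = X"

definition group_inverse :: "'a :: field mat \<Rightarrow> 'a mat" where
  "group_inverse H = (THE X. is_group_inverse H X)"

definition append_cols :: "'a :: zero mat \<Rightarrow> 'a mat \<Rightarrow> 'a mat" where
  "append_cols A B = four_block_mat A B (0\<^sub>m 0 (dim_col A)) (0\<^sub>m 0 (dim_col B))"

definition ones_vec :: "nat \<Rightarrow> complex vec" where
  "ones_vec m = vec m (\<lambda>_. 1)"

definition is_vec_norm :: "nat \<Rightarrow> (complex vec \<Rightarrow> real) \<Rightarrow> bool" where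
  "is_vec_norm m N \<longleftrightarrow>
     (\<forall>v \<in> carrier_vec m. 0 \<le> N v \<and> (N v = 0 \<longleftrightarrow> v = 0\<^sub>v m)) \<and>
     (\<forall>a. \<forall>v \<in> carrier_vec m. N (a \<cdot>\<^sub>v v) = cmod a * N v) \<and>
     (\<forall>v \<in> carrier_vec m. \<forall>w \<in> carrier_vec m. N (v + w) \<le> N v + N w)"

text \<open>The types of vectors and matrices of arbitrary dimension carry no topology; series are
  taken entrywise.\<close>

definition vec_summable :: "nat \<Rightarrow> (nat \<Rightarrow> complex vec) \<Rightarrow> bool" where
  "vec_summable n f \<longleftrightarrow> (\<forall>i<n. summable (\<lambda>k. f k $ i))"

definition vec_suminf :: "nat \<Rightarrow> (nat \<Rightarrow> complex vec) \<Rightarrow> complex vec" where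
  "vec_suminf n f = vec n (\<lambda>i. \<Sum>k. f k $ i)"

definition mat_suminf :: "nat \<Rightarrow> (nat \<Rightarrow> complex mat) \<Rightarrow> complex mat" where
  "mat_suminf n f = mat n n (\<lambda>(i, j). \<Sum>k. f k $$ (i, j))"

abbreviation vec_sum :: "nat \<Rightarrow> ('i \<Rightarrow> complex vec) \<Rightarrow> 'i set \<Rightarrow> complex vec" where
  "vec_sum \<equiv> finsum_vec TYPE(complex)"

end

theory Submission
  imports Defs
begin

text \<open>
  Put \<open>S\<^sub>n = \<Sum>\<^sub>k R\<^sup>k g\<^sub>n\<^sub>+\<^sub>k\<close>, so that \<open>S\<^sub>n = g\<^sub>n + R S\<^sub>n\<^sub>+\<^sub>1\<close>, and \<open>D = (U - 1)\<^sup>-\<^sup>1\<close>. Two identities carry the proof: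
  \<open>W = D + G W R\<close>, which is read off the series, and \<open>W R = Ghat W\<close>, which holds because \<open>- W\<close> is
  the block of the Green matrix of the walk on all integer levels between equal levels, and both sides are
  (up to the sign) the block that leads one level up: \<open>R\<close> counts the visits to the next level between
  visits to this one, \<open>Ghat\<close> is the first passage to the next level. For \<open>u\<^sub>n = W S\<^sub>n\<close> and \<open>w\<^sub>n = W g\<^sub>n\<close> the
  identities say \<open>u\<^sub>n = w\<^sub>n + Ghat u\<^sub>n\<^sub>+\<^sub>1\<close> and \<open>D S\<^sub>n = u\<^sub>n - G Ghat u\<^sub>n\<close>.

  By the second of these the convolution \<open>y\<^sub>r = - \<Sum>\<^sub>j\<^sub><\<^sub>r G\<^sup>j D S\<^sub>r\<^sub>-\<^sub>j\<close> telescopes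
  (\<open>convolution_identity\<close>) to \<open>y\<^sub>r = Z\<^sub>r + G\<^sup>r q\<close> with \<open>q = Ghat u\<^sub>1\<close> and
  \<open>Z\<^sub>r = - \<Sum>\<^sub>1\<^sub>\<le>\<^sub>k\<^sub>\<le>\<^sub>r G\<^sup>r\<^sup>-\<^sup>k w\<^sub>k - Ghat u\<^sub>r\<^sub>+\<^sub>1\<close>. The tail \<open>Ghat u\<^sub>r\<^sub>+\<^sub>1\<close> is then split along the
  spectral decomposition of \<open>Ghat\<close> (\<open>spectral_splitting\<close>). In the nilpotent coordinates it is a finite sum.
  In the others the recursion for \<open>u\<close> can be run towards level 1, where \<open>V\<^sub>1\<^sup>-\<^sup>r\<close> and \<open>ystar\<close> come from.
  This gives \<open>Z\<^sub>r = L V\<^sub>1\<^sup>-\<^sup>r ystar + \<sigma>\<^sub>r\<close>. It remains to see that \<open>x\<close> and \<open>q + \<gamma>\<close> differ by a constant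
  vector, which \<open>G\<^sup>r\<close> fixes: with \<open>H = 1 - Pstar\<close> the argument of the group inverse in \<open>x\<close> is
  \<open>H q + S\<^sub>0\<close>, and \<open>H\<^sup># H q - q\<close> lies in the kernel of \<open>H\<close>, the constants.

  Probability enters through comparisons of nonnegative matrices. A bound on least solutions of quadratic
  equations (\<open>least_solution_bound\<close>) gives \<open>\<pi>\<^sub>i R \<le> \<pi>\<^sub>i\<^sub>+\<^sub>1\<close>, so the powers of \<open>R\<close> are summable
  (\<open>R_pow_summable\<close>) and the series for \<open>W\<close> converges. The minimum principle on the irreducible two-sided walk
  gives \<open>(1 - U)\<^sup>-\<^sup>1 \<ge> 0\<close> and with it the relations between \<open>G\<close>, \<open>R\<close> and \<open>U\<close>
  (\<open>minimal_G_factorization\<close>); the maximum principle on the chain itself gives \<open>G 1 = 1\<close> (\<open>G_row_sums\<close>) and the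
  kernel of \<open>H\<close>. Finally, the condition on the \<open>g\<^sub>k\<close> weighs them with the exact powers \<open>\<rho>(R)\<^sup>k\<close>, so the
  entries of \<open>R\<^sup>k\<close> must be of order \<open>\<rho>(R)\<^sup>k\<close> without a polynomial factor (\<open>R_pow_bound\<close>); this rests on
  the irreducibility of \<open>Am + A0 + A1\<close>.\<close>

section \<open>Entrywise order and entrywise limits of matrices\<close>

lemma index_mult_mat_sum:
  assumes "A \<in> carrier_mat n k" "B \<in> carrier_mat k l" "i < n" "j < l"
  shows "(A * B) $$ (i, j) = (\<Sum>a<k. A $$ (i, a) * B $$ (a, j))"
  using assms by (auto simp: scalar_prod_def lessThan_atLeast0 intro!: sum.cong)

lemma index_mult_mat_vec_sum:
  assumes "A \<in> carrier_mat n k" "v \<in> carrier_vec k" "i < n"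
  shows "(A *\<^sub>v v) $ i = (\<Sum>a<k. A $$ (i, a) * v $ a)"
  using assms by (auto simp: scalar_prod_def lessThan_atLeast0 intro!: sum.cong)

lemma mat_pow_commute:
  fixes A :: "'a :: semiring_1 mat"
  assumes [simp]: "A \<in> carrier_mat n n"
  shows "A ^\<^sub>m k * A = A * A ^\<^sub>m k"
proof (induction k)
  case (Suc k)
  have "A ^\<^sub>m Suc k * A = (A * A ^\<^sub>m k) * A" by (simp add: Suc)
  also have "\<dots> = A * A ^\<^sub>m Suc k" by (simp add: assoc_mult_mat[of _ n n _ n _ n])
  finally show ?case .
next
  case 0
  have "dim_row A = n" by (rule carrier_matD(1)[OF assms])
  then show ?case by (simp add: left_mult_one_mat[OF assms] right_mult_one_mat[OF assms])
qed

lemma mat_pow_Suc_left: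
  fixes A :: "'a :: semiring_1 mat"
  assumes "A \<in> carrier_mat n n"
  shows "A ^\<^sub>m Suc k = A * A ^\<^sub>m k"
  using mat_pow_commute[OF assms] by simp

lemma mult_mat_vec_uminus:
  fixes A :: "'a :: ring mat"
  assumes "A \<in> carrier_mat n k" "v \<in> carrier_vec k"
  shows "A *\<^sub>v (- v) = - (A *\<^sub>v v)"
  using assms by (intro eq_vecI) auto

lemma mat_le_iff:
  assumes "A \<in> carrier_mat n k" "B \<in> carrier_mat n k"
  shows "A \<le> B \<longleftrightarrow> (\<forall>i<n. \<forall>j<k. A $$ (i, j) \<le> B $$ (i, j))"
  using assms by (auto simp: less_eq_mat_def)

lemma mat_nonneg_iff:
  "0\<^sub>m n k \<le> A \<longleftrightarrow> A \<in> carrier_mat n k \<and> (\<forall>i<n. \<forall>j<k. 0 \<le> A $$ (i, j))"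
  by (auto simp: less_eq_mat_def)

lemma mat_le_carrier:
  "A \<le> B \<Longrightarrow> A \<in> carrier_mat n k \<Longrightarrow> B \<in> carrier_mat n k"
  by (metis carrier_matD carrier_matI less_eq_mat_def)

lemma mat_add_mono:
  fixes A B C D :: "real mat"
  assumes "A \<le> B" "C \<le> D" "A \<in> carrier_mat n k" "C \<in> carrier_mat n k"
  shows "A + C \<le> B + D"
proof -
  have "B \<in> carrier_mat n k" "D \<in> carrier_mat n k"
    using assms mat_le_carrier by blast+
  then show ?thesis
    using assms by (auto simp: mat_le_iff[of _ n k] add_mono)
qed

lemma mat_mult_mono:
  fixes A B C D :: "real mat"
  assumes "0\<^sub>m n k \<le> A" "A \<le> B" "0\<^sub>m k l \<le> C" "C \<le> D"
  shows "A * C \<le> B * D"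
proof -
  have c: "A \<in> carrier_mat n k" "C \<in> carrier_mat k l"
    using assms by (auto simp: mat_nonneg_iff)
  have d: "B \<in> carrier_mat n k" "D \<in> carrier_mat k l"
    using assms c mat_le_carrier by blast+
  show ?thesis
    unfolding mat_le_iff[OF mult_carrier_mat[OF c] mult_carrier_mat[OF d]]
  proof (intro allI impI)
    fix i j assume "i < n" "j < l"
    moreover have "A $$ (i, a) * C $$ (a, j) \<le> B $$ (i, a) * D $$ (a, j)" if "a < k" for a
    proof (rule mult_mono)
      have "0 \<le> A $$ (i, a)" using assms(1) that \<open>i < n\<close> by (auto simp: mat_nonneg_iff)
      moreover show "A $$ (i, a) \<le> B $$ (i, a)"
        using assms(2) that \<open>i < n\<close> c d by (auto simp: mat_le_iff[of A n k])
      ultimately show "0 \<le> B $$ (i, a)" by simp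
      show "0 \<le> C $$ (a, j)" using assms(3) that \<open>j < l\<close> by (auto simp: mat_nonneg_iff)
      show "C $$ (a, j) \<le> D $$ (a, j)"
        using assms(4) that \<open>j < l\<close> c d by (auto simp: mat_le_iff[of C k l])
    qed
    ultimately show "(A * C) $$ (i, j) \<le> (B * D) $$ (i, j)"
      by (auto simp: index_mult_mat_sum[OF c] index_mult_mat_sum[OF d] simp del: index_mult_mat intro!: sum_mono)
  qed
qed

lemma mat_mult_nonneg:
  fixes A B :: "real mat"
  assumes "0\<^sub>m n k \<le> A" "0\<^sub>m k l \<le> B"
  shows "0\<^sub>m n l \<le> A * B"
  using assms by (auto simp: mat_nonneg_iff index_mult_mat_sum[of _ n k _ l]
      simp del: index_mult_mat(1) intro!: sum_nonneg)

lemma mat_add_nonneg: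
  fixes A B :: "real mat"
  assumes "0\<^sub>m n k \<le> A" "0\<^sub>m n k \<le> B"
  shows "0\<^sub>m n k \<le> A + B"
  using assms by (auto simp: mat_nonneg_iff)

lemma mat_pow_nonneg:
  fixes A :: "real mat"
  assumes "0\<^sub>m n n \<le> A"
  shows "0\<^sub>m n n \<le> A ^\<^sub>m k"
proof (induction k)
  case 0
  then show ?case using assms by (auto simp: mat_nonneg_iff)
next
  case (Suc k)
  then show ?case using mat_mult_nonneg[OF Suc assms] by simp
qed

lemma transpose_mat_mono:
  fixes A B :: "'a :: ord mat"
  shows "A \<le> B \<Longrightarrow> transpose_mat A \<le> transpose_mat B"
  by (auto simp: less_eq_mat_def)

definition mat_tendsto :: "nat \<Rightarrow> nat \<Rightarrow> (nat \<Rightarrow> real mat) \<Rightarrow> real mat \<Rightarrow> bool" where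
  "mat_tendsto n k S X \<longleftrightarrow> X \<in> carrier_mat n k \<and> (\<forall>r. S r \<in> carrier_mat n k) \<and>
     (\<forall>i<n. \<forall>j<k. (\<lambda>r. S r $$ (i, j)) \<longlonglongrightarrow> X $$ (i, j))"

lemma mat_tendsto_const: "X \<in> carrier_mat n k \<Longrightarrow> mat_tendsto n k (\<lambda>_. X) X"
  by (auto simp: mat_tendsto_def)

lemma mat_tendsto_add:
  "mat_tendsto n k S X \<Longrightarrow> mat_tendsto n k T Y \<Longrightarrow> mat_tendsto n k (\<lambda>r. S r + T r) (X + Y)"
  unfolding mat_tendsto_def by (auto simp: carrier_matD[of "T r" n k for r] tendsto_add)

lemma mat_tendsto_mult:
  assumes "mat_tendsto n k S X" "mat_tendsto k l T Y"
  shows "mat_tendsto n l (\<lambda>r. S r * T r) (X * Y)"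
proof -
  have "(\<lambda>r. (S r * T r) $$ (i, j)) \<longlonglongrightarrow> (X * Y) $$ (i, j)" if "i < n" "j < l" for i j
  proof -
    have "(\<lambda>r. \<Sum>a<k. S r $$ (i, a) * T r $$ (a, j)) \<longlonglongrightarrow> (\<Sum>a<k. X $$ (i, a) * Y $$ (a, j))"
      using assms that unfolding mat_tendsto_def by (auto intro!: tendsto_sum tendsto_mult)
    then show ?thesis
      using assms that unfolding mat_tendsto_def
      by (simp add: index_mult_mat_sum[of _ n k _ l] del: index_mult_mat)
  qed
  then show ?thesis
    using assms unfolding mat_tendsto_def by (auto intro: mult_carrier_mat)
qed

lemma mat_tendsto_unique:
  assumes "mat_tendsto n k S X" "mat_tendsto n k S Y"
  shows "X = Y"
  using assms unfolding mat_tendsto_def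
  by (intro eq_matI) (auto, meson LIMSEQ_unique)

lemma mat_tendsto_Suc:
  "mat_tendsto n k S X \<Longrightarrow> mat_tendsto n k (\<lambda>r. S (Suc r)) X"
  unfolding mat_tendsto_def using LIMSEQ_Suc by blast

lemma mat_tendsto_le:
  assumes "mat_tendsto n k S X" "\<And>r. S r \<le> Y" "Y \<in> carrier_mat n k"
  shows "X \<le> Y"
  using assms unfolding mat_tendsto_def
  by (auto simp: mat_le_iff[of _ n k] intro!: LIMSEQ_le_const2[of "\<lambda>r. S r $$ (i, j)" for i j])

lemma mat_tendsto_ge:
  assumes "mat_tendsto n k S X" "\<And>r. Y \<le> S r" "Y \<in> carrier_mat n k"
  shows "Y \<le> X"
  using assms unfolding mat_tendsto_def
  by (auto simp: mat_le_iff[of _ n k] intro!: LIMSEQ_le_const[of "\<lambda>r. S r $$ (i, j)" for i j])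

lemma mat_tendsto_mono_bounded:
  fixes S :: "nat \<Rightarrow> real mat"
  assumes S: "\<And>r. S r \<in> carrier_mat n k" "\<And>r. S r \<le> S (Suc r)" "\<And>r. S r \<le> Y"
  shows "\<exists>X. mat_tendsto n k S X"
proof -
  have Y: "Y \<in> carrier_mat n k"
    using S(1,3) mat_le_carrier by blast
  have "convergent (\<lambda>r. S r $$ (i, j))" if "i < n" "j < k" for i j
  proof -
    have "incseq (\<lambda>r. S r $$ (i, j))"
      using S that by (intro incseq_SucI) (auto simp: mat_le_iff[of _ n k])
    moreover have "S r $$ (i, j) \<le> Y $$ (i, j)" for r
      using S(1) S(3)[of r] that Y by (auto simp: mat_le_iff[of _ n k])
    ultimately show ?thesis
      by (meson incseq_convergent convergentI)
  qed
  then have "mat_tendsto n k S (mat n k (\<lambda>(i, j). lim (\<lambda>r. S r $$ (i, j))))"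
    using S(1) by (auto simp: mat_tendsto_def convergent_LIMSEQ_iff)
  then show ?thesis by blast
qed

section \<open>Least solutions of quadratic matrix equations\<close>

text \<open>The iteration started at the zero matrix increases to a solution below \<open>Y\<close>, and the linear
  bound on a sequence of rows survives every step of it. The bound is applied three times: to the
  stationary rows \<open>\<pi>\<^sub>k\<close> and \<open>R\<close>, to a constant sequence, the invariant row of \<open>Am + A0 + A1\<close>, and
  the counterpart of \<open>R\<close> for the reflected walk, and, transposed, to the constant 1 and \<open>G\<close>.\<close>

lemma least_solution_bound:
  fixes C A D Y :: "real mat"
  assumes nn: "0\<^sub>m m m \<le> C" "0\<^sub>m m m \<le> A" "0\<^sub>m m m \<le> D" "0\<^sub>m m m \<le> Y"
    and Y: "Y = C + Y * A + Y * Y * D"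
  obtains X where "0\<^sub>m m m \<le> X" "X \<le> Y" "X = C + X * A + X * X * D"
    "\<forall>n u. (\<forall>k. 0\<^sub>m n m \<le> u k) \<longrightarrow>
       (\<forall>k. u k * C + u (Suc k) * A + u (Suc (Suc k)) * D \<le> u (Suc k)) \<longrightarrow>
       (\<forall>k. u k * X \<le> u (Suc k))"
proof -
  define \<Phi> where "\<Phi> X = C + X * A + X * X * D" for X
  define S where "S = rec_nat (0\<^sub>m m m) (\<lambda>_. \<Phi>)"
  have S0: "S 0 = 0\<^sub>m m m" and SS: "S (Suc r) = \<Phi> (S r)" for r
    by (auto simp: S_def)
  have c: "C \<in> carrier_mat m m" "A \<in> carrier_mat m m" "D \<in> carrier_mat m m" "Y \<in> carrier_mat m m"
    using nn by (auto simp: mat_nonneg_iff)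
  have mono: "\<Phi> X \<le> \<Phi> Z" if "0\<^sub>m m m \<le> X" "X \<le> Z" for X Z
  proof -
    have X: "X \<in> carrier_mat m m" using that by (auto simp: mat_nonneg_iff)
    have "X * X \<le> Z * Z" by (intro mat_mult_mono[of m m _ _ m] that)
    moreover have "0\<^sub>m m m \<le> X * X" using that by (intro mat_mult_nonneg)
    ultimately have "X * X * D \<le> Z * Z * D" "X * A \<le> Z * A"
      using that nn by (auto intro!: mat_mult_mono[of m m _ _ m])
    then show ?thesis
      unfolding \<Phi>_def using c X
      by (intro mat_add_mono[of _ _ _ _ m m]) (auto intro!: mult_carrier_mat[of _ m m] simp del: assoc_mult_mat)
  qed
  have nonneg: "0\<^sub>m m m \<le> S r" for r
  proof (induction r)
    case (Suc r)
    then show ?case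
      using nn by (auto simp: SS \<Phi>_def intro!: mat_add_nonneg mat_mult_nonneg)
  qed (simp add: S0)
  then have Sc: "S r \<in> carrier_mat m m" for r by (auto simp: mat_nonneg_iff)
  have SY: "S r \<le> Y" for r
  proof (induction r)
    case (Suc r)
    then show ?case using mono[OF nonneg Suc] Y by (simp add: SS \<Phi>_def)
  qed (use nn S0 in auto)
  have inc: "S r \<le> S (Suc r)" for r
  proof (induction r)
    case 0 then show ?case using nonneg[of 1] S0 by simp
  next
    case (Suc r) then show ?case using mono[OF nonneg Suc] by (simp add: SS)
  qed
  obtain X where X: "mat_tendsto m m S X"
    using mat_tendsto_mono_bounded[of S m m Y] Sc inc SY by blast
  have "mat_tendsto m m (\<lambda>r. \<Phi> (S r)) (\<Phi> X)"
    unfolding \<Phi>_def by (intro mat_tendsto_add mat_tendsto_mult[of _ m] mat_tendsto_const X c)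
  moreover have "mat_tendsto m m (\<lambda>r. \<Phi> (S r)) X"
    using mat_tendsto_Suc[OF X] by (simp add: SS)
  ultimately have X_eq: "X = \<Phi> X" using mat_tendsto_unique by blast
  show thesis
  proof
    show "0\<^sub>m m m \<le> X" using mat_tendsto_ge[OF X nonneg] by simp
    show "X \<le> Y" using mat_tendsto_le[OF X SY c(4)] .
    show "X = C + X * A + X * X * D" using X_eq by (simp add: \<Phi>_def)
    show "\<forall>n u. (\<forall>k. 0\<^sub>m n m \<le> u k) \<longrightarrow>
       (\<forall>k. u k * C + u (Suc k) * A + u (Suc (Suc k)) * D \<le> u (Suc k)) \<longrightarrow>
       (\<forall>k. u k * X \<le> u (Suc k))"
    proof (intro allI impI)
      fix n k and u :: "nat \<Rightarrow> real mat"
      assume "\<forall>k. 0\<^sub>m n m \<le> u k"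
        and "\<forall>k. u k * C + u (Suc k) * A + u (Suc (Suc k)) * D \<le> u (Suc k)"
      then have u: "\<And>k. 0\<^sub>m n m \<le> u k"
        "\<And>k. u k * C + u (Suc k) * A + u (Suc (Suc k)) * D \<le> u (Suc k)" by auto
      then have uc: "u k \<in> carrier_mat n m" for k by (auto simp: mat_nonneg_iff)
      have "u k * S r \<le> u (Suc k)" for r k
      proof (induction r arbitrary: k)
        case 0
        then show ?case using u(1)[of "Suc k"] uc[of k] by (simp add: S0)
      next
        case (Suc r)
        have nnS: "0\<^sub>m n m \<le> u k * S r" for k using u nonneg by (intro mat_mult_nonneg)
        have "u k * S (Suc r) = u k * C + u k * S r * A + u k * S r * S r * D"
          using uc[of k] c Sc[of r]
          by (simp add: SS \<Phi>_def mult_add_distrib_mat[of _ n m _ m] assoc_mult_mat[of _ n m _ m _ m]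
              assoc_mult_mat[of _ m m _ m _ m] assoc_add_mat[of _ n m])
        also have "\<dots> \<le> u k * C + u (Suc k) * A + u (Suc (Suc k)) * D"
        proof -
          have "u k * S r * S r \<le> u (Suc k) * S r"
            using nnS nonneg by (intro mat_mult_mono[of n m _ _ m] Suc) auto
          also have "\<dots> \<le> u (Suc (Suc k))" by (rule Suc)
          finally have "u k * S r * S r * D \<le> u (Suc (Suc k)) * D"
            using nn by (intro mat_mult_mono[of n m _ _ m] mat_mult_nonneg[of n m] nnS nonneg) auto
          moreover have "u k * S r * A \<le> u (Suc k) * A"
            using nn by (intro mat_mult_mono[of n m _ _ m] Suc nnS) auto
          ultimately show ?thesis
            using uc Sc c by (intro mat_add_mono[of _ _ _ _ n m] add_carrier_mat mult_carrier_mat[of _ n m]) auto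
        qed
        also have "\<dots> \<le> u (Suc k)" by (rule u)
        finally show ?case .
      qed
      then show "u k * X \<le> u (Suc k)"
        by (intro mat_tendsto_le[OF mat_tendsto_mult[OF mat_tendsto_const X]]) (auto intro: uc)
    qed
  qed
qed

section \<open>Inverses and nonnegative inverses\<close>

lemma mat_inv_eqs:
  fixes A :: "'a :: field mat"
  assumes A: "A \<in> carrier_mat n n" and B: "B \<in> carrier_mat n n" and AB: "A * B = 1\<^sub>m n"
  shows "mat_inv A = B" "B * A = 1\<^sub>m n"
proof -
  show BA: "B * A = 1\<^sub>m n" by (rule mat_mult_left_right_inverse[OF A B AB])
  have "A \<in> Units (ring_mat TYPE('a) n ())"
    using A B AB BA unfolding Units_def by (auto simp: ring_mat_simps)
  then obtain C where C: "mat_inverse A = Some C"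
    using mat_inverse(1)[OF A, of "()"] by (cases "mat_inverse A") auto
  from mat_inverse(2)[OF A C] have "C * A = 1\<^sub>m n" and Cc: "C \<in> carrier_mat n n" by auto
  then have "C = C * (A * B)" using AB by simp
  also have "\<dots> = (C * A) * B" using A B Cc by (simp add: assoc_mult_mat[of _ n n _ n _ n])
  also have "\<dots> = B" using \<open>C * A = 1\<^sub>m n\<close> B by simp
  finally show "mat_inv A = B" using C by simp
qed

lemma invertible_mat_inv:
  fixes A :: "'a :: field mat"
  assumes A: "A \<in> carrier_mat n n" and "invertible_mat A"
  shows "mat_inv A \<in> carrier_mat n n" "A * mat_inv A = 1\<^sub>m n" "mat_inv A * A = 1\<^sub>m n"
proof -
  from assms obtain B where B: "A * B = 1\<^sub>m n" "B * A = 1\<^sub>m (dim_row B)"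
    unfolding invertible_mat_def inverts_mat_def by auto
  then have "dim_row (B * A) = dim_row B" "dim_col (B * A) = dim_row B" "dim_col (A * B) = n"
    by auto
  then have "B \<in> carrier_mat n n" using A by auto
  then have "mat_inv A = B" "B * A = 1\<^sub>m n" using mat_inv_eqs[OF A _ B(1)] by auto
  then show "mat_inv A \<in> carrier_mat n n" "A * mat_inv A = 1\<^sub>m n" "mat_inv A * A = 1\<^sub>m n"
    using B(1) \<open>B \<in> carrier_mat n n\<close> by auto
qed

lemma injective_mat_inverse:
  fixes A :: "'a :: field mat"
  assumes A: "A \<in> carrier_mat n n"
    and inj: "\<And>v. v \<in> carrier_vec n \<Longrightarrow> A *\<^sub>v v = 0\<^sub>v n \<Longrightarrow> v = 0\<^sub>v n"
  obtains B where "B \<in> carrier_mat n n" "A * B = 1\<^sub>m n" "B * A = 1\<^sub>m n"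
proof -
  have "det A \<noteq> 0"
    using inj det_0_iff_vec_prod_zero_field[OF A] by auto
  from det_non_zero_imp_unit[OF A this, of "()"] show thesis
    using that unfolding Units_def by (auto simp: ring_mat_simps)
qed

text \<open>For nonnegative \<open>U\<close> this says that \<open>1 - U\<close> is a nonsingular M-matrix. It is stated with
  superharmonic vectors because the maximum principle of the walk yields it in this form.\<close>

definition min_principle :: "nat \<Rightarrow> real mat \<Rightarrow> bool" where
  "min_principle m U \<longleftrightarrow> 0\<^sub>m m m \<le> U \<and>
     (\<forall>v \<in> carrier_vec m. (\<forall>a<m. (U *\<^sub>v v) $ a \<le> v $ a) \<longrightarrow> (\<forall>a<m. 0 \<le> v $ a))"

text \<open>If \<open>v\<close> is superharmonic for the smaller matrix then its negative part is so
  for the larger one.\<close>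

lemma min_principle_mono:
  assumes "min_principle m V" "0\<^sub>m m m \<le> U" "U \<le> V"
  shows "min_principle m U"
  unfolding min_principle_def
proof (intro conjI ballI impI)
  show "0\<^sub>m m m \<le> U" by fact
  fix v assume v: "v \<in> carrier_vec m" and sup: "\<forall>a<m. (U *\<^sub>v v) $ a \<le> v $ a"
  have U: "U \<in> carrier_mat m m" "V \<in> carrier_mat m m"
    using assms by (auto simp: min_principle_def mat_nonneg_iff)
  define w where "w = vec m (\<lambda>a. min (v $ a) 0)"
  have w: "w \<in> carrier_vec m" by (simp add: w_def)
  have w_nth: "w $ a = min (v $ a) 0" if "a < m" for a using that by (simp add: w_def)
  have "(V *\<^sub>v w) $ a \<le> w $ a" if a: "a < m" for a
  proof -
    note V_w = index_mult_mat_vec_sum[OF U(2) w a] and U_w = index_mult_mat_vec_sum[OF U(1) w a]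
      and U_v = index_mult_mat_vec_sum[OF U(1) v a]
    have entries: "0 \<le> U $$ (a, b)" "U $$ (a, b) \<le> V $$ (a, b)" if "b < m" for b
      using assms(2,3) a that unfolding mat_nonneg_iff mat_le_iff[OF U] by auto
    have "(V *\<^sub>v w) $ a \<le> (U *\<^sub>v w) $ a"
      unfolding V_w U_w using entries by (intro sum_mono mult_right_mono_neg) (auto simp: w_nth)
    moreover have "(U *\<^sub>v w) $ a \<le> (U *\<^sub>v v) $ a"
      unfolding U_w U_v using entries by (intro sum_mono mult_left_mono) (auto simp: w_nth)
    moreover have "(U *\<^sub>v w) $ a \<le> 0"
      unfolding U_w using entries by (intro sum_nonpos mult_nonneg_nonpos) (auto simp: w_nth)
    moreover have "(U *\<^sub>v v) $ a \<le> v $ a" using sup a by blast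
    ultimately show ?thesis unfolding w_nth[OF a] by linarith
  qed
  then have "\<forall>a<m. 0 \<le> w $ a"
    using assms(1) w unfolding min_principle_def by blast
  then show "\<forall>a<m. 0 \<le> v $ a" by (auto simp: w_def)
qed

text \<open>Applied to \<open>v\<close> and \<open>- v\<close> the principle makes \<open>1 - U\<close> injective; applied to the columns of the
  inverse it makes them nonnegative.\<close>

lemma min_principle_inverse:
  assumes "min_principle m U"
  obtains N where "0\<^sub>m m m \<le> N" "(1\<^sub>m m - U) * N = 1\<^sub>m m" "N * (1\<^sub>m m - U) = 1\<^sub>m m"
proof -
  have U: "U \<in> carrier_mat m m" using assms by (auto simp: min_principle_def mat_nonneg_iff)
  have sup: "\<forall>a<m. 0 \<le> v $ a"
    if v: "v \<in> carrier_vec m" and le: "\<forall>a<m. 0 \<le> ((1\<^sub>m m - U) *\<^sub>v v) $ a" for v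
  proof -
    have "(1\<^sub>m m - U) *\<^sub>v v = v - U *\<^sub>v v"
      using U v by (simp add: minus_mult_distrib_mat_vec[of _ m m])
    then have "\<forall>a<m. (U *\<^sub>v v) $ a \<le> v $ a" using le U v by (auto simp del: index_mult_mat_vec)
    then show ?thesis using assms v unfolding min_principle_def by blast
  qed
  obtain N where N: "N \<in> carrier_mat m m" "(1\<^sub>m m - U) * N = 1\<^sub>m m" "N * (1\<^sub>m m - U) = 1\<^sub>m m"
  proof (rule injective_mat_inverse[of "1\<^sub>m m - U" m])
    show "1\<^sub>m m - U \<in> carrier_mat m m" using U by auto
    fix v :: "real vec" assume v: "v \<in> carrier_vec m" and z: "(1\<^sub>m m - U) *\<^sub>v v = 0\<^sub>v m"
    have "(1\<^sub>m m - U) *\<^sub>v (- v) = - ((1\<^sub>m m - U) *\<^sub>v v)"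
      by (rule mult_mat_vec_uminus[OF minus_carrier_mat[OF U] v])
    then have "(1\<^sub>m m - U) *\<^sub>v (- v) = 0\<^sub>v m" using z by simp
    then show "v = 0\<^sub>v m" using sup[OF v] sup[of "- v"] v z
      by (intro eq_vecI) (auto simp del: index_mult_mat_vec intro: antisym)
  qed
  have "0 \<le> N $$ (a, b)" if "a < m" "b < m" for a b
  proof -
    have "(1\<^sub>m m - U) *\<^sub>v col N b = col ((1\<^sub>m m - U) * N) b"
      using N U that by (intro col_mult2[symmetric, of _ m m _ m]) auto
    then have "\<forall>a<m. 0 \<le> ((1\<^sub>m m - U) *\<^sub>v col N b) $ a"
      using N(2) that by (auto simp del: index_mult_mat_vec)
    then have "\<forall>a<m. 0 \<le> col N b $ a" using sup[of "col N b"] N(1) by auto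
    then show ?thesis using that N(1) by auto
  qed
  then show thesis using that[of N] N by (auto simp: mat_nonneg_iff)
qed

section \<open>Skip-free random walks\<close>

lemma mat_minus_eq_zero_iff:
  fixes A B :: "'a :: group_add mat"
  assumes "A \<in> carrier_mat n k" "B \<in> carrier_mat n k"
  shows "A - B = 0\<^sub>m n k \<longleftrightarrow> B = A"
  using assms by (auto simp: mat_eq_iff)

lemma mat_diff_eq_iff:
  fixes A B C :: "'a :: ab_group_add mat"
  assumes "A \<in> carrier_mat n k" "B \<in> carrier_mat n k" "C \<in> carrier_mat n k"
  shows "A - B = C \<longleftrightarrow> A = C + B"
  using assms by (auto simp: mat_eq_iff algebra_simps)

lemma quadratic_left_form:
  fixes C A D X :: "real mat"
  assumes "C \<in> carrier_mat m m" "A \<in> carrier_mat m m" "D \<in> carrier_mat m m" "X \<in> carrier_mat m m"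
  shows "C + (A - 1\<^sub>m m) * X + D * X ^\<^sub>m 2 = 0\<^sub>m m m \<longleftrightarrow> X = C + A * X + D * (X * X)"
proof -
  have 1: "(A - 1\<^sub>m m) * X = A * X - X" and 2: "X ^\<^sub>m 2 = X * X"
    using assms by (simp_all add: minus_mult_distrib_mat[of _ m m _ _ m] numeral_2_eq_2)
  have "C + (A - 1\<^sub>m m) * X + D * X ^\<^sub>m 2 = (C + A * X + D * (X * X)) - X"
    unfolding 1 2 using assms by (intro eq_matI) auto
  moreover have "C + A * X + D * (X * X) \<in> carrier_mat m m" using assms by auto
  ultimately show ?thesis
    using mat_minus_eq_zero_iff[OF _ assms(4)] by simp
qed

lemma quadratic_right_form:
  fixes C A D X :: "real mat"
  assumes "C \<in> carrier_mat m m" "A \<in> carrier_mat m m" "D \<in> carrier_mat m m" "X \<in> carrier_mat m m"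
  shows "C + X * (A - 1\<^sub>m m) + X ^\<^sub>m 2 * D = 0\<^sub>m m m \<longleftrightarrow> X = C + X * A + X * X * D"
proof -
  have 1: "X * (A - 1\<^sub>m m) = X * A - X" and 2: "X ^\<^sub>m 2 = X * X"
    using assms by (simp_all add: mult_minus_distrib_mat[of _ m m _ m] numeral_2_eq_2)
  have "C + X * (A - 1\<^sub>m m) + X ^\<^sub>m 2 * D = (C + X * A + X * X * D) - X"
    unfolding 1 2 using assms by (intro eq_matI) auto
  moreover have "C + X * A + X * X * D \<in> carrier_mat m m" using assms by auto
  ultimately show ?thesis
    using mat_minus_eq_zero_iff[OF _ assms(4)] by simp
qed

text \<open>The case of equality in the trivial estimate of an average, for the three directions of a
  step.\<close>

lemma average_le_lower_bound:
  fixes p q r x y z :: "nat \<Rightarrow> real"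
  assumes nn: "\<And>b. b < m \<Longrightarrow> 0 \<le> p b \<and> 0 \<le> q b \<and> 0 \<le> r b"
    and tot: "(\<Sum>b<m. p b + q b + r b) = 1"
    and ge: "\<And>b. b < m \<Longrightarrow> \<mu> \<le> x b \<and> \<mu> \<le> y b \<and> \<mu> \<le> z b"
    and le: "(\<Sum>b<m. p b * x b + q b * y b + r b * z b) \<le> \<mu>"
    and b: "b < m"
  shows "0 < p b \<Longrightarrow> x b = \<mu>" "0 < q b \<Longrightarrow> y b = \<mu>" "0 < r b \<Longrightarrow> z b = \<mu>"
proof -
  define d where "d b = p b * (x b - \<mu>) + q b * (y b - \<mu>) + r b * (z b - \<mu>)" for b
  have "(\<Sum>b<m. d b) = (\<Sum>b<m. p b * x b + q b * y b + r b * z b) - (\<Sum>b<m. p b + q b + r b) * \<mu>"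
    unfolding d_def sum_distrib_right sum_subtractf[symmetric] by (intro sum.cong) (auto simp: algebra_simps)
  also have "\<dots> \<le> 0" using le tot by simp
  finally have le0: "(\<Sum>b<m. d b) \<le> 0" .
  have pos: "0 \<le> p b * (x b - \<mu>) \<and> 0 \<le> q b * (y b - \<mu>) \<and> 0 \<le> r b * (z b - \<mu>)" if "b < m" for b
    using nn[OF that] ge[OF that] by simp
  then have "\<And>b. b < m \<Longrightarrow> 0 \<le> d b" unfolding d_def by force
  moreover from this have "(\<Sum>b<m. d b) = 0" using le0 by (intro antisym sum_nonneg) auto
  ultimately have "d b = 0" using b sum_nonneg_eq_0_iff[of "{..<m}" d] by auto
  then have "p b * (x b - \<mu>) = 0" "q b * (y b - \<mu>) = 0" "r b * (z b - \<mu>) = 0"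
    using pos[OF b] unfolding d_def by linarith+
  then show "0 < p b \<Longrightarrow> x b = \<mu>" "0 < q b \<Longrightarrow> y b = \<mu>" "0 < r b \<Longrightarrow> z b = \<mu>" by auto
qed

definition "state_closed S p K \<longleftrightarrow> (\<forall>s\<in>K. \<forall>t\<in>S. 0 < p s t \<longrightarrow> t \<in> K)"

lemma irreducible_closed:
  assumes irr: "irreducible_on S p" and K: "state_closed S p K" "s \<in> K" "s \<in> S" "t \<in> S"
  shows "t \<in> K"
proof -
  have "(s, t) \<in> {(u, v). u \<in> S \<and> v \<in> S \<and> 0 < p u v}\<^sup>*"
    using irr K by (auto simp: irreducible_on_def reaches_def)
  then show ?thesis
    using K by induction (auto simp: state_closed_def)
qed

locale skip_free_walk =
  fixes m :: nat and Am A0 A1 :: "real mat"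
  assumes nonneg: "0\<^sub>m m m \<le> Am" "0\<^sub>m m m \<le> A0" "0\<^sub>m m m \<le> A1"
    and row_sums: "\<And>a. a < m \<Longrightarrow> (\<Sum>b<m. A1 $$ (a, b) + A0 $$ (a, b) + Am $$ (a, b)) = 1"
    and irreducible: "irreducible_on (UNIV \<times> {..<m}) (doubly_infinite_qbd_trans Am A0 A1)"
begin

lemma carriers [simp]: "Am \<in> carrier_mat m m" "A0 \<in> carrier_mat m m" "A1 \<in> carrier_mat m m"
  using nonneg by (auto simp: mat_nonneg_iff)

lemmas square_simps [simp] =
  mult_carrier_mat[of _ m m _ m] minus_carrier_mat[of _ m m] mult_mat_vec_carrier[of _ m m]
  assoc_mult_mat[of _ m m _ m _ m] assoc_mult_mat_vec[of _ m m _ m] assoc_add_mat[of _ m m]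
  carrier_matD[of _ m m] left_mult_one_mat[of _ m m] right_mult_one_mat[of _ m m]

lemmas square_distribs =
  mult_add_distrib_mat[of _ m m _ m] add_mult_distrib_mat[of _ m m _ _ m]
  minus_mult_distrib_mat[of _ m m _ _ m] mult_minus_distrib_mat[of _ m m _ m]
  add_mult_distrib_mat_vec[of _ m m]

lemma entry_nonneg:
  assumes "a < m" "b < m"
  shows "0 \<le> A1 $$ (a, b) \<and> 0 \<le> A0 $$ (a, b) \<and> 0 \<le> Am $$ (a, b)"
  using nonneg assms by (auto simp: mat_nonneg_iff)

text \<open>With the identity moved to the other side all terms of the quadratic equations are nonnegative,
  as the monotonicity arguments need.\<close>

definition solves_G :: "real mat \<Rightarrow> bool" where
  "solves_G X \<longleftrightarrow> 0\<^sub>m m m \<le> X \<and> X = Am + A0 * X + A1 * (X * X)"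

definition solves_R :: "real mat \<Rightarrow> bool" where
  "solves_R X \<longleftrightarrow> 0\<^sub>m m m \<le> X \<and> X = A1 + X * A0 + X * X * Am"

lemma minimal_G_iff:
  "minimal_nonneg_solution m (\<lambda>X. Am + (A0 - 1\<^sub>m m) * X + A1 * X ^\<^sub>m 2) X \<longleftrightarrow>
     solves_G X \<and> (\<forall>Y. solves_G Y \<longrightarrow> X \<le> Y)"
  unfolding minimal_nonneg_solution_def solves_G_def
  using quadratic_left_form[of Am m A0 A1] by (auto simp: mat_nonneg_iff)

lemma minimal_R_iff:
  "minimal_nonneg_solution m (\<lambda>X. A1 + X * (A0 - 1\<^sub>m m) + X ^\<^sub>m 2 * Am) X \<longleftrightarrow>
     solves_R X \<and> (\<forall>Y. solves_R Y \<longrightarrow> X \<le> Y)"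
  unfolding minimal_nonneg_solution_def solves_R_def
  using quadratic_right_form[of A1 m A0 Am] by (auto simp: mat_nonneg_iff)

lemma solves_G_pow:
  assumes G: "solves_G G" and v: "v \<in> carrier_vec m"
  shows "G ^\<^sub>m Suc n *\<^sub>v v = G *\<^sub>v (G ^\<^sub>m n *\<^sub>v v)"
    and "A1 *\<^sub>v (G ^\<^sub>m Suc (Suc n) *\<^sub>v v) + A0 *\<^sub>v (G ^\<^sub>m Suc n *\<^sub>v v) + Am *\<^sub>v (G ^\<^sub>m n *\<^sub>v v) = G ^\<^sub>m Suc n *\<^sub>v v"
proof -
  have Gn: "0\<^sub>m m m \<le> G" and Geq: "G = Am + A0 * G + A1 * (G * G)"
    using G unfolding solves_G_def by blast+
  then have Gc [simp]: "G \<in> carrier_mat m m" by (simp only: mat_nonneg_iff)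
  define f where "f n = G ^\<^sub>m n *\<^sub>v v" for n
  have fc [simp]: "f n \<in> carrier_vec m" for n using v by (simp add: f_def)
  then have [simp]: "dim_vec (f n) = m" for n by auto
  have fS: "f (Suc n) = G *\<^sub>v f n" for n
    unfolding f_def mat_pow_Suc_left[OF Gc] using v by simp
  then show "G ^\<^sub>m Suc n *\<^sub>v v = G *\<^sub>v (G ^\<^sub>m n *\<^sub>v v)" by (simp only: f_def)
  have "f (Suc n) = (Am + A0 * G + A1 * (G * G)) *\<^sub>v f n"
    unfolding fS by (subst (1) Geq) simp
  also have "\<dots> = Am *\<^sub>v f n + A0 *\<^sub>v f (Suc n) + A1 *\<^sub>v f (Suc (Suc n))"
    unfolding fS by (simp add: square_distribs assoc_add_vec[of _ m])
  finally have eq: "f (Suc n) = \<dots>" .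
  have "A1 *\<^sub>v f (Suc (Suc n)) + A0 *\<^sub>v f (Suc n) + Am *\<^sub>v f n = f (Suc n)"
    by (rule trans[OF _ eq[symmetric]], intro eq_vecI) (auto simp del: index_mult_mat_vec)
  then show "A1 *\<^sub>v (G ^\<^sub>m Suc (Suc n) *\<^sub>v v) + A0 *\<^sub>v (G ^\<^sub>m Suc n *\<^sub>v v) + Am *\<^sub>v (G ^\<^sub>m n *\<^sub>v v) = G ^\<^sub>m Suc n *\<^sub>v v"
    by (simp only: f_def)
qed

text \<open>After transposition the column \<open>1\<close> becomes a row satisfying the premise of
  the bound on least solutions.\<close>

lemma minimal_G_row_sums:
  assumes G: "solves_G G" and min: "\<And>Y. solves_G Y \<Longrightarrow> G \<le> Y" and a: "a < m"
  shows "(\<Sum>b<m. G $$ (a, b)) \<le> 1"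
proof -
  let ?T = "transpose_mat :: real mat \<Rightarrow> real mat"
  have Gn: "0\<^sub>m m m \<le> G" and Geq: "G = Am + A0 * G + A1 * (G * G)"
    using G by (auto simp: solves_G_def)
  then have Gc [simp]: "G \<in> carrier_mat m m" by (simp only: mat_nonneg_iff)
  have nnT: "0\<^sub>m m m \<le> ?T X" if "0\<^sub>m m m \<le> X" for X
    using that by (auto simp: mat_nonneg_iff)
  have TG: "?T (Am + A0 * X + A1 * (X * X)) = ?T Am + ?T X * ?T A0 + ?T X * ?T X * ?T A1"
    if X: "X \<in> carrier_mat m m" for X
    using X by (simp add: transpose_add[of _ m m] transpose_mult[of _ m m _ m])
  have "?T G = ?T Am + ?T G * ?T A0 + ?T G * ?T G * ?T A1"
    by (subst TG[OF Gc, symmetric]) (rule arg_cong[of _ _ ?T, OF Geq])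
  then obtain X where X: "0\<^sub>m m m \<le> X" "X \<le> ?T G" "X = ?T Am + X * ?T A0 + X * X * ?T A1"
    and bd: "\<forall>n u. (\<forall>k. 0\<^sub>m n m \<le> u k) \<longrightarrow>
       (\<forall>k. u k * ?T Am + u (Suc k) * ?T A0 + u (Suc (Suc k)) * ?T A1 \<le> u (Suc k)) \<longrightarrow>
       (\<forall>k. u k * X \<le> u (Suc k))"
    by (rule least_solution_bound[OF nnT[OF nonneg(1)] nnT[OF nonneg(2)] nnT[OF nonneg(3)] nnT[OF Gn]])
  have Xc: "X \<in> carrier_mat m m" using X(1) by (auto simp: mat_nonneg_iff)
  have "?T X = Am + A0 * ?T X + A1 * (?T X * ?T X)"
    using TG[of "?T X"] Xc X(3) by (metis Matrix.transpose_transpose transpose_carrier_mat)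
  then have "solves_G (?T X)" using nnT X(1) by (simp add: solves_G_def)
  then have "G \<le> ?T X" by (rule min)
  moreover have "?T X \<le> G" using transpose_mat_mono[OF X(2)] by simp
  ultimately have GX: "G = ?T X" by simp
  define e :: "real mat" where "e = mat 1 m (\<lambda>_. 1)"
  have ec [simp]: "e \<in> carrier_mat 1 m" by (simp add: e_def)
  have eX: "(e * ?T Y) $$ (0, b) = (\<Sum>c<m. Y $$ (b, c))" if "Y \<in> carrier_mat m m" "b < m" for Y b
    using that by (subst index_mult_mat_sum[of _ 1 m _ m]) (auto simp: e_def intro!: sum.cong)
  have "e * ?T Am + e * ?T A0 + e * ?T A1 \<le> e"
  proof (subst mat_le_iff[of _ 1 m, OF _ ec])
    show "\<forall>i<1. \<forall>b<m. (e * ?T Am + e * ?T A0 + e * ?T A1) $$ (i, b) \<le> e $$ (i, b)"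
    proof (intro allI impI)
      fix i b :: nat assume "i < 1" and b: "b < m"
      then have "(e * ?T Am + e * ?T A0 + e * ?T A1) $$ (i, b) =
          (e * ?T Am) $$ (0, b) + (e * ?T A0) $$ (0, b) + (e * ?T A1) $$ (0, b)"
        by (simp add: e_def del: index_mult_mat(1))
      also have "\<dots> = 1"
        unfolding eX[OF carriers(1) b] eX[OF carriers(2) b] eX[OF carriers(3) b]
        using row_sums[OF b] by (simp add: sum.distrib)
      finally show "(e * ?T Am + e * ?T A0 + e * ?T A1) $$ (i, b) \<le> e $$ (i, b)"
        using \<open>i < 1\<close> b by (simp add: e_def)
    qed
  qed (intro add_carrier_mat mult_carrier_mat[of _ 1 m] ec; simp)
  moreover have "0\<^sub>m 1 m \<le> e" by (simp add: mat_nonneg_iff e_def)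
  ultimately have "e * X \<le> e" by (intro bd[rule_format, of 1 "\<lambda>_. e"])
  then have "(e * X) $$ (0, a) \<le> e $$ (0, a)" using a Xc by (auto simp: less_eq_mat_def e_def simp del: index_mult_mat(1))
  then show ?thesis using eX[OF Gc a] GX a by (simp add: e_def)
qed

text \<open>The vector \<open>v\<close> on level 1, continued by \<open>G\<close> to the higher levels and by 0 to level 0, is
  superharmonic on the positive levels. A negative minimum would be taken on a set of positive levels
  that the walk cannot leave, contrary to irreducibility.\<close>

lemma min_principle_U:
  assumes G: "solves_G G" and sub: "\<And>a. a < m \<Longrightarrow> (\<Sum>b<m. G $$ (a, b)) \<le> 1"
  shows "min_principle m (A0 + A1 * G)"
  unfolding min_principle_def
proof (intro conjI ballI impI allI)
  have Gn: "0\<^sub>m m m \<le> G" and Gc [simp]: "G \<in> carrier_mat m m"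
    using G by (auto simp: solves_G_def mat_nonneg_iff)
  show "0\<^sub>m m m \<le> A0 + A1 * G" by (intro mat_add_nonneg mat_mult_nonneg[of m m] nonneg Gn)
  fix v a assume v [simp]: "v \<in> carrier_vec m" and sup: "\<forall>a<m. ((A0 + A1 * G) *\<^sub>v v) $ a \<le> v $ a"
    and a: "a < m"
  show "0 \<le> v $ a"
  proof (rule ccontr)
    assume "\<not> 0 \<le> v $ a"
    define \<mu> where "\<mu> = Min ((\<lambda>a. v $ a) ` {..<m})"
    have "\<mu> \<in> (\<lambda>a. v $ a) ` {..<m}" unfolding \<mu>_def using a by (intro Min_in) auto
    then obtain a0 where a0: "a0 < m" "v $ a0 = \<mu>" by auto
    have vmu: "\<mu> \<le> v $ b" if "b < m" for b unfolding \<mu>_def using that by (intro Min_le) auto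
    have neg: "\<mu> < 0" using vmu[OF a] \<open>\<not> 0 \<le> v $ a\<close> by simp
    define f where "f n = G ^\<^sub>m n *\<^sub>v v" for n
    have fc [simp]: "f n \<in> carrier_vec m" for n by (simp add: f_def)
    then have [simp]: "dim_vec (f n) = m" for n by auto
    have f0: "f 0 = v" by (simp add: f_def)
    have fS: "f (Suc n) = G *\<^sub>v f n" for n
      unfolding f_def by (rule solves_G_pow(1)[OF G v])
    have fmu: "\<mu> \<le> f n $ b" if "b < m" for n b
      using that
    proof (induction n arbitrary: b)
      case 0 then show ?case using vmu by (simp add: f0)
    next
      case (Suc n)
      have "\<mu> \<le> (\<Sum>c<m. G $$ (b, c)) * \<mu>"
        using mult_right_mono_neg[OF sub[OF Suc.prems], of \<mu>] neg by simp
      also have "\<dots> \<le> (\<Sum>c<m. G $$ (b, c) * f n $ c)"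
        unfolding sum_distrib_right using Suc Gn
        by (intro sum_mono mult_left_mono) (auto simp: mat_nonneg_iff)
      finally show ?case
        unfolding fS using Suc.prems by (subst index_mult_mat_vec_sum[of _ m m]) auto
    qed
    have comb: "(\<Sum>b<m. A1 $$ (c, b) * x $ b + A0 $$ (c, b) * y $ b + Am $$ (c, b) * z $ b) =
        (A1 *\<^sub>v x + A0 *\<^sub>v y + Am *\<^sub>v z) $ c"
      if "c < m" "x \<in> carrier_vec m" "y \<in> carrier_vec m" "z \<in> carrier_vec m" for c x y z
      using that by (simp add: index_mult_mat_vec_sum[of _ m m] sum.distrib del: index_mult_mat_vec)
    have harm: "A1 *\<^sub>v f (Suc (Suc n)) + A0 *\<^sub>v f (Suc n) + Am *\<^sub>v f n = f (Suc n)" for n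
      unfolding f_def by (rule solves_G_pow(2)[OF G v])
    \<comment> \<open>\<open>f n\<close> sits on level \<open>n + 1\<close>, and \<open>h n\<close> on the level below it.\<close>
    define h where "h n = (case n of 0 \<Rightarrow> 0\<^sub>v m | Suc k \<Rightarrow> f k)" for n
    have hc [simp]: "h n \<in> carrier_vec m" for n by (simp add: h_def split: nat.split)
    have hmu: "\<mu> \<le> h n $ b" if "b < m" for n b
      using that fmu neg by (simp add: h_def split: nat.split)
    have superharm: "(A1 *\<^sub>v f (Suc n) + A0 *\<^sub>v f n + Am *\<^sub>v h n) $ b \<le> f n $ b" if "b < m" for n b
    proof (cases n)
      case 0
      have "(A0 + A1 * G) *\<^sub>v v = A0 *\<^sub>v f 0 + A1 *\<^sub>v f (Suc 0)"
        unfolding fS by (simp add: square_distribs f0)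
      moreover have "Am *\<^sub>v h 0 = 0\<^sub>v m" by (auto simp: h_def)
      ultimately show ?thesis using sup that 0 by (auto simp: f0 add.commute simp del: index_mult_mat_vec)
    next
      case (Suc k) then show ?thesis using harm[of k] by (simp add: h_def)
    qed
    define K where "K = {(i, b). 1 \<le> i \<and> b < m \<and> f (nat (i - 1)) $ b = \<mu>}"
    have "state_closed (UNIV \<times> {..<m}) (doubly_infinite_qbd_trans Am A0 A1) K"
      unfolding state_closed_def
    proof (intro ballI impI)
      fix s t assume s: "s \<in> K" and t: "t \<in> (UNIV :: int set) \<times> {..<m}"
        and pos: "0 < doubly_infinite_qbd_trans Am A0 A1 s t"
      obtain i c where ic: "s = (i, c)" "1 \<le> i" "c < m" "f (nat (i - 1)) $ c = \<mu>"
        using s by (auto simp: K_def)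
      obtain j b where jb: "t = (j, b)" "b < m" using t by auto
      define n where "n = nat (i - 1)"
      have le: "(\<Sum>b<m. A1 $$ (c, b) * f (Suc n) $ b + A0 $$ (c, b) * f n $ b + Am $$ (c, b) * h n $ b) \<le> \<mu>"
        using superharm[OF ic(3), of n] ic(3,4) by (subst comb) (auto simp: n_def)
      note eq = average_le_lower_bound[where p = "\<lambda>b. A1 $$ (c, b)" and q = "\<lambda>b. A0 $$ (c, b)"
          and r = "\<lambda>b. Am $$ (c, b)" and m = m, OF entry_nonneg[OF ic(3)] row_sums[OF ic(3)] _ le jb(2)]
      have ge: "\<mu> \<le> f (Suc n) $ b \<and> \<mu> \<le> f n $ b \<and> \<mu> \<le> h n $ b" if "b < m" for b
        using fmu hmu that by auto
      consider "j = i" "0 < A0 $$ (c, b)" | "j = i + 1" "0 < A1 $$ (c, b)" | "j = i - 1" "0 < Am $$ (c, b)"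
        using pos ic(1) jb(1) by (auto simp: doubly_infinite_qbd_trans_def split: if_splits)
      then show "t \<in> K"
      proof cases
        case 1 then show ?thesis using eq(2) ge jb ic by (auto simp: K_def n_def)
      next
        case 2
        moreover have "nat (j - 1) = Suc n" using 2 ic(2) by (simp add: n_def)
        ultimately show ?thesis using eq(1) ge jb ic by (auto simp: K_def)
      next
        case 3
        then have hm: "h n $ b = \<mu>" using eq(3) ge by auto
        then obtain k where k: "n = Suc k" using neg jb(2) by (cases n) (auto simp: h_def)
        then have "nat (j - 1) = k" "1 \<le> j" using 3 ic(2) by (auto simp: n_def)
        then show ?thesis using hm k jb by (auto simp: K_def h_def)
      qed
    qed
    moreover have "(1, a0) \<in> K" using a0 by (simp add: K_def f0)
    ultimately have "(0, a0) \<in> K"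
      using irreducible_closed[OF irreducible, of K "(1, a0)" "(0, a0)"] a0 by auto
    then show False by (simp add: K_def)
  qed
qed

text \<open>\<open>N = (1 - U)\<^sup>-\<^sup>1\<close> counts the visits to a level before the first one below it, whence
  \<open>G = N Am\<close> and the candidate \<open>A1 N\<close> for \<open>R\<close>. The last conclusion identifies the candidate with the
  minimal solution of the equation for \<open>R\<close>: from a solution \<open>X \<le> A1 N\<close> one gets
  \<open>V = A0 + X Am \<le> U\<close> and the solution \<open>Y = (1 - V)\<^sup>-\<^sup>1 Am\<close> of the equation for \<open>G\<close>, with
  \<open>V = A0 + A1 Y\<close>; minimality of \<open>G\<close> forces \<open>U \<le> V\<close>.\<close>

lemma minimal_G_factorization:
  assumes G: "solves_G G" and min: "\<And>Y. solves_G Y \<Longrightarrow> G \<le> Y"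
  obtains N where "0\<^sub>m m m \<le> N"
    "(1\<^sub>m m - (A0 + A1 * G)) * N = 1\<^sub>m m" "N * (1\<^sub>m m - (A0 + A1 * G)) = 1\<^sub>m m"
    "G = N * Am" "solves_R (A1 * N)" "\<forall>X. solves_R X \<longrightarrow> X \<le> A1 * N \<longrightarrow> X = A1 * N"
proof -
  define U where "U = A0 + A1 * G"
  have Gn: "0\<^sub>m m m \<le> G" and Gc [simp]: "G \<in> carrier_mat m m" and
    Geq: "G = Am + A0 * G + A1 * (G * G)"
    using G by (auto simp: solves_G_def mat_nonneg_iff)
  have Uc [simp]: "U \<in> carrier_mat m m" by (simp add: U_def)
  have mpU: "min_principle m U"
    unfolding U_def using min_principle_U[OF G] minimal_G_row_sums[OF G min] by blast
  then obtain N where N: "0\<^sub>m m m \<le> N" "(1\<^sub>m m - U) * N = 1\<^sub>m m" "N * (1\<^sub>m m - U) = 1\<^sub>m m"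
    by (rule min_principle_inverse)
  have Nc [simp]: "N \<in> carrier_mat m m" using N(1) by (auto simp: mat_nonneg_iff)
  have "Am = (1\<^sub>m m - U) * G"
  proof -
    have "(1\<^sub>m m - U) * G = G - (A0 * G + A1 * (G * G))"
      by (simp add: U_def square_distribs)
    also have "\<dots> = Am" using Geq by (simp add: mat_diff_eq_iff[of _ m m])
    finally show ?thesis by simp
  qed
  then have NAm: "G = N * Am"
    using N(3) by (simp add: assoc_mult_mat[of N m m "1\<^sub>m m - U" m G m, symmetric] del: assoc_mult_mat square_simps(4))
  have solution_from: "X = A1 + X * A0 + X * (A1 * Y)"
    if X: "X = A1 * Z" and Z: "Z * (1\<^sub>m m - (A0 + A1 * Y)) = 1\<^sub>m m"
      and [simp]: "Z \<in> carrier_mat m m" "Y \<in> carrier_mat m m" for X Y Z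
  proof -
    have "X * (1\<^sub>m m - (A0 + A1 * Y)) = A1 * (Z * (1\<^sub>m m - (A0 + A1 * Y)))"
      unfolding X by simp
    also have "\<dots> = A1" by (simp add: Z)
    finally have "A1 = X - (X * A0 + X * (A1 * Y))"
      by (simp add: X square_distribs)
    then have "X - (X * A0 + X * (A1 * Y)) = A1" by simp
    moreover have "X \<in> carrier_mat m m" by (simp add: X)
    ultimately show ?thesis by (simp add: mat_diff_eq_iff[of _ m m])
  qed
  have R: "solves_R (A1 * N)"
    unfolding solves_R_def
  proof
    show "0\<^sub>m m m \<le> A1 * N" by (intro mat_mult_nonneg[of m m] nonneg N)
    have "A1 * N = A1 + A1 * N * A0 + A1 * N * (A1 * G)"
      by (rule solution_from[OF refl]) (use N(3) in \<open>simp_all add: U_def\<close>)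
    also have "A1 * N * (A1 * G) = A1 * N * (A1 * N) * Am" by (simp add: NAm[symmetric])
    finally show "A1 * N = A1 + A1 * N * A0 + A1 * N * (A1 * N) * Am" .
  qed
  have unique: "X = A1 * N" if X: "solves_R X" and le: "X \<le> A1 * N" for X
  proof -
    have Xn: "0\<^sub>m m m \<le> X" and Xc [simp]: "X \<in> carrier_mat m m" and Xeq: "X = A1 + X * A0 + X * X * Am"
      using X by (auto simp: solves_R_def mat_nonneg_iff)
    define V where "V = A0 + X * Am"
    have [simp]: "V \<in> carrier_mat m m" by (simp add: V_def)
    have Vn: "0\<^sub>m m m \<le> V" unfolding V_def by (intro mat_add_nonneg mat_mult_nonneg[of m m] nonneg Xn)
    have "X * Am \<le> A1 * N * Am" by (rule mat_mult_mono[OF Xn le nonneg(1)]) simp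
    then have "X * Am \<le> A1 * G" by (simp add: NAm[symmetric])
    then have VU: "V \<le> U" unfolding V_def U_def by (intro mat_add_mono[of _ _ _ _ m m]) auto
    obtain Z where Z: "0\<^sub>m m m \<le> Z" "(1\<^sub>m m - V) * Z = 1\<^sub>m m" "Z * (1\<^sub>m m - V) = 1\<^sub>m m"
      using min_principle_inverse[OF min_principle_mono[OF mpU Vn VU]] .
    have Zc [simp]: "Z \<in> carrier_mat m m" using Z(1) by (auto simp: mat_nonneg_iff)
    have "X * (1\<^sub>m m - V) = X - (X * A0 + X * (X * Am))" by (simp add: V_def square_distribs)
    also have "\<dots> = A1" using Xeq by (simp add: mat_diff_eq_iff[of _ m m])
    finally have XV: "X * (1\<^sub>m m - V) = A1" .
    have "A1 * Z = X * ((1\<^sub>m m - V) * Z)" by (subst XV[symmetric]) simp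
    then have XZ: "X = A1 * Z" using Z(2) by simp
    define Y where "Y = Z * Am"
    have Yc [simp]: "Y \<in> carrier_mat m m" by (simp add: Y_def)
    have AY: "A1 * Y = X * Am" by (simp add: Y_def XZ)
    have "solves_G Y"
      unfolding solves_G_def
    proof
      show "0\<^sub>m m m \<le> Y" unfolding Y_def by (intro mat_mult_nonneg[of m m] Z nonneg)
      have "Am = (1\<^sub>m m - V) * Y"
        unfolding Y_def using Z(2)
        by (simp add: assoc_mult_mat[of "1\<^sub>m m - V" m m Z m Am m, symmetric] del: assoc_mult_mat square_simps(4))
      also have "\<dots> = Y - (A0 * Y + A1 * (Y * Y))"
        by (simp add: V_def AY[symmetric] square_distribs)
      finally have "Y - (A0 * Y + A1 * (Y * Y)) = Am" by simp
      then show "Y = Am + A0 * Y + A1 * (Y * Y)" by (simp add: mat_diff_eq_iff[of _ m m])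
    qed
    then have "A1 * G \<le> A1 * Y" by (intro mat_mult_mono[OF nonneg(3) _ Gn] min) auto
    then have "U \<le> V" unfolding U_def V_def AY by (intro mat_add_mono[of _ _ _ _ m m]) auto
    then have "U = V" using VU by simp
    then have "Z = Z * ((1\<^sub>m m - U) * N)" using N(2) by simp
    also have "\<dots> = (Z * (1\<^sub>m m - U)) * N" by simp
    also have "\<dots> = N" using Z(3) \<open>U = V\<close> by simp
    finally show ?thesis using XZ by simp
  qed
  show thesis using that[OF N[unfolded U_def] NAm R] unique by blast
qed

end

section \<open>Reflection, invariant rows and irreducibility\<close>

lemma converse_doubly_infinite:
  "doubly_infinite_qbd_trans A1 A0 Am (- i, a) (- j, b) = doubly_infinite_qbd_trans Am A0 A1 (i, a) (j, b)"
  by (auto simp: doubly_infinite_qbd_trans_def)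

lemma (in skip_free_walk) reflected: "skip_free_walk m A1 A0 Am"
proof
  show "0\<^sub>m m m \<le> A1" "0\<^sub>m m m \<le> A0" "0\<^sub>m m m \<le> Am" by (fact nonneg)+
  show "(\<Sum>b<m. Am $$ (a, b) + A0 $$ (a, b) + A1 $$ (a, b)) = 1" if "a < m" for a
    using row_sums[OF that] by (simp add: add_ac)
  let ?S = "(UNIV :: int set) \<times> {..<m}"
  let ?r = "\<lambda>D C. {(u, v). u \<in> ?S \<and> v \<in> ?S \<and> 0 < doubly_infinite_qbd_trans D A0 C u v}"
  have flip: "((- i, a), (- j, b)) \<in> ?r A1 Am" if "((i, a), (j, b)) \<in> ?r Am A1" for i a j b
    using that by (simp add: converse_doubly_infinite)
  have refl: "(map_prod uminus id s, map_prod uminus id t) \<in> (?r A1 Am)\<^sup>*" if "(s, t) \<in> (?r Am A1)\<^sup>*" for s t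
    using that
  proof induction
    case (step t u)
    have "(map_prod uminus id t, map_prod uminus id u) \<in> ?r A1 Am"
      using step.hyps(2) flip by (cases t; cases u) simp
    then show ?case using step.IH by (rule rtrancl_into_rtrancl[rotated])
  qed simp
  show "irreducible_on ?S (doubly_infinite_qbd_trans A1 A0 Am)"
    unfolding irreducible_on_def reaches_def
  proof (intro ballI)
    fix s t :: "int \<times> nat" assume "s \<in> ?S" "t \<in> ?S"
    then have "map_prod uminus id s \<in> ?S" "map_prod uminus id t \<in> ?S" by auto
    then have "(map_prod uminus id s, map_prod uminus id t) \<in> (?r Am A1)\<^sup>*"
      by (intro irreducible[unfolded irreducible_on_def reaches_def, THEN bspec, THEN bspec])
    from refl[OF this] show "(s, t) \<in> (?r A1 Am)\<^sup>*" by (simp add: prod.map_comp o_def prod.map_ident)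
  qed
qed

text \<open>The entrywise absolute value of a left fixed vector is again fixed because the row sums leave
  no slack; irreducibility makes it positive.\<close>

lemma positive_invariant_row:
  fixes A :: "real mat"
  assumes m: "0 < m" and A: "0\<^sub>m m m \<le> A" and rows: "\<And>a. a < m \<Longrightarrow> (\<Sum>b<m. A $$ (a, b)) = 1"
    and irr: "irreducible_on {..<m} (\<lambda>a b. A $$ (a, b))"
  obtains \<alpha> where "\<alpha> \<in> carrier_mat 1 m" "\<forall>b<m. 0 < \<alpha> $$ (0, b)" "\<alpha> * A = \<alpha>"
proof -
  have Ac: "A \<in> carrier_mat m m" and An: "\<And>a b. a < m \<Longrightarrow> b < m \<Longrightarrow> 0 \<le> A $$ (a, b)"
    using A by (auto simp: mat_nonneg_iff)
  define T where "T = transpose_mat (1\<^sub>m m - A)"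
  have Tc: "T \<in> carrier_mat m m" using Ac by (auto simp: T_def)
  define e :: "real vec" where "e = vec m (\<lambda>_. 1)"
  have ec: "e \<in> carrier_vec m" by (simp add: e_def)
  have "(1\<^sub>m m - A) *\<^sub>v e = 0\<^sub>v m"
  proof (rule eq_vecI)
    fix a assume "a < dim_vec (0\<^sub>v m)"
    then have a: "a < m" by simp
    have "((1\<^sub>m m - A) *\<^sub>v e) $ a = (\<Sum>b<m. (1\<^sub>m m - A) $$ (a, b) * e $ b)"
      by (rule index_mult_mat_vec_sum[OF _ ec a]) (use Ac in auto)
    also have "\<dots> = (\<Sum>b<m. (if a = b then 1 else 0) - A $$ (a, b))"
      using a Ac by (intro sum.cong) (auto simp: e_def)
    also have "\<dots> = 0" using a rows[OF a] by (simp add: sum_subtractf)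
    finally show "((1\<^sub>m m - A) *\<^sub>v e) $ a = 0\<^sub>v m $ a" using a by simp
  qed (use Ac in auto)
  moreover have "e \<noteq> 0\<^sub>v m"
  proof
    assume "e = 0\<^sub>v m"
    then have "e $ 0 = 0" using m by simp
    then show False using m by (simp add: e_def)
  qed
  ultimately have "det (1\<^sub>m m - A) = 0"
    using det_0_iff_vec_prod_zero_field[OF minus_carrier_mat[OF Ac, of "1\<^sub>m m"]] ec by blast
  then have "det T = 0" unfolding T_def using det_transpose[OF minus_carrier_mat[OF Ac, of "1\<^sub>m m"]] by simp
  then obtain v where v: "v \<in> carrier_vec m" "v \<noteq> 0\<^sub>v m" "T *\<^sub>v v = 0\<^sub>v m"
    using det_0_iff_vec_prod_zero_field[OF Tc] by auto
  have veq: "(\<Sum>a<m. v $ a * A $$ (a, b)) = v $ b" if b: "b < m" for b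
  proof -
    have "0 = (T *\<^sub>v v) $ b" using v b by simp
    also have "\<dots> = (\<Sum>a<m. T $$ (b, a) * v $ a)" by (rule index_mult_mat_vec_sum[OF Tc v(1) b])
    also have "\<dots> = (\<Sum>a<m. (if a = b then v $ a else 0) - v $ a * A $$ (a, b))"
      using b Ac by (intro sum.cong) (auto simp: T_def algebra_simps)
    also have "\<dots> = v $ b - (\<Sum>a<m. v $ a * A $$ (a, b))" using b by (simp add: sum_subtractf)
    finally show ?thesis by simp
  qed
  define w where "w b = \<bar>v $ b\<bar>" for b
  have w_le: "w b \<le> (\<Sum>a<m. w a * A $$ (a, b))" if b: "b < m" for b
  proof -
    have "w b = \<bar>\<Sum>a<m. v $ a * A $$ (a, b)\<bar>" by (simp add: w_def veq[OF b])
    also have "\<dots> \<le> (\<Sum>a<m. \<bar>v $ a * A $$ (a, b)\<bar>)" by (rule sum_abs)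
    also have "\<dots> = (\<Sum>a<m. w a * A $$ (a, b))"
      using An b by (intro sum.cong) (auto simp: w_def abs_mult)
    finally show ?thesis .
  qed
  have "(\<Sum>b<m. \<Sum>a<m. w a * A $$ (a, b)) = (\<Sum>a<m. \<Sum>b<m. w a * A $$ (a, b))"
    by (rule sum.swap)
  also have "\<dots> = (\<Sum>a<m. w a)"
    using rows by (intro sum.cong) (auto simp: sum_distrib_left[symmetric])
  finally have "(\<Sum>b<m. (\<Sum>a<m. w a * A $$ (a, b)) - w b) = 0" by (simp add: sum_subtractf)
  then have w_eq: "(\<Sum>a<m. w a * A $$ (a, b)) = w b" if "b < m" for b
    using w_le that sum_nonneg_eq_0_iff[of "{..<m}" "\<lambda>b. (\<Sum>a<m. w a * A $$ (a, b)) - w b"] by auto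
  have "state_closed {..<m} (\<lambda>a b. A $$ (a, b)) {a. a < m \<and> 0 < w a}"
    unfolding state_closed_def
  proof (intro ballI impI)
    fix a b assume a: "a \<in> {a. a < m \<and> 0 < w a}" and b: "b \<in> {..<m}" and "0 < A $$ (a, b)"
    then have "0 < w a * A $$ (a, b)" by simp
    also have "\<dots> \<le> (\<Sum>a<m. w a * A $$ (a, b))"
      using a b An by (intro member_le_sum) (auto simp: w_def)
    also have "\<dots> = w b" using w_eq b by simp
    finally show "b \<in> {a. a < m \<and> 0 < w a}" using b by simp
  qed
  moreover obtain a where "a < m" "0 < w a"
    using v(1,2) by (auto simp: vec_eq_iff w_def)
  ultimately have pos: "0 < w b" if "b < m" for b
    using irreducible_closed[OF irr, of "{a. a < m \<and> 0 < w a}" a b] that by auto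
  show thesis
  proof
    show "mat 1 m (\<lambda>(_, b). w b) \<in> carrier_mat 1 m" by simp
    show "\<forall>b<m. 0 < mat 1 m (\<lambda>(_, b). w b) $$ (0, b)" using pos by simp
    show "mat 1 m (\<lambda>(_, b). w b) * A = mat 1 m (\<lambda>(_, b). w b)"
      using Ac w_eq
      by (intro eq_matI) (auto simp: index_mult_mat_sum[of _ 1 m A m] simp del: index_mult_mat(1))
  qed
qed

text \<open>The phases of the final class are closed for the phase process \<open>Am + A0 + A1\<close>. As this is
  irreducible, the final class is the whole state space.\<close>

lemma two_sided_walk_irreducible:
  assumes nn: "0\<^sub>m m m \<le> Am" "0\<^sub>m m m \<le> A0" "0\<^sub>m m m \<le> A1"
    and irr: "irreducible_on {..<m} (\<lambda>a b. (Am + A0 + A1) $$ (a, b))"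
    and fin: "single_final_class m Am A0 A1 Es"
  shows "irreducible_on (UNIV \<times> {..<m}) (doubly_infinite_qbd_trans Am A0 A1)"
proof -
  let ?S = "(UNIV :: int set) \<times> {..<m}" and ?q = "doubly_infinite_qbd_trans Am A0 A1"
  have Es: "Es \<noteq> {}" "Es \<subseteq> {..<m}" and fc: "final_class ?S ?q (UNIV \<times> Es)"
    using fin unfolding single_final_class_def Let_def by auto
  have "state_closed {..<m} (\<lambda>a b. (Am + A0 + A1) $$ (a, b)) Es"
    unfolding state_closed_def
  proof (intro ballI impI)
    fix a b assume a: "a \<in> Es" and b: "b \<in> {..<m}" and pos: "0 < (Am + A0 + A1) $$ (a, b)"
    have "a < m" using a Es by auto
    have "(Am + A0 + A1) $$ (a, b) = Am $$ (a, b) + A0 $$ (a, b) + A1 $$ (a, b)"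
      using nn \<open>a < m\<close> b by (auto simp: mat_nonneg_iff)
    then consider "0 < Am $$ (a, b)" | "0 < A0 $$ (a, b)" | "0 < A1 $$ (a, b)" using pos by linarith
    then obtain j where "0 < ?q (0, a) (j, b)"
    proof cases
      case 1 then show thesis using that[of "-1"] by (simp add: doubly_infinite_qbd_trans_def)
    next
      case 2 then show thesis using that[of 0] by (simp add: doubly_infinite_qbd_trans_def)
    next
      case 3 then show thesis using that[of 1] by (simp add: doubly_infinite_qbd_trans_def)
    qed
    then have "reaches ?S ?q (0, a) (j, b)"
      using \<open>a < m\<close> b unfolding reaches_def by (intro r_into_rtrancl) auto
    moreover have "{t. reaches ?S ?q (0, a) t} = UNIV \<times> Es"
      using fc a unfolding final_class_def by blast
    ultimately show "b \<in> Es" by blast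
  qed
  moreover obtain a0 where "a0 \<in> Es" using Es by auto
  ultimately have "Es = {..<m}"
    using irreducible_closed[OF irr, of Es a0] Es by auto
  then have "{t. reaches ?S ?q s t} = ?S" if "s \<in> ?S" for s
    using fc that unfolding final_class_def by blast
  then show ?thesis unfolding irreducible_on_def by blast
qed

section \<open>A homogeneous Sylvester equation\<close>

text \<open>The entrywise absolute value \<open>H\<close> of \<open>\<Delta>\<close> satisfies \<open>H \<le> N D H R\<close>. The row \<open>\<alpha>\<close> turns this
  into \<open>d \<le> d R\<close> for the single nonnegative row \<open>d = \<alpha> D H\<close>, which has to vanish with the powers of
  \<open>R\<close>; as \<open>\<alpha>\<close> is positive, so does \<open>D H\<close>.\<close>

lemma sylvester_zero:
  fixes \<Delta> N D R \<alpha> :: "real mat"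
  assumes N: "0\<^sub>m m m \<le> N" and D: "0\<^sub>m m m \<le> D" and R: "0\<^sub>m m m \<le> R"
    and \<Delta>: "\<Delta> \<in> carrier_mat m m" "\<Delta> = N * D * \<Delta> * R"
    and \<alpha>: "\<alpha> \<in> carrier_mat 1 m" "\<And>b. b < m \<Longrightarrow> 0 < \<alpha> $$ (0, b)" "\<alpha> * (D * N) \<le> \<alpha>"
    and R0: "mat_tendsto m m (\<lambda>k. R ^\<^sub>m k) (0\<^sub>m m m)"
  shows "\<Delta> = 0\<^sub>m m m"
proof -
  have Nc: "N \<in> carrier_mat m m" and Dc: "D \<in> carrier_mat m m" and Rc: "R \<in> carrier_mat m m"
    using N D R by (auto simp: mat_nonneg_iff)
  define H where "H = map_mat abs \<Delta>"
  have Hc: "H \<in> carrier_mat m m" using \<Delta>(1) by (simp add: H_def)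
  have Hn: "0\<^sub>m m m \<le> H" using \<Delta>(1) by (auto simp: H_def mat_nonneg_iff)
  have abs_mult: "map_mat abs (X * Y) \<le> map_mat abs X * map_mat abs Y"
    if "X \<in> carrier_mat m m" "Y \<in> carrier_mat m m" for X Y :: "real mat"
  proof (subst mat_le_iff[of _ m m])
    show "\<forall>i<m. \<forall>j<m. map_mat abs (X * Y) $$ (i, j) \<le> (map_mat abs X * map_mat abs Y) $$ (i, j)"
    proof (intro allI impI)
      fix i j assume ij: "i < m" "j < m"
      have "map_mat abs (X * Y) $$ (i, j) = \<bar>\<Sum>a<m. X $$ (i, a) * Y $$ (a, j)\<bar>"
        using that ij by (simp add: index_mult_mat_sum[OF that] del: index_mult_mat(1))
      also have "\<dots> \<le> (\<Sum>a<m. \<bar>X $$ (i, a) * Y $$ (a, j)\<bar>)" by (rule sum_abs)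
      also have "\<dots> = (\<Sum>a<m. map_mat abs X $$ (i, a) * map_mat abs Y $$ (a, j))"
        using that ij by (intro sum.cong) (auto simp: abs_mult)
      also have "\<dots> = (map_mat abs X * map_mat abs Y) $$ (i, j)"
        using that ij by (intro index_mult_mat_sum[symmetric]) auto
      finally show "map_mat abs (X * Y) $$ (i, j) \<le> (map_mat abs X * map_mat abs Y) $$ (i, j)" .
    qed
  qed (use that in auto)
  have abs_nn: "map_mat abs X = X" if "0\<^sub>m m m \<le> X" for X :: "real mat"
    using that by (intro eq_matI) (auto simp: mat_nonneg_iff)
  have abs_nonneg: "0\<^sub>m m m \<le> map_mat abs X" if "X \<in> carrier_mat m m" for X :: "real mat"
    using that by (auto simp: mat_nonneg_iff)
  have ND: "0\<^sub>m m m \<le> N * D" by (rule mat_mult_nonneg[OF N D])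
  have NDc: "N * D \<in> carrier_mat m m" by (rule mult_carrier_mat[OF Nc Dc])
  have H_le: "H \<le> N * D * H * R"
  proof -
    have "H = map_mat abs (N * D * \<Delta> * R)" unfolding H_def using \<Delta>(2) by (rule arg_cong)
    also have "\<dots> \<le> map_mat abs (N * D * \<Delta>) * map_mat abs R"
      by (rule abs_mult[OF mult_carrier_mat[OF NDc \<Delta>(1)] Rc])
    also have "\<dots> \<le> (N * D * H) * R"
      unfolding abs_nn[OF R]
    proof (rule mat_mult_mono[of m m _ _ m])
      have "map_mat abs (N * D * \<Delta>) \<le> map_mat abs (N * D) * map_mat abs \<Delta>"
        by (rule abs_mult[OF NDc \<Delta>(1)])
      then show "map_mat abs (N * D * \<Delta>) \<le> N * D * H" unfolding abs_nn[OF ND] H_def .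
      show "0\<^sub>m m m \<le> map_mat abs (N * D * \<Delta>)"
        by (rule abs_nonneg[OF mult_carrier_mat[OF NDc \<Delta>(1)]])
    qed (use R in simp_all)
    finally show ?thesis .
  qed
  have \<alpha>n: "0\<^sub>m 1 m \<le> \<alpha>" using \<alpha> by (auto simp: mat_nonneg_iff less_imp_le)
  define d where "d = \<alpha> * (D * H)"
  have DH: "0\<^sub>m m m \<le> D * H" by (rule mat_mult_nonneg[OF D Hn])
  have dn: "0\<^sub>m 1 m \<le> d" unfolding d_def by (rule mat_mult_nonneg[OF \<alpha>n DH])
  then have dc: "d \<in> carrier_mat 1 m" by (simp add: mat_nonneg_iff)
  have d_le: "d \<le> d * R"
  proof -
    have "d \<le> \<alpha> * (D * (N * D * H * R))"
      unfolding d_def by (intro mat_mult_mono[OF \<alpha>n _ DH] mat_mult_mono[OF D _ Hn] H_le) auto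
    also have "\<dots> = (\<alpha> * (D * N)) * (D * H * R)"
      using \<alpha>(1) Nc Dc Rc Hc
      by (simp add: assoc_mult_mat[of _ 1 m _ m _ m] assoc_mult_mat[of _ m m _ m _ m])
    also have "\<dots> \<le> \<alpha> * (D * H * R)"
      by (rule mat_mult_mono[OF mat_mult_nonneg[OF \<alpha>n mat_mult_nonneg[OF D N]] \<alpha>(3) mat_mult_nonneg[OF DH R]]) simp
    also have "\<dots> = d * R"
      unfolding d_def using \<alpha>(1) Dc Rc Hc
      by (simp add: assoc_mult_mat[of _ 1 m _ m _ m] assoc_mult_mat[of _ m m _ m _ m])
    finally show ?thesis .
  qed
  have d_pow: "d \<le> d * R ^\<^sub>m k" for k
  proof (induction k)
    case 0
    then show ?case using dc Rc by simp
  next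
    case (Suc k)
    have "d \<le> d * R ^\<^sub>m k" by (rule Suc)
    also have "\<dots> \<le> d * R * R ^\<^sub>m k"
      by (rule mat_mult_mono[OF dn d_le mat_pow_nonneg[OF R]]) simp
    also have "\<dots> = d * R ^\<^sub>m Suc k"
      unfolding mat_pow_Suc_left[OF Rc] using dc Rc by (simp add: assoc_mult_mat[of _ 1 m _ m _ m])
    finally show ?case .
  qed
  have "mat_tendsto 1 m (\<lambda>k. d * R ^\<^sub>m k) (d * 0\<^sub>m m m)"
    by (intro mat_tendsto_mult[OF mat_tendsto_const R0] dc)
  then have "d \<le> d * 0\<^sub>m m m" by (rule mat_tendsto_ge[OF _ d_pow dc])
  then have d0: "d $$ (0, b) = 0" if "b < m" for b
    using dn dc that by (auto simp: mat_nonneg_iff less_eq_mat_def intro: antisym)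
  have "D * H = 0\<^sub>m m m"
  proof (rule eq_matI)
    fix a b assume "a < dim_row (0\<^sub>m m m :: real mat)" "b < dim_col (0\<^sub>m m m :: real mat)"
    then have ab: "a < m" "b < m" by auto
    have DHe: "0 \<le> (D * H) $$ (a, b)" if "a < m" for a using DH ab that by (auto simp: mat_nonneg_iff)
    have "(\<Sum>a<m. \<alpha> $$ (0, a) * (D * H) $$ (a, b)) = d $$ (0, b)"
      unfolding d_def using \<alpha>(1) Dc Hc ab by (intro index_mult_mat_sum[symmetric]) auto
    then have "(\<Sum>a<m. \<alpha> $$ (0, a) * (D * H) $$ (a, b)) = 0" using d0 ab by simp
    moreover have "0 \<le> \<alpha> $$ (0, a) * (D * H) $$ (a, b)" if "a < m" for a
      using \<alpha>(2)[OF that] DHe[OF that] by simp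
    ultimately have "\<alpha> $$ (0, a) * (D * H) $$ (a, b) = 0"
      using sum_nonneg_eq_0_iff[of "{..<m}" "\<lambda>a. \<alpha> $$ (0, a) * (D * H) $$ (a, b)"] ab by auto
    then show "(D * H) $$ (a, b) = 0\<^sub>m m m $$ (a, b)" using \<alpha>(2)[OF ab(1)] ab by simp
  qed (use Dc Hc in auto)
  then have "N * D * H * R = 0\<^sub>m m m"
    using Nc Dc Hc Rc by (simp add: assoc_mult_mat[of _ m m _ m _ m])
  then have "H \<le> 0\<^sub>m m m" using H_le by simp
  then show ?thesis using \<Delta>(1)
    by (intro eq_matI) (auto simp: H_def less_eq_mat_def)
qed

section \<open>The positive recurrent QBD\<close>

(* Level 1 in the equations of level 0 keeps its name, so that facts about it apply by matching. *)
declare One_nat_def [simp del]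

text \<open>The stationary rows are matrices with one row, so that \<open>\<pi>\<^sub>i R\<close> is a matrix product and the bound
  on least solutions applies to them.\<close>

locale stationary_qbd = skip_free_walk +
  fixes B :: "real mat" and \<pi> :: "nat \<Rightarrow> real mat"
  assumes m_pos: "0 < m"
    and B_nonneg: "0\<^sub>m m m \<le> B"
    and boundary_row_sums: "\<And>a. a < m \<Longrightarrow> (\<Sum>b<m. A1 $$ (a, b) + B $$ (a, b)) = 1"
    and qbd_irreducible: "irreducible_on (UNIV \<times> {..<m}) (qbd_trans B Am A0 A1)"
    and \<pi>_carrier [simp]: "\<And>i. \<pi> i \<in> carrier_mat 1 m"
    and \<pi>_pos: "\<And>i a. a < m \<Longrightarrow> 0 < \<pi> i $$ (0, a)"
    and \<pi>_boundary: "\<pi> 0 = \<pi> 0 * B + \<pi> 1 * Am"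
    and \<pi>_interior: "\<And>i. \<pi> (Suc i) = \<pi> i * A1 + \<pi> (Suc i) * A0 + \<pi> (Suc (Suc i)) * Am"
    and \<pi>_summable: "\<And>a. a < m \<Longrightarrow> summable (\<lambda>i. \<pi> i $$ (0, a))"
begin

lemma B_carrier [simp]: "B \<in> carrier_mat m m"
  using B_nonneg by (auto simp: mat_nonneg_iff)

lemma \<pi>_nonneg: "0\<^sub>m 1 m \<le> \<pi> i"
  using \<pi>_pos by (auto simp: mat_nonneg_iff less_imp_le)

lemmas row_simps [simp] =
  mult_carrier_mat[of _ 1 m _ m] assoc_mult_mat[of _ 1 m _ m _ m] assoc_add_mat[of _ 1 m]

text \<open>The set on which the bound is attained is closed under the transitions of the chain.\<close>

lemma superharmonic_constant:
  fixes f :: "nat \<Rightarrow> real vec"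
  assumes fc: "\<And>i. f i \<in> carrier_vec m"
    and boundary: "\<And>a. a < m \<Longrightarrow> (A1 *\<^sub>v f 1 + B *\<^sub>v f 0) $ a \<le> f 0 $ a"
    and interior: "\<And>i a. a < m \<Longrightarrow> (A1 *\<^sub>v f (Suc (Suc i)) + A0 *\<^sub>v f (Suc i) + Am *\<^sub>v f i) $ a \<le> f (Suc i) $ a"
    and bound: "\<And>i a. a < m \<Longrightarrow> \<mu> \<le> f i $ a"
    and attained: "a0 < m" "f i0 $ a0 = \<mu>"
    and a: "a < m"
  shows "f i $ a = \<mu>"
proof -
  have dims: "dim_vec (f i) = m" for i using fc[of i] by simp
  have comb3: "(\<Sum>b<m. A1 $$ (c, b) * x $ b + A0 $$ (c, b) * y $ b + Am $$ (c, b) * z $ b) =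
      (A1 *\<^sub>v x + A0 *\<^sub>v y + Am *\<^sub>v z) $ c"
    if "c < m" "x \<in> carrier_vec m" "y \<in> carrier_vec m" "z \<in> carrier_vec m" for c x y z
    using that by (simp add: index_mult_mat_vec_sum[of _ m m] sum.distrib del: index_mult_mat_vec)
  have comb2: "(\<Sum>b<m. A1 $$ (c, b) * x $ b + B $$ (c, b) * y $ b + 0 * \<mu>) =
      (A1 *\<^sub>v x + B *\<^sub>v y) $ c"
    if "c < m" "x \<in> carrier_vec m" "y \<in> carrier_vec m" for c x y
    using that by (simp add: index_mult_mat_vec_sum[of _ m m] sum.distrib del: index_mult_mat_vec)
  define K where "K = {(i, b). b < m \<and> f i $ b = \<mu>}"
  have "state_closed (UNIV \<times> {..<m}) (qbd_trans B Am A0 A1) K"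
    unfolding state_closed_def
  proof (intro ballI impI)
    fix s t assume s: "s \<in> K" and t: "t \<in> (UNIV :: nat set) \<times> {..<m}"
      and pos: "0 < qbd_trans B Am A0 A1 s t"
    obtain i c where ic: "s = (i, c)" "c < m" "f i $ c = \<mu>" using s by (auto simp: K_def)
    obtain j b where jb: "t = (j, b)" "b < m" using t by auto
    have "f j $ b = \<mu>"
    proof (cases i)
      case 0
      have nn: "0 \<le> A1 $$ (c, b) \<and> 0 \<le> B $$ (c, b) \<and> 0 \<le> (0 :: real)" if "b < m" for b
        using B_nonneg entry_nonneg[OF ic(2) that] that ic(2) by (auto simp: mat_nonneg_iff)
      have tot: "(\<Sum>b<m. A1 $$ (c, b) + B $$ (c, b) + 0) = 1" using boundary_row_sums[OF ic(2)] by simp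
      have le: "(\<Sum>b<m. A1 $$ (c, b) * f 1 $ b + B $$ (c, b) * f 0 $ b + 0 * \<mu>) \<le> \<mu>"
        using boundary[OF ic(2)] ic(2,3) 0 by (subst comb2) (auto simp: fc)
      have ge: "\<mu> \<le> f 1 $ b \<and> \<mu> \<le> f 0 $ b \<and> \<mu> \<le> \<mu>" if "b < m" for b using bound[OF that] by simp
      note eq = average_le_lower_bound[where p = "\<lambda>b. A1 $$ (c, b)" and q = "\<lambda>b. B $$ (c, b)"
          and r = "\<lambda>_. 0" and m = m and z = "\<lambda>_. \<mu>", OF nn tot ge le jb(2)]
      consider "j = 0" "0 < B $$ (c, b)" | "j = 1" "0 < A1 $$ (c, b)"
        using pos ic(1) jb(1) 0 by (auto simp: qbd_trans_def split: if_splits)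
      then show ?thesis using eq by cases auto
    next
      case (Suc n)
      have le: "(\<Sum>b<m. A1 $$ (c, b) * f (Suc (Suc n)) $ b + A0 $$ (c, b) * f (Suc n) $ b + Am $$ (c, b) * f n $ b) \<le> \<mu>"
        using interior[OF ic(2), of n] ic(2,3) Suc by (subst comb3) (auto simp: fc)
      have ge: "\<mu> \<le> f (Suc (Suc n)) $ b \<and> \<mu> \<le> f (Suc n) $ b \<and> \<mu> \<le> f n $ b" if "b < m" for b
        using bound[OF that] by simp
      note eq = average_le_lower_bound[where p = "\<lambda>b. A1 $$ (c, b)" and q = "\<lambda>b. A0 $$ (c, b)"
          and r = "\<lambda>b. Am $$ (c, b)" and m = m, OF entry_nonneg[OF ic(2)] row_sums[OF ic(2)] ge le jb(2)]
      consider "j = Suc n" "0 < A0 $$ (c, b)" | "j = Suc (Suc n)" "0 < A1 $$ (c, b)" | "j = n" "0 < Am $$ (c, b)"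
        using pos ic(1) jb(1) Suc by (auto simp: qbd_trans_def split: if_splits)
      then show ?thesis using eq by cases auto
    qed
    then show "t \<in> K" using jb by (simp add: K_def)
  qed
  moreover have "(i0, a0) \<in> K" using attained by (simp add: K_def)
  ultimately have "(i, a) \<in> K"
    using irreducible_closed[OF qbd_irreducible, of K "(i0, a0)" "(i, a)"] attained a by auto
  then show ?thesis by (simp add: K_def)
qed

text \<open>The balance equations are the premise of the bound on least solutions.\<close>

lemma \<pi>_mult_R_le:
  assumes R: "solves_R R" and min: "\<And>Y. solves_R Y \<Longrightarrow> R \<le> Y"
  shows "\<pi> i * R \<le> \<pi> (Suc i)"
proof -
  have Rn: "0\<^sub>m m m \<le> R" and Req: "R = A1 + R * A0 + R * R * Am"
    using R unfolding solves_R_def by blast+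
  obtain X where X: "0\<^sub>m m m \<le> X" "X \<le> R" "X = A1 + X * A0 + X * X * Am"
    and bd: "\<forall>n u. (\<forall>k. 0\<^sub>m n m \<le> u k) \<longrightarrow>
       (\<forall>k. u k * A1 + u (Suc k) * A0 + u (Suc (Suc k)) * Am \<le> u (Suc k)) \<longrightarrow>
       (\<forall>k. u k * X \<le> u (Suc k))"
    by (rule least_solution_bound[OF nonneg(3) nonneg(2) nonneg(1) Rn Req])
  have "solves_R X" using X unfolding solves_R_def by blast
  then have "R \<le> X" by (rule min)
  then have "R = X" using X(2) by simp
  moreover have "\<pi> i * X \<le> \<pi> (Suc i)"
    by (intro bd[rule_format, of 1 \<pi>]) (simp_all add: \<pi>_nonneg \<pi>_interior[symmetric] del: row_simps)
  ultimately show ?thesis by simp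
qed

text \<open>\<open>\<pi>\<^sub>0 R\<^sup>k \<le> \<pi>\<^sub>k\<close>, the rows \<open>\<pi>\<^sub>k\<close> are summable, and \<open>\<pi>\<^sub>0\<close> is positive.\<close>

lemma R_pow_summable:
  assumes R: "solves_R R" and min: "\<And>Y. solves_R Y \<Longrightarrow> R \<le> Y" and ab: "a < m" "b < m"
  shows "summable (\<lambda>k. (R ^\<^sub>m k) $$ (a, b))"
proof -
  have Rn: "0\<^sub>m m m \<le> R" using R unfolding solves_R_def by blast
  then have Rc [simp]: "R \<in> carrier_mat m m" by (simp add: mat_nonneg_iff)
  have Pn: "0\<^sub>m m m \<le> R ^\<^sub>m k" for k by (rule mat_pow_nonneg[OF Rn])
  have le: "\<pi> 0 * R ^\<^sub>m k \<le> \<pi> k" for k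
  proof (induction k)
    case 0
    have "R ^\<^sub>m 0 = 1\<^sub>m m" using carrier_matD(1)[OF Rc] by simp
    then show ?case by (simp add: right_mult_one_mat[OF \<pi>_carrier])
  next
    case (Suc k)
    have "\<pi> 0 * R ^\<^sub>m Suc k = \<pi> 0 * R ^\<^sub>m k * R" by simp
    also have "\<dots> \<le> \<pi> k * R"
      by (rule mat_mult_mono[OF mat_mult_nonneg[OF \<pi>_nonneg Pn] Suc Rn]) simp
    also have "\<dots> \<le> \<pi> (Suc k)" by (rule \<pi>_mult_R_le[OF R min])
    finally show ?case .
  qed
  have bound: "(R ^\<^sub>m k) $$ (a, b) \<le> \<pi> k $$ (0, b) / \<pi> 0 $$ (0, a)" for k
  proof -
    have "\<pi> 0 $$ (0, a) * (R ^\<^sub>m k) $$ (a, b) \<le> (\<Sum>c<m. \<pi> 0 $$ (0, c) * (R ^\<^sub>m k) $$ (c, b))"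
      using ab Pn[of k] by (intro member_le_sum) (auto simp: mat_nonneg_iff less_imp_le[OF \<pi>_pos])
    also have "\<dots> = (\<pi> 0 * R ^\<^sub>m k) $$ (0, b)"
      by (rule index_mult_mat_sum[OF \<pi>_carrier _ _ ab(2), symmetric]) simp_all
    also have "\<dots> \<le> \<pi> k $$ (0, b)" using le[of k] ab(2) by (subst (asm) mat_le_iff[of _ 1 m]) (auto simp del: index_mult_mat(1))
    finally show ?thesis using \<pi>_pos[OF ab(1)] by (simp add: pos_le_divide_eq mult.commute)
  qed
  have "summable (\<lambda>k. \<pi> k $$ (0, b) / \<pi> 0 $$ (0, a))"
    by (intro summable_divide \<pi>_summable ab)
  then show ?thesis
    by (rule summable_comparison_test'[of _ 0]) (use bound Pn ab in \<open>auto simp: mat_nonneg_iff\<close>)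
qed

text \<open>The function with value \<open>f\<^sub>i = G\<^sup>i 1\<close> on level \<open>i\<close> is harmonic off level 0. The flux
  \<open>c\<^sub>i = \<pi>\<^sub>i A1 f\<^sub>i\<^sub>+\<^sub>1 - \<pi>\<^sub>i\<^sub>+\<^sub>1 Am f\<^sub>i\<close> between neighbouring levels therefore does not depend on \<open>i\<close>. As
  \<open>\<pi>\<close> tends to 0 it vanishes, and this says that \<open>f\<close> is harmonic on level 0 as well. Being
  maximal there, \<open>f\<close> is constant.\<close>

lemma G_row_sums:
  assumes G: "solves_G G" and min: "\<And>Y. solves_G Y \<Longrightarrow> G \<le> Y" and a: "a < m"
  shows "(\<Sum>b<m. G $$ (a, b)) = 1"
proof -
  have Gn: "0\<^sub>m m m \<le> G" using G unfolding solves_G_def by blast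
  then have Gc [simp]: "G \<in> carrier_mat m m" by (simp only: mat_nonneg_iff)
  have sub: "\<And>a. a < m \<Longrightarrow> (\<Sum>b<m. G $$ (a, b)) \<le> 1" by (rule minimal_G_row_sums[OF G min])
  define e :: "real vec" where "e = vec m (\<lambda>_. 1)"
  have ec [simp]: "e \<in> carrier_vec m" by (simp add: e_def)
  have e_nth: "e $ a = 1" if "a < m" for a using that by (simp add: e_def)
  define f where "f i = G ^\<^sub>m i *\<^sub>v e" for i
  have fc [simp]: "f i \<in> carrier_vec m" for i by (simp add: f_def)
  then have [simp]: "dim_vec (f i) = m" for i by auto
  have f0: "f 0 = e" by (simp add: f_def)
  have fS: "f (Suc i) = G *\<^sub>v f i" for i
    unfolding f_def by (rule solves_G_pow(1)[OF G ec])
  have harm: "A1 *\<^sub>v f (Suc (Suc i)) + A0 *\<^sub>v f (Suc i) + Am *\<^sub>v f i = f (Suc i)" for i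
    unfolding f_def by (rule solves_G_pow(2)[OF G ec])
  have f_bounds: "0 \<le> f i $ a \<and> f i $ a \<le> 1" if "a < m" for i a
    using that
  proof (induction i arbitrary: a)
    case 0 then show ?case by (simp add: f0 e_nth)
  next
    case (Suc i)
    have "f (Suc i) $ a = (\<Sum>b<m. G $$ (a, b) * f i $ b)"
      unfolding fS by (rule index_mult_mat_vec_sum[OF Gc fc Suc.prems])
    moreover have "(\<Sum>b<m. G $$ (a, b) * f i $ b) \<le> (\<Sum>b<m. G $$ (a, b) * 1)"
      using Gn Suc by (intro sum_mono mult_left_mono) (auto simp: mat_nonneg_iff)
    moreover have "0 \<le> (\<Sum>b<m. G $$ (a, b) * f i $ b)"
      using Gn Suc by (intro sum_nonneg mult_nonneg_nonneg) (auto simp: mat_nonneg_iff)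
    ultimately show ?case using sub[OF Suc.prems] by simp
  qed
  define ip where "ip u x = (u *\<^sub>v x) $ 0" for u :: "real mat" and x :: "real vec"
  have ip_sum: "ip u x = (\<Sum>a<m. u $$ (0, a) * x $ a)" if "u \<in> carrier_mat 1 m" "x \<in> carrier_vec m" for u x
    unfolding ip_def by (rule index_mult_mat_vec_sum[OF that]) simp
  have ip_assoc: "ip (u * X) x = ip u (X *\<^sub>v x)"
    if "u \<in> carrier_mat 1 m" "X \<in> carrier_mat m m" "x \<in> carrier_vec m" for u X x
    unfolding ip_def by (simp only: assoc_mult_mat_vec[OF that])
  have ip_left: "ip (u + w) x = ip u x + ip w x"
    if "u \<in> carrier_mat 1 m" "w \<in> carrier_mat 1 m" "x \<in> carrier_vec m" for u w x
    unfolding ip_def add_mult_distrib_mat_vec[OF that] using that by simp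
  have ip_right: "ip u (x + y) = ip u x + ip u y"
    if "u \<in> carrier_mat 1 m" "x \<in> carrier_vec m" "y \<in> carrier_vec m" for u x y
    unfolding ip_def mult_add_distrib_mat_vec[OF that] using that by simp
  define c where "c i = ip (\<pi> i) (A1 *\<^sub>v f (Suc i)) - ip (\<pi> (Suc i)) (Am *\<^sub>v f i)" for i
  have c_Suc: "c (Suc i) = c i" for i
  proof -
    have "ip (\<pi> (Suc i)) (f (Suc i)) = ip (\<pi> i * A1 + \<pi> (Suc i) * A0 + \<pi> (Suc (Suc i)) * Am) (f (Suc i))"
      using \<pi>_interior[of i] by simp
    also have "\<dots> = ip (\<pi> i) (A1 *\<^sub>v f (Suc i)) + ip (\<pi> (Suc i)) (A0 *\<^sub>v f (Suc i))
        + ip (\<pi> (Suc (Suc i))) (Am *\<^sub>v f (Suc i))"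
      by (simp add: ip_left ip_assoc)
    moreover have "ip (\<pi> (Suc i)) (f (Suc i)) =
        ip (\<pi> (Suc i)) (A1 *\<^sub>v f (Suc (Suc i)) + A0 *\<^sub>v f (Suc i) + Am *\<^sub>v f i)"
      by (simp only: harm)
    then have "ip (\<pi> (Suc i)) (f (Suc i)) = ip (\<pi> (Suc i)) (A1 *\<^sub>v f (Suc (Suc i)))
        + ip (\<pi> (Suc i)) (A0 *\<^sub>v f (Suc i)) + ip (\<pi> (Suc i)) (Am *\<^sub>v f i)"
      by (simp add: ip_right)
    ultimately show ?thesis unfolding c_def by simp
  qed
  have ip_tendsto: "(\<lambda>i. ip (\<pi> (s i)) (X *\<^sub>v f (t i))) \<longlonglongrightarrow> 0"
    if X [simp]: "X \<in> carrier_mat m m" and Xn: "\<And>a b. a < m \<Longrightarrow> b < m \<Longrightarrow> 0 \<le> X $$ (a, b)"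
      and Xs: "\<And>a. a < m \<Longrightarrow> (\<Sum>b<m. X $$ (a, b)) \<le> 1"
      and s: "\<And>a. a < m \<Longrightarrow> (\<lambda>i. \<pi> (s i) $$ (0, a)) \<longlonglongrightarrow> 0" for X s t
  proof (rule tendsto_sandwich[of "\<lambda>_. 0" _ _ "\<lambda>i. \<Sum>a<m. \<pi> (s i) $$ (0, a)"])
    have Xf: "0 \<le> (X *\<^sub>v f i) $ a \<and> (X *\<^sub>v f i) $ a \<le> 1" if a: "a < m" for i a
    proof -
      have "(X *\<^sub>v f i) $ a = (\<Sum>b<m. X $$ (a, b) * f i $ b)"
        by (rule index_mult_mat_vec_sum[OF X fc a])
      moreover have "(\<Sum>b<m. X $$ (a, b) * f i $ b) \<le> (\<Sum>b<m. X $$ (a, b) * 1)"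
        using Xn[OF a] f_bounds by (intro sum_mono mult_left_mono) auto
      moreover have "0 \<le> (\<Sum>b<m. X $$ (a, b) * f i $ b)"
        using Xn[OF a] f_bounds by (intro sum_nonneg mult_nonneg_nonneg) auto
      ultimately show ?thesis using Xs[OF a] by simp
    qed
    have eq: "ip (\<pi> (s i)) (X *\<^sub>v f (t i)) = (\<Sum>a<m. \<pi> (s i) $$ (0, a) * (X *\<^sub>v f (t i)) $ a)" for i
      by (rule ip_sum) simp_all
    have "0 \<le> ip (\<pi> (s i)) (X *\<^sub>v f (t i))" for i
      unfolding eq using Xf less_imp_le[OF \<pi>_pos]
      by (intro sum_nonneg mult_nonneg_nonneg) (auto simp del: index_mult_mat_vec)
    then show "\<forall>\<^sub>F i in sequentially. 0 \<le> ip (\<pi> (s i)) (X *\<^sub>v f (t i))" by simp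
    have "ip (\<pi> (s i)) (X *\<^sub>v f (t i)) \<le> (\<Sum>a<m. \<pi> (s i) $$ (0, a) * 1)" for i
      unfolding eq using Xf less_imp_le[OF \<pi>_pos]
      by (intro sum_mono mult_left_mono) (auto simp del: index_mult_mat_vec)
    then show "\<forall>\<^sub>F i in sequentially. ip (\<pi> (s i)) (X *\<^sub>v f (t i)) \<le> (\<Sum>a<m. \<pi> (s i) $$ (0, a))" by simp
    show "(\<lambda>i. \<Sum>a<m. \<pi> (s i) $$ (0, a)) \<longlonglongrightarrow> 0"
      by (intro tendsto_null_sum s) auto
  qed simp
  have sums_le: "(\<Sum>b<m. A1 $$ (a, b)) \<le> 1" "(\<Sum>b<m. Am $$ (a, b)) \<le> 1" if "a < m" for a
  proof -
    have "0 \<le> (\<Sum>b<m. A1 $$ (a, b))" "0 \<le> (\<Sum>b<m. A0 $$ (a, b))" "0 \<le> (\<Sum>b<m. Am $$ (a, b))"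
      using entry_nonneg[OF that] by (auto intro!: sum_nonneg)
    then show "(\<Sum>b<m. A1 $$ (a, b)) \<le> 1" "(\<Sum>b<m. Am $$ (a, b)) \<le> 1"
      using row_sums[OF that] by (simp_all add: sum.distrib)
  qed
  have \<pi>0: "(\<lambda>i. \<pi> i $$ (0, a)) \<longlonglongrightarrow> 0" if "a < m" for a
    using \<pi>_summable[OF that] by (rule summable_LIMSEQ_zero)
  have "(\<lambda>i. ip (\<pi> i) (A1 *\<^sub>v f (Suc i))) \<longlonglongrightarrow> 0"
    by (rule ip_tendsto) (use entry_nonneg sums_le \<pi>0 in auto)
  moreover have "(\<lambda>i. ip (\<pi> (Suc i)) (Am *\<^sub>v f i)) \<longlonglongrightarrow> 0"
    by (rule ip_tendsto[where s = Suc]) (use entry_nonneg sums_le LIMSEQ_Suc[OF \<pi>0] in auto)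
  ultimately have "c \<longlonglongrightarrow> 0"
    unfolding c_def[abs_def] using tendsto_diff by fastforce
  moreover have "c i = c 0" for i by (induction i) (simp_all add: c_Suc)
  then have "c = (\<lambda>_. c 0)" by (rule ext)
  ultimately have c0: "c 0 = 0" by (metis LIMSEQ_const_iff)
  \<comment> \<open>The defect of harmonicity on level 0 is nonnegative, and its mean under \<open>\<pi> 0\<close> is \<open>- c 0\<close>.\<close>
  define d where "d a = e $ a - (B *\<^sub>v f 0) $ a - (A1 *\<^sub>v f 1) $ a" for a
  have d_nonneg: "0 \<le> d a" if a: "a < m" for a
  proof -
    have "(A1 *\<^sub>v f 1) $ a = (\<Sum>b<m. A1 $$ (a, b) * f 1 $ b)"
      by (rule index_mult_mat_vec_sum[OF carriers(3) fc a])
    also have "\<dots> \<le> (\<Sum>b<m. A1 $$ (a, b) * 1)"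
      using f_bounds entry_nonneg[OF a] by (intro sum_mono mult_left_mono) auto
    finally have "(A1 *\<^sub>v f 1) $ a \<le> (\<Sum>b<m. A1 $$ (a, b))" by simp
    moreover have "(B *\<^sub>v f 0) $ a = (\<Sum>b<m. B $$ (a, b) * f 0 $ b)"
      by (rule index_mult_mat_vec_sum[OF B_carrier fc a])
    then have "(B *\<^sub>v f 0) $ a = (\<Sum>b<m. B $$ (a, b))" by (simp add: f0 e_nth)
    moreover have "e $ a = (\<Sum>b<m. A1 $$ (a, b)) + (\<Sum>b<m. B $$ (a, b))"
      using boundary_row_sums[OF a] a by (simp add: e_nth sum.distrib)
    ultimately show ?thesis unfolding d_def by simp
  qed
  have "(\<Sum>a<m. \<pi> 0 $$ (0, a) * d a) = ip (\<pi> 0) (f 0) - ip (\<pi> 0) (B *\<^sub>v f 0) - ip (\<pi> 0) (A1 *\<^sub>v f 1)"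
    unfolding d_def by (simp add: ip_sum f0 sum_subtractf[symmetric] algebra_simps del: index_mult_mat_vec)
  also have "ip (\<pi> 0) (f 0) = ip (\<pi> 0 * B + \<pi> 1 * Am) (f 0)" using \<pi>_boundary by simp
  also have "\<dots> = ip (\<pi> 0) (B *\<^sub>v f 0) + ip (\<pi> 1) (Am *\<^sub>v f 0)" by (simp add: ip_left ip_assoc)
  finally have "(\<Sum>a<m. \<pi> 0 $$ (0, a) * d a) = - c 0" unfolding c_def One_nat_def by simp
  then have "(\<Sum>a<m. \<pi> 0 $$ (0, a) * d a) = 0" using c0 by simp
  moreover have "0 \<le> \<pi> 0 $$ (0, a) * d a" if "a < m" for a
    using \<pi>_pos[OF that, of 0] d_nonneg[OF that] by simp
  ultimately have "\<pi> 0 $$ (0, a) * d a = 0" if "a < m" for a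
    using that sum_nonneg_eq_0_iff[of "{..<m}" "\<lambda>a. \<pi> 0 $$ (0, a) * d a"] by auto
  then have d0: "d a = 0" if "a < m" for a using that \<pi>_pos[OF that, of 0] by fastforce
  \<comment> \<open>The maximum of \<open>f\<close> on level 0 becomes a minimum of \<open>h\<close>.\<close>
  define h where "h i = - f i" for i
  have hc: "h i \<in> carrier_vec m" for i by (simp add: h_def)
  have mult_h: "(X *\<^sub>v h i) $ a = - (X *\<^sub>v f i) $ a" if "X \<in> carrier_mat m m" "a < m" for X i a
    unfolding h_def mult_mat_vec_uminus[OF that(1) fc] using that by (simp del: index_mult_mat_vec)
  have h_nth: "h i $ a = - f i $ a" if "a < m" for i a using that by (simp add: h_def)
  have "h 1 $ a = - 1"
  proof (rule superharmonic_constant)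
    fix i b assume b: "b < m"
    show "(A1 *\<^sub>v h 1 + B *\<^sub>v h 0) $ b \<le> h 0 $ b"
      using d0[OF b] b by (simp add: mult_h h_nth d_def f0 del: index_mult_mat_vec)
    have "(A1 *\<^sub>v f (Suc (Suc i)) + A0 *\<^sub>v f (Suc i) + Am *\<^sub>v f i) $ b = f (Suc i) $ b"
      by (simp only: harm)
    then show "(A1 *\<^sub>v h (Suc (Suc i)) + A0 *\<^sub>v h (Suc i) + Am *\<^sub>v h i) $ b \<le> h (Suc i) $ b"
      using b by (simp add: mult_h h_nth del: index_mult_mat_vec)
    show "- 1 \<le> h i $ b" using f_bounds[OF b, of i] b by (simp add: h_nth)
  next
    show "0 < m" by (rule m_pos)
    show "h 0 $ 0 = - 1" using m_pos by (simp add: h_nth f0 e_nth)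
    show "a < m" by (rule a)
  qed (rule hc)
  then have "(G *\<^sub>v f 0) $ a = 1" using a fS[of 0] by (simp add: h_nth One_nat_def del: index_mult_mat_vec)
  moreover have "(G *\<^sub>v f 0) $ a = (\<Sum>b<m. G $$ (a, b) * f 0 $ b)"
    by (rule index_mult_mat_vec_sum[OF Gc fc a])
  ultimately show ?thesis by (simp add: f0 e_nth)
qed

text \<open>A fixed vector of \<open>B + A1 G\<close> extends by the powers of the stochastic matrix \<open>G\<close> to a harmonic
  function of the chain, whose minimum is taken on level 0.\<close>

lemma fixed_vector_constant:
  assumes G: "solves_G G" and min: "\<And>Y. solves_G Y \<Longrightarrow> G \<le> Y"
    and v: "v \<in> carrier_vec m" "(B + A1 * G) *\<^sub>v v = v" and ab: "a < m" "b < m"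
  shows "v $ a = v $ b"
proof -
  have Gn: "0\<^sub>m m m \<le> G" and Geq: "G = Am + A0 * G + A1 * (G * G)"
    using G unfolding solves_G_def by blast+
  then have Gc [simp]: "G \<in> carrier_mat m m" by (simp only: mat_nonneg_iff)
  note v(1)[simp]
  define \<mu> where "\<mu> = Min ((\<lambda>a. v $ a) ` {..<m})"
  have "\<mu> \<in> (\<lambda>a. v $ a) ` {..<m}" unfolding \<mu>_def using ab by (intro Min_in) auto
  then obtain a0 where a0: "a0 < m" "v $ a0 = \<mu>" by auto
  have vmu: "\<mu> \<le> v $ b" if "b < m" for b unfolding \<mu>_def using that by (intro Min_le) auto
  define f where "f n = G ^\<^sub>m n *\<^sub>v v" for n
  have fc [simp]: "f n \<in> carrier_vec m" for n by (simp add: f_def)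
  then have [simp]: "dim_vec (f n) = m" for n by auto
  have f0: "f 0 = v" by (simp add: f_def)
  have fS: "f (Suc n) = G *\<^sub>v f n" for n
    unfolding f_def by (rule solves_G_pow(1)[OF G v(1)])
  have fmu: "\<mu> \<le> f n $ b" if "b < m" for n b
    using that
  proof (induction n arbitrary: b)
    case 0 then show ?case using vmu by (simp add: f0)
  next
    case (Suc n)
    have "\<mu> = (\<Sum>c<m. G $$ (b, c)) * \<mu>" using G_row_sums[OF G min, of b] Suc.prems by simp
    also have "\<dots> \<le> (\<Sum>c<m. G $$ (b, c) * f n $ c)"
      unfolding sum_distrib_right using Suc Gn
      by (intro sum_mono mult_left_mono) (auto simp: mat_nonneg_iff)
    finally show ?case
      unfolding fS using Suc.prems by (subst index_mult_mat_vec_sum[of _ m m]) auto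
  qed
  have harm: "A1 *\<^sub>v f (Suc (Suc n)) + A0 *\<^sub>v f (Suc n) + Am *\<^sub>v f n = f (Suc n)" for n
    unfolding f_def by (rule solves_G_pow(2)[OF G v(1)])
  have base: "A1 *\<^sub>v f 1 + B *\<^sub>v f 0 = f 0"
  proof -
    have "B *\<^sub>v v + A1 *\<^sub>v (G *\<^sub>v v) = v"
      using v by (simp add: add_mult_distrib_mat_vec[of _ m m])
    then show ?thesis using fS[of 0] by (simp add: f0 comm_add_vec[of _ m] One_nat_def)
  qed
  have "f 0 $ c = \<mu>" if "c < m" for c
    by (rule superharmonic_constant[of f \<mu> a0 0 c 0, OF fc _ _ fmu a0(1) _ that])
      (simp_all only: harm base order_refl, simp add: f0 a0(2))
  then show ?thesis using ab by (simp add: f0)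
qed

end

declare One_nat_def [simp]

section \<open>Growth of the powers of R\<close>

lemma smult_mat_pow:
  fixes A :: "'a :: comm_semiring_1 mat"
  assumes A: "A \<in> carrier_mat n n"
  shows "(c \<cdot>\<^sub>m A) ^\<^sub>m k = c ^ k \<cdot>\<^sub>m A ^\<^sub>m k"
proof (induction k)
  case 0
  show ?case using A by (intro eq_matI) auto
next
  case (Suc k)
  have "(c \<cdot>\<^sub>m A) ^\<^sub>m Suc k = (c ^ k \<cdot>\<^sub>m A ^\<^sub>m k) * (c \<cdot>\<^sub>m A)" by (simp add: Suc)
  also have "\<dots> = c \<cdot>\<^sub>m (c ^ k \<cdot>\<^sub>m (A ^\<^sub>m k * A))"
    using A by (simp add: mult_smult_assoc_mat[of _ n n _ n] mult_smult_distrib[of _ n n _ n])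
  also have "\<dots> = c ^ Suc k \<cdot>\<^sub>m A ^\<^sub>m Suc k"
    by (intro eq_matI) (auto simp: mult_ac)
  finally show ?case .
qed

lemma spectral_radius_nonneg:
  assumes "A \<in> carrier_mat n n" "0 < n"
  shows "0 \<le> spectral_radius A"
  using spectral_radius_mem_max(1)[OF assms] by auto

text \<open>Scaled by \<open>1 / t\<close> the matrix has spectral radius less than 1, and its powers are bounded.\<close>

lemma pow_bound_above_spectral_radius:
  assumes A: "A \<in> carrier_mat n n" and n: "0 < n" and t: "spectral_radius A < t"
  obtains c where "\<forall>k i j. i < n \<longrightarrow> j < n \<longrightarrow> cmod ((A ^\<^sub>m k) $$ (i, j)) \<le> c * t ^ k"
proof -
  have t0: "0 < t" using spectral_radius_nonneg[OF A n] t by simp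
  define C where "C = complex_of_real (1 / t) \<cdot>\<^sub>m A"
  have C: "C \<in> carrier_mat n n" using A by (simp add: C_def)
  obtain ev where ev: "ev \<in> spectrum C" "spectral_radius C = cmod ev"
    using spectral_radius_mem_max(1)[OF C n] by auto
  then obtain v where v: "v \<in> carrier_vec n" "v \<noteq> 0\<^sub>v n" "C *\<^sub>v v = ev \<cdot>\<^sub>v v"
    using C by (auto simp: spectrum_def eigenvalue_def eigenvector_def)
  have "A *\<^sub>v v = (of_real t * ev) \<cdot>\<^sub>v v"
  proof (rule eq_vecI)
    fix i assume "i < dim_vec ((of_real t * ev) \<cdot>\<^sub>v v)"
    then have i: "i < n" using v by simp
    have "(C *\<^sub>v v) $ i = (\<Sum>a<n. C $$ (i, a) * v $ a)" by (rule index_mult_mat_vec_sum[OF C v(1) i])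
    also have "\<dots> = of_real (1 / t) * (\<Sum>a<n. A $$ (i, a) * v $ a)"
      unfolding sum_distrib_left using A i by (intro sum.cong) (auto simp: C_def)
    also have "(\<Sum>a<n. A $$ (i, a) * v $ a) = (A *\<^sub>v v) $ i"
      by (rule index_mult_mat_vec_sum[OF A v(1) i, symmetric])
    finally have "ev * v $ i = of_real (1 / t) * (A *\<^sub>v v) $ i" using v i by simp
    then show "(A *\<^sub>v v) $ i = ((of_real t * ev) \<cdot>\<^sub>v v) $ i"
      using i v t0 by (simp add: field_simps del: index_mult_mat_vec)
  qed (use A v in auto)
  then have "of_real t * ev \<in> spectrum A"
    using A v by (auto simp: spectrum_def eigenvalue_def eigenvector_def)
  then have "cmod (of_real t * ev) \<le> spectral_radius A"
    using spectral_radius_mem_max(2)[OF A n] by blast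
  moreover have "cmod (of_real t * ev) = t * cmod ev" using t0 by (simp add: norm_mult)
  ultimately have "t * cmod ev < t * 1" using t by linarith
  then have "spectral_radius C < 1"
    unfolding ev(2) by (rule mult_less_cancel_left_pos[OF t0, THEN iffD1])
  from spectral_radius_jnf_norm_bound_less_1_upper_triangular[OF C this]
  obtain c where c: "norm_bound (C ^\<^sub>m k) c" for k by blast
  show thesis
  proof (rule that, intro allI impI)
    fix k i j assume ij: "i < n" "j < n"
    have "(C ^\<^sub>m k) $$ (i, j) = of_real (1 / t) ^ k * (A ^\<^sub>m k) $$ (i, j)"
      unfolding C_def smult_mat_pow[OF A] using A ij by simp
    then have eq: "cmod ((C ^\<^sub>m k) $$ (i, j)) = cmod ((A ^\<^sub>m k) $$ (i, j)) / t ^ k"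
      using t0 by (simp add: norm_mult norm_power norm_divide power_divide)
    have "cmod ((C ^\<^sub>m k) $$ (i, j)) \<le> c"
      using c[of k] C ij unfolding norm_bound_def by auto
    then show "cmod ((A ^\<^sub>m k) $$ (i, j)) \<le> c * t ^ k"
      unfolding eq using t0 by (simp add: pos_divide_le_eq)
  qed
qed

lemma mat_pow_add:
  fixes A :: "'a :: semiring_1 mat"
  assumes A: "A \<in> carrier_mat n n"
  shows "A ^\<^sub>m (k + l) = A ^\<^sub>m k * A ^\<^sub>m l"
proof (induction l)
  case 0
  then show ?case using A by (simp add: right_mult_one_mat[of _ n n])
next
  case (Suc l)
  have "A ^\<^sub>m (k + Suc l) = (A ^\<^sub>m k * A ^\<^sub>m l) * A" by (simp add: Suc)
  also have "\<dots> = A ^\<^sub>m k * A ^\<^sub>m Suc l" using A by (simp add: assoc_mult_mat[of _ n n _ n _ n])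
  finally show ?case .
qed

text \<open>Diagonal entries of powers of a nonnegative matrix are supermultiplicative: if one exceeded
  \<open>t\<^sup>k\<close> for some \<open>t > \<rho>\<close>, then along the multiples of \<open>k\<close> it would exceed every multiple of the
  powers of \<open>t\<close>. So they are free of the polynomial factor that other entries may have.\<close>

lemma diagonal_pow_le:
  fixes A :: "real mat"
  assumes A: "0\<^sub>m n n \<le> A" and j: "j < n"
  shows "(A ^\<^sub>m k) $$ (j, j) \<le> spectral_radius (cmat A) ^ k"
proof -
  have Ac: "A \<in> carrier_mat n n" using A by (simp add: mat_nonneg_iff)
  then have cA: "cmat A \<in> carrier_mat n n" by simp
  have n: "0 < n" using j by simp
  define \<rho> where "\<rho> = spectral_radius (cmat A)"
  define x where "x = (A ^\<^sub>m k) $$ (j, j)"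
  have nn: "0 \<le> (A ^\<^sub>m l) $$ (a, b)" if "a < n" "b < n" for l a b
    using mat_pow_nonneg[OF A, of l] that by (simp add: mat_nonneg_iff)
  have x0: "0 \<le> x" unfolding x_def by (rule nn[OF j j])
  have super: "x ^ l \<le> (A ^\<^sub>m (k * l)) $$ (j, j)" for l
  proof (induction l)
    case 0 show ?case using Ac j by simp
  next
    case (Suc l)
    have "x ^ Suc l \<le> (A ^\<^sub>m k) $$ (j, j) * (A ^\<^sub>m (k * l)) $$ (j, j)"
      using mult_left_mono[OF Suc x0] by (simp add: x_def)
    also have "\<dots> \<le> (\<Sum>a<n. (A ^\<^sub>m k) $$ (j, a) * (A ^\<^sub>m (k * l)) $$ (a, j))"
      using j nn by (intro member_le_sum) auto
    also have "\<dots> = (A ^\<^sub>m k * A ^\<^sub>m (k * l)) $$ (j, j)"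
      using Ac j by (intro index_mult_mat_sum[symmetric]) auto
    finally show ?case by (simp add: mat_pow_add[OF Ac])
  qed
  have le: "x \<le> t ^ k" if t: "\<rho> < t" for t
  proof (rule ccontr)
    assume "\<not> x \<le> t ^ k"
    have t0: "0 < t" using t spectral_radius_nonneg[OF cA n] by (simp add: \<rho>_def)
    obtain c where c: "\<forall>k i j. i < n \<longrightarrow> j < n \<longrightarrow> cmod ((cmat A ^\<^sub>m k) $$ (i, j)) \<le> c * t ^ k"
      using pow_bound_above_spectral_radius[OF cA n t[unfolded \<rho>_def]] .
    have "(x / t ^ k) ^ l \<le> c" for l
    proof -
      have "(A ^\<^sub>m (k * l)) $$ (j, j) = cmod ((cmat A ^\<^sub>m (k * l)) $$ (j, j))"
        using Ac j nn[OF j j] by (simp add: of_real_hom.mat_hom_pow[OF Ac, symmetric])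
      then have "x ^ l \<le> c * t ^ (k * l)" using super[of l] c[rule_format, OF j j, of "k * l"] by simp
      then show ?thesis using t0 by (simp add: power_divide power_mult pos_divide_le_eq zero_less_power)
    qed
    moreover have "1 < x / t ^ k" using \<open>\<not> x \<le> t ^ k\<close> t0 by simp
    then obtain l where "c < (x / t ^ k) ^ l" using real_arch_pow by blast
    ultimately show False using not_le by blast
  qed
  have "((\<lambda>t. t ^ k) \<longlongrightarrow> \<rho> ^ k) (at_right \<rho>)"
    by (intro tendsto_intros)
  moreover have "eventually (\<lambda>t. x \<le> t ^ k) (at_right \<rho>)"
    using le by (auto simp: eventually_at_filter)
  ultimately show ?thesis
    unfolding x_def[symmetric] \<rho>_def[symmetric] by (intro tendsto_lowerbound) auto
qed

context skip_free_walk
begin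

text \<open>The rows of the powers of \<open>R\<close> satisfy the balance equations of the walk. These bound the entry
  in column \<open>a\<close> by a multiple of the entry in column \<open>b\<close> of an equal or neighbouring power whenever
  the phase process can step from \<open>a\<close> to \<open>b\<close>. A path from \<open>a\<close> to the phase of the row ends in a
  diagonal entry.\<close>

lemma R_pow_bound:
  assumes R: "solves_R R" and irr: "irreducible_on {..<m} (\<lambda>a b. (Am + A0 + A1) $$ (a, b))"
    and j: "j < m" and a: "a < m"
  shows "\<exists>C k0. \<forall>k\<ge>k0. (R ^\<^sub>m k) $$ (j, a) \<le> C * spectral_radius (cmat R) ^ k"
proof -
  have Rn: "0\<^sub>m m m \<le> R" and Req: "R = A1 + R * A0 + R * R * Am"
    using R unfolding solves_R_def by blast+
  then have Rc [simp]: "R \<in> carrier_mat m m" by (simp only: mat_nonneg_iff)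
  define \<rho> where "\<rho> = spectral_radius (cmat R)"
  have \<rho>0: "0 \<le> \<rho>" unfolding \<rho>_def by (rule spectral_radius_nonneg[of _ m]) (use j in auto)
  have nn: "0 \<le> (R ^\<^sub>m l) $$ (a, b)" if "a < m" "b < m" for l a b
    using mat_pow_nonneg[OF Rn, of l] that by (simp add: mat_nonneg_iff)
  have balance: "R ^\<^sub>m Suc n = R ^\<^sub>m n * A1 + R ^\<^sub>m Suc n * A0 + R ^\<^sub>m Suc (Suc n) * Am" for n
  proof -
    have "R ^\<^sub>m Suc n = R ^\<^sub>m n * (A1 + R * A0 + R * R * Am)"
      by (subst Req[symmetric]) simp
    also have "\<dots> = R ^\<^sub>m n * A1 + R ^\<^sub>m Suc n * A0 + R ^\<^sub>m Suc (Suc n) * Am"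
      by (simp add: square_distribs)
    finally show ?thesis .
  qed
  have entry: "(R ^\<^sub>m n) $$ (j, a) * A1 $$ (a, b) \<le> (R ^\<^sub>m Suc n) $$ (j, b)"
    "(R ^\<^sub>m Suc n) $$ (j, a) * A0 $$ (a, b) \<le> (R ^\<^sub>m Suc n) $$ (j, b)"
    "(R ^\<^sub>m Suc (Suc n)) $$ (j, a) * Am $$ (a, b) \<le> (R ^\<^sub>m Suc n) $$ (j, b)"
    if ab: "a < m" "b < m" for n a b
  proof -
    have one: "(R ^\<^sub>m l) $$ (j, a) * X $$ (a, b) \<le> (R ^\<^sub>m l * X) $$ (j, b)" "0 \<le> (R ^\<^sub>m l * X) $$ (j, b)"
      if X: "0\<^sub>m m m \<le> X" for X l
    proof -
      have Xc: "X \<in> carrier_mat m m" using X by (simp add: mat_nonneg_iff)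
      have eq: "(R ^\<^sub>m l * X) $$ (j, b) = (\<Sum>c<m. (R ^\<^sub>m l) $$ (j, c) * X $$ (c, b))"
        by (rule index_mult_mat_sum[OF _ Xc j ab(2)]) simp
      have "0 \<le> (R ^\<^sub>m l) $$ (j, c) * X $$ (c, b)" if "c < m" for c
        using nn[OF j that] X that ab by (simp add: mat_nonneg_iff)
      then show "(R ^\<^sub>m l) $$ (j, a) * X $$ (a, b) \<le> (R ^\<^sub>m l * X) $$ (j, b)" "0 \<le> (R ^\<^sub>m l * X) $$ (j, b)"
        unfolding eq using ab by (auto intro!: member_le_sum sum_nonneg)
    qed
    have "(R ^\<^sub>m Suc n) $$ (j, b) = (R ^\<^sub>m n * A1) $$ (j, b) + (R ^\<^sub>m Suc n * A0) $$ (j, b)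
        + (R ^\<^sub>m Suc (Suc n) * Am) $$ (j, b)"
      by (subst balance) (use j ab in \<open>simp del: index_mult_mat(1) pow_mat.simps assoc_mult_mat square_simps(4)\<close>)
    then show "(R ^\<^sub>m n) $$ (j, a) * A1 $$ (a, b) \<le> (R ^\<^sub>m Suc n) $$ (j, b)"
      "(R ^\<^sub>m Suc n) $$ (j, a) * A0 $$ (a, b) \<le> (R ^\<^sub>m Suc n) $$ (j, b)"
      "(R ^\<^sub>m Suc (Suc n)) $$ (j, a) * Am $$ (a, b) \<le> (R ^\<^sub>m Suc n) $$ (j, b)"
      using one[OF nonneg(1), of "Suc (Suc n)"] one[OF nonneg(2), of "Suc n"] one[OF nonneg(3), of n]
      by linarith+
  qed
  have "(a, j) \<in> {(u, v). u \<in> {..<m} \<and> v \<in> {..<m} \<and> 0 < (Am + A0 + A1) $$ (u, v)}\<^sup>*"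
    using irr a j by (auto simp: irreducible_on_def reaches_def)
  then have "\<exists>C k0. \<forall>k\<ge>k0. (R ^\<^sub>m k) $$ (j, a) \<le> C * \<rho> ^ k"
  proof (induction rule: converse_rtrancl_induct)
    case base
    have "\<forall>k\<ge>0. (R ^\<^sub>m k) $$ (j, j) \<le> 1 * \<rho> ^ k"
      using diagonal_pow_le[OF Rn j] by (simp add: \<rho>_def)
    then show ?case by blast
  next
    case (step a b)
    then have ab: "a < m" "b < m" and "0 < (Am + A0 + A1) $$ (a, b)" by auto
    then have pos: "0 < Am $$ (a, b) + A0 $$ (a, b) + A1 $$ (a, b)" by simp
    obtain C k0 where C: "\<And>k. k \<ge> k0 \<Longrightarrow> (R ^\<^sub>m k) $$ (j, b) \<le> C * \<rho> ^ k" using step.IH by blast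
    consider "0 < A1 $$ (a, b)" | "0 < A0 $$ (a, b)" | "0 < Am $$ (a, b)" using pos by linarith
    then show ?case
    proof cases
      case 1
      have "(R ^\<^sub>m k) $$ (j, a) \<le> (C * \<rho> / A1 $$ (a, b)) * \<rho> ^ k" if "k \<ge> k0" for k
        using entry(1)[OF ab, of k] C[of "Suc k"] that 1 by (simp add: field_simps)
      then show ?thesis by blast
    next
      case 2
      have "(R ^\<^sub>m k) $$ (j, a) \<le> (C / A0 $$ (a, b)) * \<rho> ^ k" if k: "k \<ge> Suc k0" for k
      proof -
        obtain l where "k = Suc l" using k by (cases k) auto
        then show ?thesis using entry(2)[OF ab, of l] C[of k] k 2 by (simp add: field_simps)
      qed
      then show ?thesis by blast
    next
      case 3
      have "(R ^\<^sub>m k) $$ (j, a) \<le> (C / \<rho> / Am $$ (a, b)) * \<rho> ^ k" if k: "k \<ge> Suc (Suc k0)" for k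
      proof -
        obtain l where l: "k = Suc (Suc l)" "k0 \<le> Suc l" using k by (cases k; cases "k - 1") auto
        have "(R ^\<^sub>m k) $$ (j, a) * Am $$ (a, b) \<le> C * \<rho> ^ Suc l"
          using entry(3)[OF ab, of l] C[of "Suc l"] l by simp
        \<comment> \<open>For \<open>\<rho> = 0\<close> both sides are 0.\<close>
        also have "\<dots> = C / \<rho> * \<rho> ^ k" using l by (cases "\<rho> = 0") auto
        finally have "(R ^\<^sub>m k) $$ (j, a) \<le> C / \<rho> * \<rho> ^ k / Am $$ (a, b)"
          using 3 by (simp only: pos_le_divide_eq)
        then show ?thesis by simp
      qed
      then show ?thesis by blast
    qed
  qed
  then show ?thesis by (simp add: \<rho>_def)
qed

end

section \<open>Norms on coordinate vectors\<close>

lemma bounded_real_subsequence: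
  fixes X :: "nat \<Rightarrow> real"
  assumes "\<And>n. \<bar>X n\<bar> \<le> K"
  obtains r where "strict_mono r" "convergent (\<lambda>n. X (r n))"
proof -
  obtain r where r: "strict_mono (r :: nat \<Rightarrow> nat)" "monoseq (\<lambda>n. X (r n))"
    using seq_monosub by blast
  moreover have "Bseq (\<lambda>n. X (r n))" using assms by (intro BseqI'[of _ K]) simp
  ultimately show thesis using that Bseq_monoseq_convergent by blast
qed

lemma bounded_complex_subsequence:
  fixes X :: "nat \<Rightarrow> complex"
  assumes "\<And>n. cmod (X n) \<le> K"
  obtains r where "strict_mono r" "convergent (\<lambda>n. X (r n))"
proof -
  obtain r where r: "strict_mono r" "convergent (\<lambda>n. Re (X (r n)))"
    using bounded_real_subsequence[of "\<lambda>n. Re (X n)" K] assms abs_Re_le_cmod order_trans by metis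
  obtain s where s: "strict_mono s" "convergent (\<lambda>n. Im (X (r (s n))))"
    using bounded_real_subsequence[of "\<lambda>n. Im (X (r n))" K] assms abs_Im_le_cmod order_trans by metis
  have "convergent (\<lambda>n. Re (X (r (s n))))"
    using convergent_subseq_convergent[OF r(2) s(1)] by (simp add: o_def)
  then have "convergent (\<lambda>n. X (r (s n)))"
    using s(2) by (auto simp: convergent_def tendsto_complex_iff intro: exI[of _ "Complex x y" for x y])
  moreover have "strict_mono (\<lambda>n. r (s n))" using r s by (simp add: strict_mono_def)
  ultimately show thesis using that by blast
qed

lemma coordinatewise_subsequence:
  fixes X :: "nat \<Rightarrow> nat \<Rightarrow> complex"
  assumes "\<And>i n. i < m \<Longrightarrow> cmod (X n i) \<le> K"
  shows "\<exists>r. strict_mono r \<and> (\<forall>i<m. convergent (\<lambda>n. X (r n) i))"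
  using assms
proof (induction m)
  case 0
  then show ?case by (intro exI[of _ "\<lambda>n. n"]) (simp add: strict_mono_def)
next
  case (Suc m)
  obtain r where r: "strict_mono r" "\<forall>i<m. convergent (\<lambda>n. X (r n) i)"
    using Suc.IH Suc.prems by fastforce
  obtain s where s: "strict_mono s" "convergent (\<lambda>n. X (r (s n)) m)"
    using bounded_complex_subsequence[of "\<lambda>n. X (r n) m" K] Suc.prems[of m] by auto
  have "convergent (\<lambda>n. X (r (s n)) i)" if "i < m" for i
    using convergent_subseq_convergent[of "\<lambda>n. X (r n) i" s] r(2) s(1) that by (simp add: o_def)
  then have "\<forall>i<Suc m. convergent (\<lambda>n. X (r (s n)) i)" using s(2) less_Suc_eq by auto
  moreover have "strict_mono (\<lambda>n. r (s n))" using r s by (simp add: strict_mono_def)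
  ultimately show ?case by blast
qed

text \<open>The truncations of \<open>v\<close> to the first \<open>k\<close> coordinates allow an induction on \<open>k\<close>.\<close>

lemma vec_norm_le_coordinates:
  assumes N: "is_vec_norm m N" and v: "v \<in> carrier_vec m"
  shows "N v \<le> (\<Sum>j<m. cmod (v $ j) * N (unit_vec m j))"
proof -
  define u where "u k = vec m (\<lambda>j. if j < k then v $ j else 0)" for k
  have "N (u k) \<le> (\<Sum>j<k. cmod (v $ j) * N (unit_vec m j))" if "k \<le> m" for k
    using that
  proof (induction k)
    case 0
    have "u 0 = 0\<^sub>v m" by (intro eq_vecI) (auto simp: u_def)
    moreover have "N (0\<^sub>v m) = 0" using N zero_carrier_vec[of m] unfolding is_vec_norm_def by blast
    ultimately show ?case by simp
  next
    case (Suc k)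
    have "u (Suc k) = u k + v $ k \<cdot>\<^sub>v unit_vec m k"
      using Suc.prems by (intro eq_vecI) (auto simp: u_def less_Suc_eq)
    moreover have "N (u k + v $ k \<cdot>\<^sub>v unit_vec m k) \<le> N (u k) + N (v $ k \<cdot>\<^sub>v unit_vec m k)"
    proof -
      have "u k \<in> carrier_vec m" "v $ k \<cdot>\<^sub>v unit_vec m k \<in> carrier_vec m" by (simp_all add: u_def)
      then show ?thesis using N unfolding is_vec_norm_def by blast
    qed
    moreover have "N (v $ k \<cdot>\<^sub>v unit_vec m k) = cmod (v $ k) * N (unit_vec m k)"
      using N unfolding is_vec_norm_def by auto
    ultimately show ?case using Suc by simp
  qed
  moreover have "u m = v" using v by (intro eq_vecI) (auto simp: u_def)
  ultimately show ?thesis by (metis order_refl)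
qed

text \<open>If not, unit vectors of the sum norm with \<open>N\<close> tending to 0 would accumulate at a nonzero
  vector of norm 0.\<close>

lemma coordinate_le_vec_norm:
  assumes N: "is_vec_norm m N" and i: "i < m"
  shows "\<exists>C\<ge>0. \<forall>v\<in>carrier_vec m. cmod (v $ i) \<le> C * N v"
proof (rule ccontr)
  assume "\<not> ?thesis"
  then have ex: "\<exists>v\<in>carrier_vec m. real n * N v < cmod (v $ i)" for n :: nat
    by (metis not_le of_nat_0_le_iff)
  have N_smult: "N (a \<cdot>\<^sub>v v) = cmod a * N v" and N_nn: "0 \<le> N v"
    and N_tri: "w \<in> carrier_vec m \<Longrightarrow> N (v + w) \<le> N v + N w"
    and N_0: "N v = 0 \<Longrightarrow> v = 0\<^sub>v m"
    if "v \<in> carrier_vec m" for a v w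
    using N that unfolding is_vec_norm_def by auto
  have "\<exists>w\<in>carrier_vec m. (\<Sum>j<m. cmod (w $ j)) = 1 \<and> real n * N w \<le> 1" for n :: nat
  proof -
    obtain v where v: "v \<in> carrier_vec m" "real n * N v < cmod (v $ i)" using ex by blast
    define S where "S = (\<Sum>j<m. cmod (v $ j))"
    have S_ge: "cmod (v $ i) \<le> S" unfolding S_def using i by (intro member_le_sum) auto
    moreover have "0 \<le> real n * N v" using N_nn[OF v(1)] by simp
    ultimately have S0: "0 < S" using v(2) by linarith
    define w where "w = of_real (1 / S) \<cdot>\<^sub>v v"
    have w: "w \<in> carrier_vec m" using v(1) by (simp add: w_def)
    have "(\<Sum>j<m. cmod (w $ j)) = (\<Sum>j<m. cmod (v $ j) / S)"
      using v(1) S0 by (intro sum.cong) (auto simp: w_def norm_mult norm_divide)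
    also have "\<dots> = 1" using S0 by (simp add: sum_divide_distrib[symmetric] S_def)
    finally have 1: "(\<Sum>j<m. cmod (w $ j)) = 1" .
    have "real n * N w = real n * N v / S"
      using S0 N_smult[OF v(1)] by (simp add: w_def norm_divide)
    also have "\<dots> \<le> 1" using v(2) S_ge S0 by simp
    finally show ?thesis using w 1 by blast
  qed
  then obtain w where w: "w n \<in> carrier_vec m" "(\<Sum>j<m. cmod (w n $ j)) = 1" "real n * N (w n) \<le> 1" for n
    by metis
  have "cmod (w n $ j) \<le> 1" if "j < m" for n j
    using member_le_sum[of j "{..<m}" "\<lambda>j. cmod (w n $ j)"] w(2)[of n] that by simp
  then obtain r where r: "strict_mono r" "\<And>j. j < m \<Longrightarrow> convergent (\<lambda>n. w (r n) $ j)"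
    using coordinatewise_subsequence[of m "\<lambda>n j. w n $ j" 1] by blast
  define z where "z = vec m (\<lambda>j. lim (\<lambda>n. w (r n) $ j))"
  have z: "z \<in> carrier_vec m" by (simp add: z_def)
  have lim: "(\<lambda>n. w (r n) $ j) \<longlonglongrightarrow> z $ j" if "j < m" for j
    using r(2)[OF that] that by (simp add: z_def convergent_LIMSEQ_iff)
  have "(\<lambda>n. \<Sum>j<m. cmod (w (r n) $ j)) \<longlonglongrightarrow> (\<Sum>j<m. cmod (z $ j))"
    by (intro tendsto_sum tendsto_norm lim) auto
  then have sum1: "(\<Sum>j<m. cmod (z $ j)) = 1" by (simp add: w(2) LIMSEQ_const_iff)
  have le: "N z \<le> (\<Sum>j<m. cmod (z $ j - w (r n) $ j) * N (unit_vec m j)) + 1 / real n" if "0 < n" for n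
  proof -
    have "z = (z - w (r n)) + w (r n)" using z w(1)[of "r n"] by (intro eq_vecI) auto
    then have "N z \<le> N (z - w (r n)) + N (w (r n))"
      using N_tri[of "z - w (r n)" "w (r n)"] z w(1)[of "r n"] by auto
    moreover have "N (z - w (r n)) \<le> (\<Sum>j<m. cmod ((z - w (r n)) $ j) * N (unit_vec m j))"
      by (rule vec_norm_le_coordinates[OF N]) (use z w(1) in auto)
    moreover have "(\<Sum>j<m. cmod ((z - w (r n)) $ j) * N (unit_vec m j)) =
        (\<Sum>j<m. cmod (z $ j - w (r n) $ j) * N (unit_vec m j))"
      using z w(1)[of "r n"] by (intro sum.cong) auto
    moreover have "N (w (r n)) \<le> 1 / real n"
    proof -
      have "real n * N (w (r n)) \<le> real (r n) * N (w (r n))"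
        using seq_suble[OF r(1), of n] N_nn[OF w(1)] by (intro mult_right_mono) auto
      also have "\<dots> \<le> 1" by (rule w(3))
      finally show ?thesis using that by (simp add: field_simps)
    qed
    ultimately show ?thesis by linarith
  qed
  have "(\<lambda>n. (\<Sum>j<m. cmod (z $ j - w (r n) $ j) * N (unit_vec m j)) + 1 / real n)
      \<longlonglongrightarrow> (\<Sum>j<m. cmod (z $ j - z $ j) * N (unit_vec m j)) + 0"
    by (intro tendsto_add tendsto_sum tendsto_mult tendsto_norm tendsto_diff tendsto_const lim lim_1_over_n) auto
  then have "N z \<le> (\<Sum>j<m. cmod (z $ j - z $ j) * N (unit_vec m j)) + 0"
    by (rule LIMSEQ_le_const) (use le in \<open>auto intro: exI[of _ 1]\<close>)
  then have "N z = 0" using N_nn[OF z] by simp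
  then have "z = 0\<^sub>v m" by (rule N_0[OF z])
  then show False using sum1 by simp
qed

section \<open>Nilpotent matrices and group inverses\<close>

text \<open>All Jordan blocks belong to the eigenvalue 0. The power must be positive for \<open>n = 0\<close> too.\<close>

lemma spectral_radius_zero_nilpotent:
  fixes A :: "complex mat"
  assumes A: "A \<in> carrier_mat n n" and sr: "0 < n \<longrightarrow> spectral_radius A = 0"
  shows "\<exists>k>0. A ^\<^sub>m k = 0\<^sub>m n n"
proof (cases "n = 0")
  case True
  then have "A ^\<^sub>m 1 = 0\<^sub>m n n" using A by (intro eq_matI) auto
  then show ?thesis by (intro exI[of _ 1]) simp
next
  case False
  obtain n_as where jnf: "jordan_nf A n_as"
    using jordan_nf_exists[OF A] char_poly_factorized[OF A] by blast
  obtain P Q where PQ: "P \<in> carrier_mat n n" "Q \<in> carrier_mat n n"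
    and cp: "char_poly A = (\<Prod>(na, a)\<leftarrow>n_as. [:- a, 1:] ^ na)"
    and pow: "\<And>k. A ^\<^sub>m k = P * (jordan_matrix n_as) ^\<^sub>m k * Q"
    using jordan_nf_powE[OF A jnf] by blast
  have zero: "a = 0" if "(k, a) \<in> set n_as" for k a
  proof -
    have "k \<noteq> 0" using jnf that by (force simp: jordan_nf_def)
    then have "poly (char_poly A) a = 0"
      unfolding cp poly_prod_list using that by (force simp: prod_list_zero_iff o_def)
    then have "a \<in> spectrum A" using spectrum_root_char_poly[OF A] by simp
    then have "cmod a \<le> 0" using spectral_radius_mem_max(2)[OF A, of "cmod a"] False sr by auto
    then show ?thesis by simp
  qed
  define k where "k = Suc (sum_list (map fst n_as))"
  have kge: "l < k" if "(l, a) \<in> set n_as" for l a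
    using member_le_sum_list[of l "map fst n_as"] that by (force simp: k_def)
  have "jordan_matrix n_as ^\<^sub>m k = 0\<^sub>m (sum_list (map fst n_as)) (sum_list (map fst n_as))"
    unfolding jordan_matrix_pow
  proof (use zero kge in \<open>induction n_as\<close>)
    case Nil then show ?case by simp
  next
    case (Cons x xs)
    obtain l a where x: "x = (l, a)" by force
    have "a = 0" "l < k" using Cons.prems x by auto
    then have "jordan_block l a ^\<^sub>m k = 0\<^sub>m l l"
      unfolding \<open>a = 0\<close> jordan_block_zero_pow by (intro eq_matI) auto
    moreover have "diag_block_mat (map (\<lambda>(n, a). jordan_block n a ^\<^sub>m k) xs) =
        0\<^sub>m (sum_list (map fst xs)) (sum_list (map fst xs))"
      by (rule Cons.IH) (use Cons.prems in auto)
    ultimately show ?case by (simp add: x Let_def)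
  qed
  moreover have "jordan_matrix n_as \<in> carrier_mat n n"
    using jnf A unfolding jordan_nf_def similar_mat_def similar_mat_wit_def Let_def by auto
  then have "sum_list (map fst n_as) = n" using jordan_matrix_carrier[of n_as] by auto
  ultimately have "A ^\<^sub>m k = 0\<^sub>m n n" unfolding pow using PQ by simp
  then show ?thesis by (auto simp: k_def)
qed

lemma group_inverse_unique:
  fixes H :: "'a :: field mat"
  assumes H: "H \<in> carrier_mat n n" and X: "is_group_inverse H X" and Y: "is_group_inverse H Y"
  shows "X = Y"
proof -
  have c: "X \<in> carrier_mat n n" "Y \<in> carrier_mat n n"
    using H X Y by (auto simp: is_group_inverse_def)
  note as = assoc_mult_mat[of _ n n _ n _ n]
  have X_eqs: "H * X = X * H" "H * X * H = H" "X * H * X = X"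
    using X unfolding is_group_inverse_def by blast+
  have Y_eqs: "H * Y = Y * H" "H * Y * H = H" "Y * H * Y = Y"
    using Y unfolding is_group_inverse_def by blast+
  have "X * H = X * (H * Y * H)" by (simp only: Y_eqs(2))
  also have "\<dots> = (X * H) * (Y * H)" using H c by (simp add: as)
  also have "\<dots> = (H * X) * (H * Y)" by (simp only: X_eqs(1) Y_eqs(1))
  also have "\<dots> = (H * X * H) * Y" using H c by (simp add: as)
  also have "\<dots> = H * Y" by (simp only: X_eqs(2))
  finally have eq: "X * H = H * Y" .
  have "X = X * H * X" by (simp only: X_eqs(3))
  also have "\<dots> = Y * H * X" by (simp only: eq Y_eqs(1))
  also have "\<dots> = Y * (H * X)" using H c by (simp add: as)
  also have "\<dots> = Y * (H * Y)" by (simp only: eq X_eqs(1))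
  also have "\<dots> = Y * H * Y" using H c by (simp add: as)
  also have "\<dots> = Y" by (rule Y_eqs(3))
  finally show ?thesis .
qed

text \<open>With the projection \<open>Q = e p\<close> to the kernel, \<open>H + Q\<close> is injective, and its inverse \<open>Z\<close> satisfies
  \<open>H Z = Z H = 1 - Q\<close>; therefore \<open>Z - Q\<close> is the group inverse.\<close>

lemma group_inverse_simple_kernel:
  fixes H :: "'a :: field mat"
  assumes H: "H \<in> carrier_mat n n" and e: "e \<in> carrier_mat n 1" and p: "p \<in> carrier_mat 1 n"
    and He: "H * e = 0\<^sub>m n 1" and pH: "p * H = 0\<^sub>m 1 n" and pe: "p * e = 1\<^sub>m 1"
    and ker: "\<And>v. v \<in> carrier_vec n \<Longrightarrow> H *\<^sub>v v = 0\<^sub>v n \<Longrightarrow> \<exists>c. v = c \<cdot>\<^sub>v col e 0"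
  shows "is_group_inverse H (group_inverse H)"
proof -
  define Q where "Q = e * p"
  have Qc: "Q \<in> carrier_mat n n" unfolding Q_def using e p by (rule mult_carrier_mat)
  have HQ: "H * Q = 0\<^sub>m n n"
    unfolding Q_def using assoc_mult_mat[OF H e p] p by (simp add: He)
  have QH: "Q * H = 0\<^sub>m n n"
    unfolding Q_def using assoc_mult_mat[OF e p H] e by (simp add: pH)
  have pQ: "p * Q = p"
    unfolding Q_def using assoc_mult_mat[OF p e p] p by (simp add: pe del: One_nat_def)
  have QQ: "Q * Q = Q"
    using assoc_mult_mat[OF e p Qc] by (simp add: pQ flip: Q_def)
  have HPc: "H + Q \<in> carrier_mat n n" using Qc by simp
  obtain Z where Z: "Z \<in> carrier_mat n n" "(H + Q) * Z = 1\<^sub>m n" "Z * (H + Q) = 1\<^sub>m n"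
  proof (rule injective_mat_inverse[OF HPc])
    fix v :: "'a vec" assume v: "v \<in> carrier_vec n" and z: "(H + Q) *\<^sub>v v = 0\<^sub>v n"
    have "p *\<^sub>v v = (p * (H + Q)) *\<^sub>v v"
      using mult_add_distrib_mat[OF p H Qc] p by (simp add: pH pQ del: One_nat_def)
    also have "\<dots> = p *\<^sub>v ((H + Q) *\<^sub>v v)" by (rule assoc_mult_mat_vec[OF p HPc v])
    also have "\<dots> = 0\<^sub>v 1" unfolding z using p by (intro eq_vecI) (auto simp: scalar_prod_def)
    finally have pv: "p *\<^sub>v v = 0\<^sub>v 1" .
    have "Q *\<^sub>v v = e *\<^sub>v (p *\<^sub>v v)" unfolding Q_def by (rule assoc_mult_mat_vec[OF e p v])
    also have "\<dots> = 0\<^sub>v n" unfolding pv using e by (intro eq_vecI) (auto simp: scalar_prod_def)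
    finally have "H *\<^sub>v v = 0\<^sub>v n"
      using z add_mult_distrib_mat_vec[OF H Qc v] H v by (simp add: right_zero_vec[of _ n])
    then obtain c where c: "v = c \<cdot>\<^sub>v col e 0" using ker v by blast
    have "p *\<^sub>v v = c \<cdot>\<^sub>v (p *\<^sub>v col e 0)" unfolding c by (rule mult_mat_vec[OF p]) (use e in auto)
    also have "p *\<^sub>v col e 0 = col (p * e) 0" using p e by (intro col_mult2[symmetric]) auto
    also have "\<dots> = unit_vec 1 0" unfolding pe by (intro eq_vecI) auto
    finally have "(c \<cdot>\<^sub>v unit_vec 1 0) $ 0 = (0\<^sub>v 1 :: 'a vec) $ 0" using pv by simp
    then have "c = 0" by simp
    then show "v = 0\<^sub>v n" using c v e by (intro eq_vecI) auto
  qed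
  note cs = H Qc Z(1)
  note as = assoc_mult_mat[of _ n n _ n _ n]
  note dist = mult_add_distrib_mat[of _ n n _ n] add_mult_distrib_mat[of _ n n _ _ n]
    minus_mult_distrib_mat[of _ n n _ _ n] mult_minus_distrib_mat[of _ n n _ n]
  have "Z * ((H + Q) * Q) = Q" using Z cs by (simp flip: as)
  then have ZQ: "Z * Q = Q" using cs by (simp add: dist HQ QQ)
  have "(Q * (H + Q)) * Z = Q" using Z cs by (simp add: as)
  then have QZ: "Q * Z = Q" using cs by (simp add: dist QH QQ)
  have complement: "Y = 1\<^sub>m n - Q" if "Y + Q = 1\<^sub>m n" "Y \<in> carrier_mat n n" for Y
    using mat_diff_eq_iff[OF one_carrier_mat cs(2) that(2)] that(1) by simp
  have HZ: "H * Z = 1\<^sub>m n - Q"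
    by (rule complement) (use Z(2) cs in \<open>simp_all add: dist QZ\<close>)
  have ZH: "Z * H = 1\<^sub>m n - Q"
    by (rule complement) (use Z(3) cs in \<open>simp_all add: dist ZQ\<close>)
  have zero: "A - 0\<^sub>m n n = A" if "A \<in> carrier_mat n n" for A :: "'a mat"
    using that by (intro eq_matI) auto
  have cQ: "1\<^sub>m n - Q \<in> carrier_mat n n" using cs(2) by (rule minus_carrier_mat)
  define X where "X = Z - Q"
  have Xc: "X \<in> carrier_mat n n" unfolding X_def using cs(2) by (rule minus_carrier_mat)
  have HX: "H * X = 1\<^sub>m n - Q" unfolding X_def using cs by (simp add: dist HQ HZ zero[OF cQ])
  have XH: "X * H = 1\<^sub>m n - Q" unfolding X_def using cs by (simp add: dist QH ZH zero[OF cQ])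
  have 1: "H * X * H = H" unfolding HX using cs by (simp add: dist QH zero)
  have "Q * X = 0\<^sub>m n n" unfolding X_def using cs by (simp add: dist QZ QQ minus_r_inv_mat[of _ n n])
  then have "(1\<^sub>m n - Q) * X = X" using cs(2) Xc by (simp add: dist zero)
  then have 2: "X * H * X = X" unfolding XH .
  have "is_group_inverse H X"
    unfolding is_group_inverse_def using Xc H HX XH 1 2 by simp
  then have "\<exists>!X. is_group_inverse H X" using group_inverse_unique[OF H] by blast
  then show ?thesis unfolding group_inverse_def by (rule theI')
qed

section \<open>The Green matrix of the two-sided walk\<close>

context skip_free_walk
begin

lemma substochastic_pow:
  fixes G :: "real mat"
  assumes Gn: "0\<^sub>m m m \<le> G" and sub: "\<And>a. a < m \<Longrightarrow> (\<Sum>b<m. G $$ (a, b)) \<le> 1"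
    and a: "a < m"
  shows "(\<Sum>b<m. (G ^\<^sub>m k) $$ (a, b)) \<le> 1"
  using a
proof (induction k arbitrary: a)
  case 0
  have "dim_row G = m" using Gn by (auto simp: mat_nonneg_iff)
  then have "(\<Sum>b<m. (G ^\<^sub>m 0) $$ (a, b)) = (\<Sum>b<m. if a = b then 1 else 0)"
    using 0 by (intro sum.cong) auto
  also have "\<dots> = 1" using 0 by simp
  finally show ?case by simp
next
  case (Suc k)
  have Gc [simp]: "G \<in> carrier_mat m m" using Gn by (simp add: mat_nonneg_iff)
  have "(\<Sum>b<m. (G ^\<^sub>m Suc k) $$ (a, b)) = (\<Sum>b<m. \<Sum>c<m. G $$ (a, c) * (G ^\<^sub>m k) $$ (c, b))"
    unfolding mat_pow_Suc_left[OF Gc]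
    by (intro sum.cong refl index_mult_mat_sum[OF Gc _ Suc.prems]) auto
  also have "\<dots> = (\<Sum>c<m. G $$ (a, c) * (\<Sum>b<m. (G ^\<^sub>m k) $$ (c, b)))"
    by (subst sum.swap) (simp add: sum_distrib_left)
  also have "\<dots> \<le> (\<Sum>c<m. G $$ (a, c) * 1)"
    using Suc Gn by (intro sum_mono mult_left_mono) (auto simp: mat_nonneg_iff)
  also have "\<dots> \<le> 1" using sub[OF Suc.prems] by simp
  finally show ?case .
qed

text \<open>The terms are summable because the powers of \<open>G\<close> are bounded and those of \<open>R\<close> summable. In the walk,
  \<open>Q\<close> counts the visits to the starting level: \<open>N\<close> those before the first passage below it, and
  \<open>G Q R\<close> the later ones.\<close>

lemma green_series:
  fixes G N R :: "real mat"
  assumes Gn: "0\<^sub>m m m \<le> G" and sub: "\<And>a. a < m \<Longrightarrow> (\<Sum>b<m. G $$ (a, b)) \<le> 1"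
    and Nn: "0\<^sub>m m m \<le> N" and Rn: "0\<^sub>m m m \<le> R"
    and R: "\<And>a b. a < m \<Longrightarrow> b < m \<Longrightarrow> summable (\<lambda>k. (R ^\<^sub>m k) $$ (a, b))"
  obtains Q where "0\<^sub>m m m \<le> Q" "Q = N + G * Q * R"
    "\<forall>a<m. \<forall>b<m. (\<lambda>k. (G ^\<^sub>m k * N * R ^\<^sub>m k) $$ (a, b)) sums Q $$ (a, b)"
proof -
  have c [simp]: "G \<in> carrier_mat m m" "N \<in> carrier_mat m m" "R \<in> carrier_mat m m"
    using Gn Nn Rn by (simp_all only: mat_nonneg_iff)
  define t where "t k = G ^\<^sub>m k * N * R ^\<^sub>m k" for k
  have tn: "0\<^sub>m m m \<le> t k" for k
    unfolding t_def by (intro mat_mult_nonneg[of m m] mat_pow_nonneg Gn Nn Rn)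
  have tc [simp]: "t k \<in> carrier_mat m m" for k by (simp add: t_def)
  have NR: "(N * R ^\<^sub>m k) $$ (a, b) = (\<Sum>c<m. N $$ (a, c) * (R ^\<^sub>m k) $$ (c, b))" if "a < m" "b < m" for a b k
    by (rule index_mult_mat_sum[OF _ _ that]) simp_all
  have t_summable: "summable (\<lambda>k. t k $$ (a, b))" if ab: "a < m" "b < m" for a b
  proof (rule summable_comparison_test')
    show "summable (\<lambda>k. \<Sum>c<m. (N * R ^\<^sub>m k) $$ (c, b))"
      by (intro summable_sum) (use ab R in \<open>auto simp: NR simp del: index_mult_mat(1) intro!: summable_sum summable_mult\<close>)
    fix k :: nat assume "0 \<le> k"
    have "t k = G ^\<^sub>m k * (N * R ^\<^sub>m k)" by (simp add: t_def)
    then have "t k $$ (a, b) = (\<Sum>c<m. (G ^\<^sub>m k) $$ (a, c) * (N * R ^\<^sub>m k) $$ (c, b))"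
      using ab by (simp only:) (rule index_mult_mat_sum[of _ m m _ m], auto)
    also have "\<dots> \<le> (\<Sum>c<m. 1 * (N * R ^\<^sub>m k) $$ (c, b))"
    proof (intro sum_mono mult_right_mono)
      fix c assume "c \<in> {..<m}"
      then have c: "c < m" by simp
      have nn: "0 \<le> (G ^\<^sub>m k) $$ (a, d)" if "d < m" for d
        using mat_pow_nonneg[OF Gn, of k] ab that by (simp add: mat_nonneg_iff)
      then have "(G ^\<^sub>m k) $$ (a, c) \<le> (\<Sum>d<m. (G ^\<^sub>m k) $$ (a, d))"
        using c by (intro member_le_sum) auto
      then show "(G ^\<^sub>m k) $$ (a, c) \<le> 1"
        using substochastic_pow[OF Gn sub ab(1), of k] by simp
      have "0\<^sub>m m m \<le> N * R ^\<^sub>m k" by (intro mat_mult_nonneg[of m m] mat_pow_nonneg Nn Rn)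
      then show "0 \<le> (N * R ^\<^sub>m k) $$ (c, b)" using c ab by (simp only: mat_nonneg_iff)
    qed
    finally show "norm (t k $$ (a, b)) \<le> (\<Sum>c<m. (N * R ^\<^sub>m k) $$ (c, b))"
      using tn[of k] ab by (simp add: mat_nonneg_iff)
  qed
  define P where "P n = mat m m (\<lambda>(a, b). \<Sum>k<n. t k $$ (a, b))" for n
  define Q where "Q = mat m m (\<lambda>(a, b). \<Sum>k. t k $$ (a, b))"
  have Pc [simp]: "P n \<in> carrier_mat m m" for n by (simp add: P_def)
  have PQ: "mat_tendsto m m P Q"
    unfolding mat_tendsto_def
    by (auto simp: P_def Q_def intro!: summable_LIMSEQ t_summable)
  have P_Suc: "P (Suc n) = P n + t n" for n by (intro eq_matI) (auto simp: P_def)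
  have t_Suc: "t (Suc n) = G * t n * R" for n
    unfolding t_def mat_pow_Suc_left[OF c(1)] by simp
  have rec: "P (Suc n) = N + G * P n * R" for n
  proof (induction n)
    case 0
    have "P 0 = 0\<^sub>m m m" by (intro eq_matI) (auto simp: P_def)
    moreover have "P (Suc 0) = N" by (intro eq_matI) (auto simp: P_def t_def)
    ultimately show ?case by (simp add: left_mult_zero_mat[of _ m m])
  next
    case (Suc n)
    have "P (Suc (Suc n)) = (N + G * P n * R) + G * t n * R" by (simp only: P_Suc[of "Suc n"] Suc t_Suc)
    also have "\<dots> = N + G * P (Suc n) * R" by (simp add: P_Suc[of n] square_distribs)
    finally show ?case .
  qed
  have "mat_tendsto m m (\<lambda>n. P (Suc n)) (N + G * Q * R)"
    unfolding rec by (intro mat_tendsto_add mat_tendsto_mult[of _ m] mat_tendsto_const PQ c)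
  then have "Q = N + G * Q * R" using mat_tendsto_unique mat_tendsto_Suc[OF PQ] by blast
  moreover have "0\<^sub>m m m \<le> Q"
    using tn by (auto simp: mat_nonneg_iff Q_def intro!: suminf_nonneg t_summable)
  moreover have "\<forall>a<m. \<forall>b<m. (\<lambda>k. t k $$ (a, b)) sums Q $$ (a, b)"
    using t_summable by (auto simp: Q_def summable_sums)
  ultimately show thesis using that unfolding t_def by blast
qed

text \<open>Both sides are the block of the Green matrix that leads one level up. Algebraically, \<open>Q R\<^sup>i\<close> and
  \<open>Gh\<^sup>i Q\<close> for \<open>i = 0, 1, 2\<close> satisfy the same three-term relation and agree for \<open>i = 0\<close>, so that
  \<open>\<Delta> = Q R - Gh Q\<close> satisfies \<open>\<Delta> = A0 \<Delta> + Am (Gh \<Delta> + \<Delta> R)\<close>. With \<open>Nh\<close>, the counterpart of \<open>N\<close> for the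
  reflected walk, this becomes the Sylvester equation \<open>\<Delta> = Nh Am \<Delta> R\<close>, and \<open>\<alpha> Am Nh \<le> \<alpha>\<close> holds for
  the invariant row \<open>\<alpha>\<close> of the phases because \<open>Am Nh\<close> is the counterpart of \<open>R\<close>.\<close>

lemma green_commutation:
  assumes G: "solves_G G" and minG: "\<And>Y. solves_G Y \<Longrightarrow> G \<le> Y"
    and Gh: "skip_free_walk.solves_G m A1 A0 Am Gh"
    and minGh: "\<And>Y. skip_free_walk.solves_G m A1 A0 Am Y \<Longrightarrow> Gh \<le> Y"
    and N: "0\<^sub>m m m \<le> N" "(1\<^sub>m m - (A0 + A1 * G)) * N = 1\<^sub>m m" "G = N * Am" "R = A1 * N"
    and R0: "mat_tendsto m m (\<lambda>k. R ^\<^sub>m k) (0\<^sub>m m m)"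
    and Q: "0\<^sub>m m m \<le> Q" "Q = N + G * Q * R"
    and irr: "irreducible_on {..<m} (\<lambda>a b. (Am + A0 + A1) $$ (a, b))" and m: "0 < m"
  shows "Q * R = Gh * Q"
proof -
  interpret rev: skip_free_walk m A1 A0 Am by (rule reflected)
  have Ghn: "0\<^sub>m m m \<le> Gh" and Gheq: "Gh = A1 + A0 * Gh + Am * (Gh * Gh)"
    using Gh unfolding rev.solves_G_def by blast+
  have Gn: "0\<^sub>m m m \<le> G" using G unfolding solves_G_def by blast
  have [simp]: "Gh \<in> carrier_mat m m" "G \<in> carrier_mat m m" "N \<in> carrier_mat m m" "Q \<in> carrier_mat m m"
    using Ghn Gn N(1) Q(1) by (simp_all only: mat_nonneg_iff)
  have Rc [simp]: "R \<in> carrier_mat m m" by (simp add: N(4))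
  have Rn: "0\<^sub>m m m \<le> R" unfolding N(4) by (intro mat_mult_nonneg[of m m] nonneg N(1))
  obtain Nh where Nh: "0\<^sub>m m m \<le> Nh" "(1\<^sub>m m - (A0 + Am * Gh)) * Nh = 1\<^sub>m m"
    "Nh * (1\<^sub>m m - (A0 + Am * Gh)) = 1\<^sub>m m" "Gh = Nh * A1" "rev.solves_R (Am * Nh)"
    "\<forall>X. rev.solves_R X \<longrightarrow> X \<le> Am * Nh \<longrightarrow> X = Am * Nh"
    by (rule rev.minimal_G_factorization[OF Gh minGh])
  have [simp]: "Nh \<in> carrier_mat m m" using Nh(1) by (simp only: mat_nonneg_iff)
  have sum_n: "0\<^sub>m m m \<le> Am + A0 + A1" by (intro mat_add_nonneg nonneg)
  have sum_rows: "(\<Sum>b<m. (Am + A0 + A1) $$ (a, b)) = 1" if "a < m" for a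
    using row_sums[OF that] that by (auto simp: add_ac intro!: sum.cong)
  obtain \<alpha> where \<alpha>: "\<alpha> \<in> carrier_mat 1 m" "\<forall>b<m. 0 < \<alpha> $$ (0, b)" "\<alpha> * (Am + A0 + A1) = \<alpha>"
    by (rule positive_invariant_row[OF m sum_n sum_rows irr])
  have \<alpha>_le: "\<alpha> * (Am * Nh) \<le> \<alpha>"
  proof -
    have Y: "0\<^sub>m m m \<le> Am * Nh" "Am * Nh = Am + Am * Nh * A0 + Am * Nh * (Am * Nh) * A1"
      using Nh(5) unfolding rev.solves_R_def by blast+
    obtain X where X: "0\<^sub>m m m \<le> X" "X \<le> Am * Nh" "X = Am + X * A0 + X * X * A1"
      and bd: "\<forall>n u. (\<forall>k. 0\<^sub>m n m \<le> u k) \<longrightarrow>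
         (\<forall>k. u k * Am + u (Suc k) * A0 + u (Suc (Suc k)) * A1 \<le> u (Suc k)) \<longrightarrow>
         (\<forall>k. u k * X \<le> u (Suc k))"
      by (rule least_solution_bound[OF nonneg(1) nonneg(2) nonneg(3) Y])
    have "rev.solves_R X" using X unfolding rev.solves_R_def by blast
    then have "X = Am * Nh" using X(2) Nh(6) by blast
    moreover have "\<alpha> * Am + \<alpha> * A0 + \<alpha> * A1 = \<alpha>"
      using \<alpha>(1,3) by (simp add: mult_add_distrib_mat[of _ 1 m _ m] assoc_add_mat[of _ 1 m] mult_carrier_mat[of _ 1 m _ m] del: One_nat_def)
    moreover have "0\<^sub>m 1 m \<le> \<alpha>" using \<alpha> by (auto simp: mat_nonneg_iff less_imp_le)
    ultimately show ?thesis using bd[rule_format, of 1 "\<lambda>_. \<alpha>"] by simp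
  qed
  have A1N: "A1 * Q = R + A1 * (G * (Q * R))"
    by (subst Q(2)) (simp add: square_distribs N(4))
  define \<Delta> where "\<Delta> = Q * R - Gh * Q"
  have \<Delta>c [simp]: "\<Delta> \<in> carrier_mat m m" by (simp add: \<Delta>_def)
  \<comment> \<open>The relation for \<open>i = 0\<close>, whose inhomogeneous term 1 is absorbed by \<open>A1N\<close> in the step to \<open>i = 1\<close>.\<close>
  have E1: "Q = 1\<^sub>m m + (A0 * Q + A1 * (G * Q)) + Am * (Q * R)"
  proof -
    have Am: "(1\<^sub>m m - (A0 + A1 * G)) * G = Am"
    proof -
      have "(1\<^sub>m m - (A0 + A1 * G)) * (N * Am) = ((1\<^sub>m m - (A0 + A1 * G)) * N) * Am" by simp
      also have "\<dots> = Am" by (simp only: N(2)) simp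
      finally show ?thesis by (simp only: N(3)[symmetric])
    qed
    have "(1\<^sub>m m - (A0 + A1 * G)) * Q = (1\<^sub>m m - (A0 + A1 * G)) * (N + G * Q * R)"
      by (subst Q(2)) (rule refl)
    also have "\<dots> = (1\<^sub>m m - (A0 + A1 * G)) * N + ((1\<^sub>m m - (A0 + A1 * G)) * G) * (Q * R)"
      by (subst mult_add_distrib_mat[of _ m m _ m]) simp_all
    also have "\<dots> = 1\<^sub>m m + Am * (Q * R)" by (simp only: N(2) Am)
    finally have "Q - (A0 * Q + A1 * (G * Q)) = 1\<^sub>m m + Am * (Q * R)" by (simp add: square_distribs)
    then have "Q = (1\<^sub>m m + Am * (Q * R)) + (A0 * Q + A1 * (G * Q))"
      by (subst (asm) mat_diff_eq_iff[of _ m m]) simp_all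
    also have "\<dots> = 1\<^sub>m m + (A0 * Q + A1 * (G * Q)) + Am * (Q * R)"
      by (intro eq_matI) (auto simp del: index_mult_mat(1))
    finally show ?thesis .
  qed
  have E2: "Q * R = A0 * (Q * R) + Am * (Q * R * R) + A1 * Q"
  proof -
    have "Q * R = (1\<^sub>m m + (A0 * Q + A1 * (G * Q)) + Am * (Q * R)) * R" by (subst E1[symmetric]) (rule refl)
    also have "\<dots> = R + (A0 * (Q * R) + A1 * (G * (Q * R))) + Am * (Q * R * R)" by (simp add: square_distribs)
    also have "\<dots> = A0 * (Q * R) + Am * (Q * R * R) + (R + A1 * (G * (Q * R)))"
      by (intro eq_matI) (auto simp del: index_mult_mat(1))
    finally show ?thesis by (simp only: A1N)
  qed
  have E3: "Gh * Q = A0 * (Gh * Q) + Am * (Gh * (Gh * Q)) + A1 * Q"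
  proof -
    have "Gh * Q = (A1 + A0 * Gh + Am * (Gh * Gh)) * Q" by (subst Gheq[symmetric]) (rule refl)
    also have "\<dots> = A1 * Q + A0 * (Gh * Q) + Am * (Gh * (Gh * Q))" by (simp add: square_distribs)
    also have "\<dots> = A0 * (Gh * Q) + Am * (Gh * (Gh * Q)) + A1 * Q"
      by (intro eq_matI) (auto simp del: index_mult_mat(1))
    finally show ?thesis .
  qed
  have "\<Delta> = A0 * \<Delta> + (Am * (Gh * \<Delta>) + Am * (\<Delta> * R))"
  proof -
    have "\<Delta> = (A0 * (Q * R) + Am * (Q * R * R) + A1 * Q) - (A0 * (Gh * Q) + Am * (Gh * (Gh * Q)) + A1 * Q)"
      unfolding \<Delta>_def by (simp only: E2[symmetric] E3[symmetric])
    also have "\<dots> = (A0 * (Q * R) - A0 * (Gh * Q)) + ((Am * (Gh * (Q * R)) - Am * (Gh * (Gh * Q)))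
        + (Am * (Q * R * R) - Am * (Gh * (Q * R))))"
      by (intro eq_matI) (auto simp del: index_mult_mat(1))
    also have "\<dots> = A0 * \<Delta> + (Am * (Gh * \<Delta>) + Am * (\<Delta> * R))"
      unfolding \<Delta>_def by (simp add: square_distribs)
    finally show ?thesis .
  qed
  then have "\<Delta> - (A0 * \<Delta> + Am * (Gh * \<Delta>)) = Am * (\<Delta> * R)"
    by (subst mat_diff_eq_iff[of _ m m]) (simp_all, subst comm_add_mat[of _ m m], simp_all)
  then have eq: "(1\<^sub>m m - (A0 + Am * Gh)) * \<Delta> = Am * (\<Delta> * R)" by (simp add: square_distribs)
  have "\<Delta> = (Nh * (1\<^sub>m m - (A0 + Am * Gh))) * \<Delta>" by (simp only: Nh(3)) simp
  also have "\<dots> = Nh * ((1\<^sub>m m - (A0 + Am * Gh)) * \<Delta>)" by simp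
  also have "\<dots> = Nh * Am * \<Delta> * R" by (simp only: eq) simp
  finally have "\<Delta> = 0\<^sub>m m m"
    by (rule sylvester_zero[OF Nh(1) nonneg(1) Rn \<Delta>c _ \<alpha>(1) \<alpha>(2)[rule_format] \<alpha>_le R0])
  then show ?thesis unfolding \<Delta>_def by (subst (asm) mat_minus_eq_zero_iff) simp_all
qed

end

section \<open>Finite sums and series of vectors\<close>

lemma vec_sum_carrier:
  assumes "\<And>j. j \<in> J \<Longrightarrow> f j \<in> carrier_vec n"
  shows "vec_sum n f J \<in> carrier_vec n"
  using finsum_vec_closed[of f J n] assms by blast

lemma vec_sum_index:
  assumes "finite J" "\<And>j. j \<in> J \<Longrightarrow> f j \<in> carrier_vec n" "i < n"
  shows "vec_sum n f J $ i = (\<Sum>j\<in>J. f j $ i)"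
  using assms by (intro index_finsum_vec) auto

lemma vec_sum_cong:
  assumes "finite J" "\<And>j. j \<in> J \<Longrightarrow> f j \<in> carrier_vec n" "\<And>j. j \<in> J \<Longrightarrow> f j = g j"
  shows "vec_sum n f J = vec_sum n g J"
proof (rule eq_vecI)
  have c: "vec_sum n f J \<in> carrier_vec n" "vec_sum n g J \<in> carrier_vec n"
    using assms vec_sum_carrier by metis+
  then show "dim_vec (vec_sum n f J) = dim_vec (vec_sum n g J)" by simp
  fix i assume "i < dim_vec (vec_sum n g J)"
  then have i: "i < n" using c by simp
  show "vec_sum n f J $ i = vec_sum n g J $ i"
    using assms i by (subst (1 2) vec_sum_index) auto
qed

lemma mult_mat_vec_sum:
  fixes A :: "complex mat"
  assumes A: "A \<in> carrier_mat l n" and J: "finite J" and f: "\<And>j. j \<in> J \<Longrightarrow> f j \<in> carrier_vec n"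
  shows "A *\<^sub>v vec_sum n f J = vec_sum l (\<lambda>j. A *\<^sub>v f j) J"
proof (rule eq_vecI)
  have Af: "A *\<^sub>v f j \<in> carrier_vec l" if "j \<in> J" for j using A f that by auto
  have c: "vec_sum n f J \<in> carrier_vec n" "vec_sum l (\<lambda>j. A *\<^sub>v f j) J \<in> carrier_vec l"
    by (intro vec_sum_carrier f Af; assumption)+
  then show "dim_vec (A *\<^sub>v vec_sum n f J) = dim_vec (vec_sum l (\<lambda>j. A *\<^sub>v f j) J)" using A by simp
  fix i assume "i < dim_vec (vec_sum l (\<lambda>j. A *\<^sub>v f j) J)"
  then have i: "i < l" using c by simp
  have "(A *\<^sub>v vec_sum n f J) $ i = (\<Sum>a<n. A $$ (i, a) * (\<Sum>j\<in>J. f j $ a))"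
    unfolding index_mult_mat_vec_sum[OF A c(1) i]
    by (intro sum.cong arg_cong2[where f = "(*)"] refl vec_sum_index J f) auto
  also have "\<dots> = (\<Sum>j\<in>J. \<Sum>a<n. A $$ (i, a) * f j $ a)"
    by (subst sum.swap) (simp add: sum_distrib_left)
  also have "\<dots> = (\<Sum>j\<in>J. (A *\<^sub>v f j) $ i)"
    by (rule sum.cong[OF refl]) (rule index_mult_mat_vec_sum[OF A f i, symmetric])
  also have "\<dots> = vec_sum l (\<lambda>j. A *\<^sub>v f j) J $ i"
    by (intro vec_sum_index[symmetric] J Af i)
  finally show "(A *\<^sub>v vec_sum n f J) $ i = vec_sum l (\<lambda>j. A *\<^sub>v f j) J $ i" .
qed

lemma vec_sum_empty [simp]: "vec_sum n f {} = 0\<^sub>v n"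
  by (rule finsum_vec_empty)

lemma vec_sum_insert:
  assumes "finite J" "j \<notin> J" "\<And>j. f j \<in> carrier_vec n"
  shows "vec_sum n f (insert j J) = f j + vec_sum n f J"
  using assms by (intro finsum_vec_insert) auto

definition vec_sums :: "nat \<Rightarrow> (nat \<Rightarrow> complex vec) \<Rightarrow> complex vec \<Rightarrow> bool" where
  "vec_sums n f s \<longleftrightarrow> s \<in> carrier_vec n \<and> (\<forall>i<n. (\<lambda>k. f k $ i) sums s $ i)"

lemma vec_sums_suminf:
  assumes "vec_sums n f s"
  shows "vec_suminf n f = s" "vec_summable n f"
  using assms by (auto simp: vec_sums_def vec_suminf_def vec_summable_def sums_iff intro!: eq_vecI)

lemma vec_summable_sums: "vec_summable n f \<Longrightarrow> vec_sums n f (vec_suminf n f)"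
  by (auto simp: vec_sums_def vec_suminf_def vec_summable_def)

lemma vec_sums_mult:
  assumes A: "A \<in> carrier_mat l n" and f: "\<And>k. f k \<in> carrier_vec n" and s: "vec_sums n f s"
  shows "vec_sums l (\<lambda>k. A *\<^sub>v f k) (A *\<^sub>v s)"
proof -
  have sc: "s \<in> carrier_vec n" using s by (simp add: vec_sums_def)
  have "(\<lambda>k. (A *\<^sub>v f k) $ i) sums (A *\<^sub>v s) $ i" if "i < l" for i
    unfolding index_mult_mat_vec_sum[OF A sc that] index_mult_mat_vec_sum[OF A f that]
    using s by (intro sums_sum sums_mult) (auto simp: vec_sums_def)
  then show ?thesis using mult_mat_vec_carrier[OF A sc] by (simp add: vec_sums_def)
qed

lemma vec_sums_head:
  assumes "vec_sums n (\<lambda>k. f (Suc k)) s" "f 0 \<in> carrier_vec n"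
  shows "vec_sums n f (f 0 + s)"
  using assms sums_Suc[of "\<lambda>k. f k $ i" for i] by (auto simp: vec_sums_def add.commute)

lemma vec_sums_unique:
  assumes "vec_sums n f s" "vec_sums n f t"
  shows "s = t"
  using vec_sums_suminf(1)[OF assms(1)] vec_sums_suminf(1)[OF assms(2)] by simp

lemma vec_sums_vec_sum:
  assumes J: "finite J" and f: "\<And>j k. j \<in> J \<Longrightarrow> f j k \<in> carrier_vec n"
    and s: "\<And>j. j \<in> J \<Longrightarrow> vec_sums n (f j) (s j)"
  shows "vec_sums n (\<lambda>k. vec_sum n (\<lambda>j. f j k) J) (vec_sum n s J)"
proof -
  have sc: "s j \<in> carrier_vec n" if "j \<in> J" for j using s[OF that] by (simp add: vec_sums_def)
  have "(\<lambda>k. vec_sum n (\<lambda>j. f j k) J $ i) sums vec_sum n s J $ i" if "i < n" for i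
  proof -
    have eq: "vec_sum n (\<lambda>j. f j k) J $ i = (\<Sum>j\<in>J. f j k $ i)" for k
      by (intro vec_sum_index J f that)
    have "vec_sum n s J $ i = (\<Sum>j\<in>J. s j $ i)"
      by (intro vec_sum_index J sc that)
    then show ?thesis unfolding eq using s that by (auto simp: vec_sums_def intro!: sums_sum)
  qed
  then show ?thesis using vec_sum_carrier[OF sc] by (auto simp: vec_sums_def)
qed

text \<open>All norms dominate the coordinates, so the series is majorized by the summable one. The shift by
  \<open>n\<close> divides by \<open>\<rho>\<^sup>n\<close>; for \<open>\<rho> = 0\<close> only one term is left.\<close>

lemma power_series_summable:
  fixes R :: "complex mat"
  assumes R: "R \<in> carrier_mat m m"
    and bound: "\<And>i j. i < m \<Longrightarrow> j < m \<Longrightarrow> \<exists>C k0. \<forall>k\<ge>k0. cmod ((R ^\<^sub>m k) $$ (i, j)) \<le> C * \<rho> ^ k"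
    and \<rho>: "0 \<le> \<rho>" and N: "is_vec_norm m N" and g: "\<And>k. g k \<in> carrier_vec m"
    and summ: "summable (\<lambda>k. \<rho> ^ k * N (g k))"
  shows "vec_summable m (\<lambda>k. R ^\<^sub>m k *\<^sub>v g (n + k))"
  unfolding vec_summable_def
proof (intro allI impI)
  fix i assume i: "i < m"
  have shifted: "summable (\<lambda>k. \<rho> ^ k * N (g (n + k)))"
  proof (cases "\<rho> = 0")
    case True
    have "summable (\<lambda>k. (0::real) ^ k * N (g (n + k)))"
      by (rule summable_finite[of "{0}"]) auto
    then show ?thesis using True by simp
  next
    case False
    have "summable (\<lambda>k. \<rho> ^ (k + n) * N (g (k + n)))"
      using summ by (simp only: summable_iff_shift[of "\<lambda>k. \<rho> ^ k * N (g k)"])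
    then have "summable (\<lambda>k. (1 / \<rho> ^ n) * (\<rho> ^ (k + n) * N (g (k + n))))" by (rule summable_mult)
    then show ?thesis using False by (simp add: power_add add.commute)
  qed
  have "summable (\<lambda>k. (R ^\<^sub>m k) $$ (i, j) * g (n + k) $ j)" if j: "j < m" for j
  proof -
    obtain C k0 where C: "\<And>k. k \<ge> k0 \<Longrightarrow> cmod ((R ^\<^sub>m k) $$ (i, j)) \<le> C * \<rho> ^ k"
      using bound[OF i j] by blast
    obtain D where D: "0 \<le> D" "\<And>v. v \<in> carrier_vec m \<Longrightarrow> cmod (v $ j) \<le> D * N v"
      using coordinate_le_vec_norm[OF N j] by blast
    show ?thesis
    proof (rule summable_comparison_test'[of "\<lambda>k. (C * D) * (\<rho> ^ k * N (g (n + k)))" k0])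
      show "summable (\<lambda>k. (C * D) * (\<rho> ^ k * N (g (n + k))))" by (rule summable_mult[OF shifted])
      fix k assume k: "k \<ge> k0"
      have "norm ((R ^\<^sub>m k) $$ (i, j) * g (n + k) $ j) \<le> (C * \<rho> ^ k) * (D * N (g (n + k)))"
        unfolding norm_mult
        using C[OF k] D(2)[OF g] by (intro mult_mono) (auto intro: order_trans[OF norm_ge_zero])
      then show "norm ((R ^\<^sub>m k) $$ (i, j) * g (n + k) $ j) \<le> (C * D) * (\<rho> ^ k * N (g (n + k)))"
        by (simp add: mult_ac)
    qed
  qed
  then have "summable (\<lambda>k. \<Sum>j<m. (R ^\<^sub>m k) $$ (i, j) * g (n + k) $ j)"
    by (intro summable_sum) auto
  moreover have "(R ^\<^sub>m k *\<^sub>v g (n + k)) $ i = (\<Sum>j<m. (R ^\<^sub>m k) $$ (i, j) * g (n + k) $ j)" for k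
    by (rule index_mult_mat_vec_sum[OF _ g i]) (use R in simp)
  ultimately show "summable (\<lambda>k. (R ^\<^sub>m k *\<^sub>v g (n + k)) $ i)" by simp
qed

section \<open>Two representations of a solution of the difference equation\<close>

text \<open>Both sides are 0 for \<open>r = 0\<close> and satisfy the recursion \<open>z\<^sub>r\<^sub>+\<^sub>1 = G z\<^sub>r - d\<^sub>r\<^sub>+\<^sub>1\<close>.\<close>

lemma convolution_identity:
  fixes G Gh :: "complex mat"
  assumes [simp]: "G \<in> carrier_mat m m" "Gh \<in> carrier_mat m m"
    "\<And>n. u n \<in> carrier_vec m" "\<And>n. w n \<in> carrier_vec m"
    and u: "\<And>n. u n = w n + Gh *\<^sub>v u (Suc n)"
    and d: "\<And>n. d n = u n - G *\<^sub>v (Gh *\<^sub>v u n)"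
  shows "- vec_sum m (\<lambda>j. G ^\<^sub>m j *\<^sub>v d (r - j)) {..<r} =
    (- vec_sum m (\<lambda>k. G ^\<^sub>m (r - k) *\<^sub>v w k) {1..r} - Gh *\<^sub>v u (Suc r)) + G ^\<^sub>m r *\<^sub>v (Gh *\<^sub>v u 1)"
proof -
  have [simp]: "Gh *\<^sub>v u n \<in> carrier_vec m" for n by (rule mult_mat_vec_carrier[of _ m m]) simp_all
  have [simp]: "G *\<^sub>v (Gh *\<^sub>v u n) \<in> carrier_vec m" for n by (rule mult_mat_vec_carrier[of _ m m]) simp_all
  have dc [simp]: "d n \<in> carrier_vec m" for n unfolding d by (intro minus_carrier_vec) simp_all
  have [simp]: "dim_vec (d n) = m" for n by (rule carrier_vecD[OF dc])
  have [simp]: "G ^\<^sub>m j *\<^sub>v v \<in> carrier_vec m" if "v \<in> carrier_vec m" for j v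
    using that by (intro mult_mat_vec_carrier[of _ m m]) simp_all
  have dims [simp]: "dim_row G = m" "dim_row Gh = m" "dim_vec (u n) = m" "dim_vec (w n) = m" for n
    by (fact carrier_matD(1)[OF assms(1)] carrier_matD(1)[OF assms(2)] carrier_vecD[OF assms(3)] carrier_vecD[OF assms(4)])+
  have pow: "G ^\<^sub>m Suc j *\<^sub>v v = G *\<^sub>v (G ^\<^sub>m j *\<^sub>v v)" if "v \<in> carrier_vec m" for j v
    unfolding mat_pow_Suc_left[OF assms(1)] using that by (intro assoc_mult_mat_vec[of _ m m _ m]) simp_all
  define Y where "Y r = vec_sum m (\<lambda>j. G ^\<^sub>m j *\<^sub>v d (r - j)) {..<r}" for r
  define T where "T r = vec_sum m (\<lambda>k. G ^\<^sub>m (r - k) *\<^sub>v w k) {1..r}" for r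
  have Yc [simp]: "Y r \<in> carrier_vec m" and Tc [simp]: "T r \<in> carrier_vec m" for r
    unfolding Y_def T_def by (intro vec_sum_carrier; simp)+
  have [simp]: "dim_vec (Y r) = m" "dim_vec (T r) = m" for r using Yc[of r] Tc[of r] by (auto simp del: Yc Tc)
  have Gx [simp]: "G *\<^sub>v v \<in> carrier_vec m" if "v \<in> carrier_vec m" for v
    using that by (intro mult_mat_vec_carrier[of _ m m]) simp_all
  have Y_Suc: "Y (Suc r) = d (Suc r) + G *\<^sub>v Y r" for r
  proof -
    have "G *\<^sub>v Y r = vec_sum m (\<lambda>j. G *\<^sub>v (G ^\<^sub>m j *\<^sub>v d (r - j))) {..<r}"
      unfolding Y_def by (rule mult_mat_vec_sum) simp_all
    then have GY: "(G *\<^sub>v Y r) $ i = (\<Sum>j<r. (G ^\<^sub>m Suc j *\<^sub>v d (r - j)) $ i)" if "i < m" for i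
      using that by (simp only: pow[OF dc, symmetric]) (intro vec_sum_index, simp_all del: pow_mat.simps(2))
    have "Y (Suc r) $ i = (\<Sum>j<Suc r. (G ^\<^sub>m j *\<^sub>v d (Suc r - j)) $ i)" if "i < m" for i
      unfolding Y_def using that by (intro vec_sum_index) simp_all
    then have YS: "Y (Suc r) $ i = (G ^\<^sub>m 0 *\<^sub>v d (Suc r)) $ i + (\<Sum>j<r. (G ^\<^sub>m Suc j *\<^sub>v d (r - j)) $ i)"
      if "i < m" for i
      using that by (simp only: sum.lessThan_Suc_shift diff_Suc_Suc diff_zero)
    show ?thesis
      by (intro eq_vecI) (simp_all add: YS GY one_mult_mat_vec[OF dc] del: index_mult_mat_vec pow_mat.simps(2))
  qed
  have T_Suc: "T (Suc r) = G *\<^sub>v T r + w (Suc r)" for r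
  proof -
    have "G *\<^sub>v T r = vec_sum m (\<lambda>k. G *\<^sub>v (G ^\<^sub>m (r - k) *\<^sub>v w k)) {1..r}"
      unfolding T_def by (rule mult_mat_vec_sum) simp_all
    then have GT: "(G *\<^sub>v T r) $ i = (\<Sum>k\<in>{1..r}. (G ^\<^sub>m (Suc r - k) *\<^sub>v w k) $ i)" if "i < m" for i
      using that by (simp only: pow[OF assms(4), symmetric])
        (subst vec_sum_index, simp_all add: Suc_diff_le del: index_mult_mat_vec pow_mat.simps(2))
    have "T (Suc r) $ i = (\<Sum>k\<in>{1..Suc r}. (G ^\<^sub>m (Suc r - k) *\<^sub>v w k) $ i)" if "i < m" for i
      unfolding T_def using that by (intro vec_sum_index) simp_all
    then show ?thesis
      by (intro eq_vecI) (simp_all add: sum.cl_ivl_Suc GT one_mult_mat_vec[OF assms(4)] del: index_mult_mat_vec pow_mat.simps(2))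
  qed
  have "- Y r = (- T r - Gh *\<^sub>v u (Suc r)) + G ^\<^sub>m r *\<^sub>v (Gh *\<^sub>v u 1)"
  proof (induction r)
    case 0
    have "Y 0 = 0\<^sub>v m" "T 0 = 0\<^sub>v m" by (simp_all add: Y_def T_def)
    then show ?case
      by (intro eq_vecI) (simp_all add: one_mult_mat_vec[of _ m] del: index_mult_mat_vec)
  next
    case (Suc r)
    have "- Y (Suc r) = - d (Suc r) + G *\<^sub>v (- Y r)"
      by (simp add: Y_Suc mult_mat_vec_uminus[OF assms(1)]) (intro eq_vecI, simp_all del: index_mult_mat_vec)
    also have "G *\<^sub>v (- Y r) = (- (G *\<^sub>v T r) - G *\<^sub>v (Gh *\<^sub>v u (Suc r))) + G *\<^sub>v (G ^\<^sub>m r *\<^sub>v (Gh *\<^sub>v u 1))"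
      unfolding Suc by (subst mult_add_distrib_mat_vec[of _ m m])
        (simp_all add: mult_minus_distrib_mat_vec[of _ m m] mult_mat_vec_uminus[OF assms(1)])
    also have "- d (Suc r) + \<dots> = (- T (Suc r) - Gh *\<^sub>v u (Suc (Suc r))) + G ^\<^sub>m Suc r *\<^sub>v (Gh *\<^sub>v u 1)"
    proof (rule eq_vecI)
      fix i assume "i < dim_vec ((- T (Suc r) - Gh *\<^sub>v u (Suc (Suc r))) + G ^\<^sub>m Suc r *\<^sub>v (Gh *\<^sub>v u 1))"
      then have i: "i < m" by simp
      have "u (Suc r) $ i = w (Suc r) $ i + (Gh *\<^sub>v u (Suc (Suc r))) $ i"
        by (subst u) (use i in \<open>simp del: index_mult_mat_vec\<close>)
      then show "(- d (Suc r) + ((- (G *\<^sub>v T r) - G *\<^sub>v (Gh *\<^sub>v u (Suc r))) + G *\<^sub>v (G ^\<^sub>m r *\<^sub>v (Gh *\<^sub>v u 1)))) $ i =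
        ((- T (Suc r) - Gh *\<^sub>v u (Suc (Suc r))) + G ^\<^sub>m Suc r *\<^sub>v (Gh *\<^sub>v u 1)) $ i"
        using i by (simp add: d T_Suc pow del: index_mult_mat_vec pow_mat.simps(2))
    qed simp
    finally show ?case .
  qed
  then show ?thesis by (simp add: Y_def T_def)
qed

lemma intertwining_pow:
  fixes V E H :: "'a :: semiring_1 mat"
  assumes V: "V \<in> carrier_mat p p" and E: "E \<in> carrier_mat p m" and H: "H \<in> carrier_mat m m"
    and eq: "V * E = E * H"
  shows "V ^\<^sub>m k * E = E * H ^\<^sub>m k"
proof (induction k)
  case 0
  have "dim_row V = p" "dim_row H = m" using V H by simp_all
  then show ?case by (simp add: left_mult_one_mat[OF E] right_mult_one_mat[OF E])
next
  case (Suc k)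
  have "V ^\<^sub>m Suc k * E = V ^\<^sub>m k * (V * E)"
    using V E by (simp add: assoc_mult_mat[of _ p p _ p _ m])
  also have "\<dots> = (V ^\<^sub>m k * E) * H"
    unfolding eq using V E H by (simp add: assoc_mult_mat[of _ p p _ m _ m])
  also have "\<dots> = E * H ^\<^sub>m Suc k"
    unfolding Suc using E H by (simp add: assoc_mult_mat[of _ p m _ m _ m])
  finally show ?case .
qed

text \<open>The tail \<open>Gh u\<^sub>r\<^sub>+\<^sub>1\<close> is the sum of its parts \<open>L E Gh u\<^sub>r\<^sub>+\<^sub>1\<close> and \<open>K F Gh u\<^sub>r\<^sub>+\<^sub>1\<close>. In the first one
  \<open>V'\<close>, the inverse of \<open>V\<^sub>1\<close>, leads from the tail at \<open>r\<close> to the tail at \<open>r + 1\<close> up to one term, so the tail is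
  expressed by \<open>E Gh u\<^sub>1\<close>. The second one unfolds to a series in the powers of \<open>V\<^sub>0\<close>, which breaks off.\<close>

lemma spectral_splitting:
  fixes G Gh L K E F V\<^sub>1 V\<^sub>0 V' :: "complex mat"
  assumes G [simp]: "G \<in> carrier_mat m m" and Gh [simp]: "Gh \<in> carrier_mat m m"
    and L [simp]: "L \<in> carrier_mat m p" and K [simp]: "K \<in> carrier_mat m q"
    and E [simp]: "E \<in> carrier_mat p m" and F [simp]: "F \<in> carrier_mat q m"
    and V1 [simp]: "V\<^sub>1 \<in> carrier_mat p p" and V' [simp]: "V' \<in> carrier_mat p p"
    and V0 [simp]: "V\<^sub>0 \<in> carrier_mat q q"
    and VV: "V' * V\<^sub>1 = 1\<^sub>m p" and E_eq: "V\<^sub>1 * E = E * Gh" and F_eq: "V\<^sub>0 * F = F * Gh"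
    and LEKF: "L * E + K * F = 1\<^sub>m m" and nil: "V\<^sub>0 ^\<^sub>m \<nu> = 0\<^sub>m q q" and \<nu>: "0 < \<nu>"
    and uc [simp]: "\<And>n. u n \<in> carrier_vec m" and wc [simp]: "\<And>n. w n \<in> carrier_vec m"
    and u: "\<And>n. u n = w n + Gh *\<^sub>v u (Suc n)"
  shows "(L * V' ^\<^sub>m r) *\<^sub>v (- ((E * Gh) *\<^sub>v u 1)) +
     (- vec_sum m (\<lambda>k. (G ^\<^sub>m (r - k) - L * V' ^\<^sub>m (r - k) * E) *\<^sub>v w k) {1..r}
      - vec_sum m (\<lambda>j. (K * V\<^sub>0 ^\<^sub>m j * F) *\<^sub>v w (j + r)) {1..\<nu> - 1}) =
     - vec_sum m (\<lambda>k. G ^\<^sub>m (r - k) *\<^sub>v w k) {1..r} - Gh *\<^sub>v u (Suc r)"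
proof -
  have Ec [simp]: "E *\<^sub>v v \<in> carrier_vec p" "F *\<^sub>v v \<in> carrier_vec q" "Gh *\<^sub>v v \<in> carrier_vec m"
    if "v \<in> carrier_vec m" for v
    using that by (auto intro: mult_mat_vec_carrier[of _ p m] mult_mat_vec_carrier[of _ q m] mult_mat_vec_carrier[of _ m m])
  have Gp [simp]: "G ^\<^sub>m j *\<^sub>v v \<in> carrier_vec m" if "v \<in> carrier_vec m" for j v
    using that by (intro mult_mat_vec_carrier[of _ m m]) simp_all
  have Vp [simp]: "V' ^\<^sub>m j *\<^sub>v v \<in> carrier_vec p" "V' *\<^sub>v v \<in> carrier_vec p" "L *\<^sub>v v \<in> carrier_vec m" if "v \<in> carrier_vec p" for j v
    using that by (auto intro!: mult_mat_vec_carrier[of _ p p] mult_mat_vec_carrier[of _ m p])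
  have Vq [simp]: "V\<^sub>0 ^\<^sub>m j *\<^sub>v v \<in> carrier_vec q" "K *\<^sub>v v \<in> carrier_vec m" if "v \<in> carrier_vec q" for j v
    using that by (auto intro!: mult_mat_vec_carrier[of _ q q] mult_mat_vec_carrier[of _ m q])
  have [simp]: "dim_row V' = p" "dim_row V\<^sub>0 = q" "dim_row L = m" "dim_row K = m" "dim_row Gh = m" "dim_row G = m"
    using V' V0 L K Gh G by (auto simp del: V' V0 L K Gh G)
  \<comment> \<open>The tail in the coordinates of \<open>V\<^sub>1\<close>.\<close>
  define er where "er n = E *\<^sub>v (Gh *\<^sub>v u (Suc n))" for n
  have erc [simp]: "er n \<in> carrier_vec p" for n by (simp add: er_def)
  have er_eq: "V' *\<^sub>v er n = E *\<^sub>v w (Suc n) + er (Suc n)" for n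
  proof -
    have "er n = (E * Gh) *\<^sub>v u (Suc n)" unfolding er_def by (rule assoc_mult_mat_vec[OF E Gh uc, symmetric])
    also have "\<dots> = V\<^sub>1 *\<^sub>v (E *\<^sub>v u (Suc n))" unfolding E_eq[symmetric] by (rule assoc_mult_mat_vec[OF V1 E uc])
    finally have "V' *\<^sub>v er n = (V' * V\<^sub>1) *\<^sub>v (E *\<^sub>v u (Suc n))"
      using assoc_mult_mat_vec[OF V' V1, of "E *\<^sub>v u (Suc n)"] by simp
    also have "\<dots> = E *\<^sub>v u (Suc n)" unfolding VV by (rule one_mult_mat_vec) simp
    also have "\<dots> = E *\<^sub>v w (Suc n) + er (Suc n)"
      unfolding er_def by (subst u) (rule mult_add_distrib_mat_vec[OF E], simp_all)
    finally show ?thesis .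
  qed
  define T where "T r = vec_sum p (\<lambda>k. V' ^\<^sub>m (r - k) *\<^sub>v (E *\<^sub>v w k)) {1..r}" for r
  have Tc [simp]: "T r \<in> carrier_vec p" for r unfolding T_def by (intro vec_sum_carrier) simp
  have pow: "V' ^\<^sub>m Suc j *\<^sub>v v = V' *\<^sub>v (V' ^\<^sub>m j *\<^sub>v v)" if "v \<in> carrier_vec p" for j v
    unfolding mat_pow_Suc_left[OF V'] using that by (intro assoc_mult_mat_vec[of _ p p _ p]) simp_all
  have T_Suc: "T (Suc r) = V' *\<^sub>v T r + E *\<^sub>v w (Suc r)" for r
  proof -
    have "V' *\<^sub>v T r = vec_sum p (\<lambda>k. V' *\<^sub>v (V' ^\<^sub>m (r - k) *\<^sub>v (E *\<^sub>v w k))) {1..r}"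
      unfolding T_def by (rule mult_mat_vec_sum) simp_all
    also have "\<dots> = vec_sum p (\<lambda>k. V' ^\<^sub>m (Suc r - k) *\<^sub>v (E *\<^sub>v w k)) {1..r}"
      by (rule vec_sum_cong) (simp_all add: pow[symmetric] Suc_diff_le del: pow_mat.simps(2))
    finally have VT: "V' *\<^sub>v T r = \<dots>" .
    have "{1..Suc r} = insert (Suc r) {1..r}" by auto
    then have "T (Suc r) = V' ^\<^sub>m (Suc r - Suc r) *\<^sub>v (E *\<^sub>v w (Suc r)) + V' *\<^sub>v T r"
      unfolding T_def[of "Suc r"] VT by (simp only:) (rule vec_sum_insert, simp_all)
    then show ?thesis by (simp add: one_mult_mat_vec[of _ p] comm_add_vec[of _ p])
  qed
  have moved: "V' ^\<^sub>m r *\<^sub>v er 0 = T r + er r" for r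
  proof (induction r)
    case 0
    have "T 0 = 0\<^sub>v p" by (simp add: T_def)
    then show ?case by (simp add: one_mult_mat_vec[of _ p])
  next
    case (Suc r)
    have "V' ^\<^sub>m Suc r *\<^sub>v er 0 = V' *\<^sub>v T r + V' *\<^sub>v er r"
      unfolding pow[OF erc] Suc by (rule mult_add_distrib_mat_vec[OF V']) simp_all
    then show ?case by (simp add: er_eq T_Suc assoc_add_vec[of _ p])
  qed
  have tail: "F *\<^sub>v (Gh *\<^sub>v u (Suc r)) =
      vec_sum q (\<lambda>j. V\<^sub>0 ^\<^sub>m j *\<^sub>v (F *\<^sub>v w (j + r))) {1..n} + V\<^sub>0 ^\<^sub>m n *\<^sub>v (F *\<^sub>v (Gh *\<^sub>v u (Suc (n + r))))" for n
  proof (induction n)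
    case 0 then show ?case by (simp add: one_mult_mat_vec[of _ q])
  next
    case (Suc n)
    let ?S = "vec_sum q (\<lambda>j. V\<^sub>0 ^\<^sub>m j *\<^sub>v (F *\<^sub>v w (j + r)))"
    have Sc: "?S J \<in> carrier_vec q" for J by (intro vec_sum_carrier) simp
    have "F *\<^sub>v (Gh *\<^sub>v u (Suc (n + r))) = V\<^sub>0 *\<^sub>v (F *\<^sub>v u (Suc (n + r)))"
      using assoc_mult_mat_vec[OF F Gh uc] assoc_mult_mat_vec[OF V0 F uc] by (simp only: F_eq)
    also have "\<dots> = V\<^sub>0 *\<^sub>v (F *\<^sub>v w (Suc (n + r)) + F *\<^sub>v (Gh *\<^sub>v u (Suc (Suc (n + r)))))"
      by (subst u) (simp add: mult_add_distrib_mat_vec[OF F])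
    finally have "V\<^sub>0 ^\<^sub>m n *\<^sub>v (F *\<^sub>v (Gh *\<^sub>v u (Suc (n + r)))) =
        V\<^sub>0 ^\<^sub>m Suc n *\<^sub>v (F *\<^sub>v w (Suc (n + r)) + F *\<^sub>v (Gh *\<^sub>v u (Suc (Suc (n + r)))))"
      by (simp add: assoc_mult_mat_vec[of _ q q _ q])
    also have "\<dots> = V\<^sub>0 ^\<^sub>m Suc n *\<^sub>v (F *\<^sub>v w (Suc (n + r))) + V\<^sub>0 ^\<^sub>m Suc n *\<^sub>v (F *\<^sub>v (Gh *\<^sub>v u (Suc (Suc (n + r)))))"
      by (rule mult_add_distrib_mat_vec[OF pow_carrier_mat[OF V0]]) simp_all
    finally have step: "V\<^sub>0 ^\<^sub>m n *\<^sub>v (F *\<^sub>v (Gh *\<^sub>v u (Suc (n + r)))) = \<dots>" .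
    have "{1..Suc n} = insert (Suc n) {1..n}" by auto
    then have "?S {1..Suc n} = V\<^sub>0 ^\<^sub>m Suc n *\<^sub>v (F *\<^sub>v w (Suc n + r)) + ?S {1..n}"
      by (simp only:) (rule vec_sum_insert, simp_all del: pow_mat.simps(2))
    also have "\<dots> = ?S {1..n} + V\<^sub>0 ^\<^sub>m Suc n *\<^sub>v (F *\<^sub>v w (Suc n + r))"
      by (rule comm_add_vec[of _ q]) (simp_all add: Sc del: pow_mat.simps(2))
    finally show ?case
      unfolding Suc step by (simp add: assoc_add_vec[of _ q] Sc del: pow_mat.simps(2))
  qed
  \<comment> \<open>The exponent \<open>\<nu> - 1\<close> suffices because \<open>F Gh\<close> contributes one more factor \<open>V\<^sub>0\<close>.\<close>
  have zero: "V\<^sub>0 ^\<^sub>m (\<nu> - 1) *\<^sub>v (F *\<^sub>v (Gh *\<^sub>v v)) = 0\<^sub>v q" if "v \<in> carrier_vec m" for v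
  proof -
    have "F *\<^sub>v (Gh *\<^sub>v v) = V\<^sub>0 *\<^sub>v (F *\<^sub>v v)"
      using assoc_mult_mat_vec[OF F Gh that] assoc_mult_mat_vec[OF V0 F that] by (simp only: F_eq)
    then have "V\<^sub>0 ^\<^sub>m (\<nu> - 1) *\<^sub>v (F *\<^sub>v (Gh *\<^sub>v v)) = V\<^sub>0 ^\<^sub>m Suc (\<nu> - 1) *\<^sub>v (F *\<^sub>v v)"
      using that by (simp add: assoc_mult_mat_vec[of _ q q _ q])
    also have "Suc (\<nu> - 1) = \<nu>" using \<nu> by simp
    also have "V\<^sub>0 ^\<^sub>m \<nu> *\<^sub>v (F *\<^sub>v v) = 0\<^sub>v q"
      unfolding nil using carrier_vecD[OF Ec(2)[OF that]] by (intro eq_vecI) (simp_all add: scalar_prod_def)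
    finally show ?thesis .
  qed
  have F_sum: "F *\<^sub>v (Gh *\<^sub>v u (Suc r)) = vec_sum q (\<lambda>j. V\<^sub>0 ^\<^sub>m j *\<^sub>v (F *\<^sub>v w (j + r))) {1..\<nu> - 1}"
    (is "_ = ?FS")
  proof -
    have "?FS \<in> carrier_vec q" by (intro vec_sum_carrier) simp
    then show ?thesis using tail[of "\<nu> - 1"] by (simp add: zero del: One_nat_def)
  qed
  have part1: "(L * V' ^\<^sub>m r) *\<^sub>v (- ((E * Gh) *\<^sub>v u 1)) = - (L *\<^sub>v T r + L *\<^sub>v er r)"
  proof -
    have "(E * Gh) *\<^sub>v u 1 = er 0" unfolding er_def by (simp add: assoc_mult_mat_vec[OF E Gh])
    moreover have "(L * V' ^\<^sub>m r) *\<^sub>v (- er 0) = - ((L * V' ^\<^sub>m r) *\<^sub>v er 0)"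
      by (rule mult_mat_vec_uminus[of _ m p]) (simp_all add: mult_carrier_mat[of _ m p _ p])
    moreover have "(L * V' ^\<^sub>m r) *\<^sub>v er 0 = L *\<^sub>v (V' ^\<^sub>m r *\<^sub>v er 0)"
      by (rule assoc_mult_mat_vec[of _ m p _ p]) simp_all
    ultimately show ?thesis by (simp add: moved mult_add_distrib_mat_vec[OF L])
  qed
  have part2: "vec_sum m (\<lambda>k. (G ^\<^sub>m (r - k) - L * V' ^\<^sub>m (r - k) * E) *\<^sub>v w k) {1..r} =
      vec_sum m (\<lambda>k. G ^\<^sub>m (r - k) *\<^sub>v w k) {1..r} - L *\<^sub>v T r" (is "_ = ?GS - _")
  proof -
    have t: "(G ^\<^sub>m n - L * V' ^\<^sub>m n * E) *\<^sub>v w k = G ^\<^sub>m n *\<^sub>v w k - L *\<^sub>v (V' ^\<^sub>m n *\<^sub>v (E *\<^sub>v w k))" for n k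
    proof -
      have "(L * V' ^\<^sub>m n * E) *\<^sub>v w k = L *\<^sub>v (V' ^\<^sub>m n *\<^sub>v (E *\<^sub>v w k))"
        by (simp add: assoc_mult_mat_vec[of _ m p _ m] assoc_mult_mat_vec[of _ m p _ p] mult_carrier_mat[of _ m p _ p]
          del: assoc_mult_mat)
      moreover have "L * V' ^\<^sub>m n * E \<in> carrier_mat m m"
        by (intro mult_carrier_mat[of _ m p]) simp_all
      ultimately show ?thesis by (simp add: minus_mult_distrib_mat_vec[of _ m m] del: assoc_mult_mat)
    qed
    have LT: "L *\<^sub>v T r = vec_sum m (\<lambda>k. L *\<^sub>v (V' ^\<^sub>m (r - k) *\<^sub>v (E *\<^sub>v w k))) {1..r}"
      unfolding T_def by (rule mult_mat_vec_sum) simp_all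
    show ?thesis unfolding t LT
    proof (rule eq_vecI)
      fix i assume "i < dim_vec (?GS - vec_sum m (\<lambda>k. L *\<^sub>v (V' ^\<^sub>m (r - k) *\<^sub>v (E *\<^sub>v w k))) {1..r})"
      moreover have LTc: "vec_sum m (\<lambda>k. L *\<^sub>v (V' ^\<^sub>m (r - k) *\<^sub>v (E *\<^sub>v w k))) {1..r} \<in> carrier_vec m"
        by (intro vec_sum_carrier) simp
      ultimately have i: "i < m" by simp
      show "vec_sum m (\<lambda>k. G ^\<^sub>m (r - k) *\<^sub>v w k - L *\<^sub>v (V' ^\<^sub>m (r - k) *\<^sub>v (E *\<^sub>v w k))) {1..r} $ i =
        (?GS - vec_sum m (\<lambda>k. L *\<^sub>v (V' ^\<^sub>m (r - k) *\<^sub>v (E *\<^sub>v w k))) {1..r}) $ i"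
        using i LTc by (simp add: vec_sum_index minus_carrier_vec[of _ m] sum_subtractf del: index_mult_mat_vec)
    next
      have c: "vec_sum m (\<lambda>k. G ^\<^sub>m (r - k) *\<^sub>v w k - L *\<^sub>v (V' ^\<^sub>m (r - k) *\<^sub>v (E *\<^sub>v w k))) {1..r} \<in> carrier_vec m"
        "?GS - vec_sum m (\<lambda>k. L *\<^sub>v (V' ^\<^sub>m (r - k) *\<^sub>v (E *\<^sub>v w k))) {1..r} \<in> carrier_vec m"
        by (intro vec_sum_carrier minus_carrier_vec; simp)+
      show "dim_vec (vec_sum m (\<lambda>k. G ^\<^sub>m (r - k) *\<^sub>v w k - L *\<^sub>v (V' ^\<^sub>m (r - k) *\<^sub>v (E *\<^sub>v w k))) {1..r}) =
        dim_vec (?GS - vec_sum m (\<lambda>k. L *\<^sub>v (V' ^\<^sub>m (r - k) *\<^sub>v (E *\<^sub>v w k))) {1..r})"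
        unfolding carrier_vecD[OF c(1)] carrier_vecD[OF c(2)] ..
    qed
  qed
  have part3: "vec_sum m (\<lambda>j. (K * V\<^sub>0 ^\<^sub>m j * F) *\<^sub>v w (j + r)) {1..\<nu> - 1} = K *\<^sub>v (F *\<^sub>v (Gh *\<^sub>v u (Suc r)))"
  proof -
    have t: "(K * V\<^sub>0 ^\<^sub>m j * F) *\<^sub>v w k = K *\<^sub>v (V\<^sub>0 ^\<^sub>m j *\<^sub>v (F *\<^sub>v w k))" for j k
      by (simp add: assoc_mult_mat_vec[of _ m q _ m] assoc_mult_mat_vec[of _ m q _ q] mult_carrier_mat[of _ m q _ q]
          del: assoc_mult_mat)
    show ?thesis unfolding t F_sum by (rule mult_mat_vec_sum[symmetric]) simp_all
  qed
  have part4: "Gh *\<^sub>v u (Suc r) = L *\<^sub>v er r + K *\<^sub>v (F *\<^sub>v (Gh *\<^sub>v u (Suc r)))"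
  proof -
    let ?v = "Gh *\<^sub>v u (Suc r)"
    have "?v = (L * E + K * F) *\<^sub>v ?v" unfolding LEKF by (simp add: one_mult_mat_vec[of _ m])
    also have "\<dots> = (L * E) *\<^sub>v ?v + (K * F) *\<^sub>v ?v"
      by (rule add_mult_distrib_mat_vec[of _ m m]) (simp_all add: mult_carrier_mat[of _ m p _ m] mult_carrier_mat[of _ m q _ m])
    also have "(L * E) *\<^sub>v ?v = L *\<^sub>v er r"
      unfolding er_def by (rule assoc_mult_mat_vec[OF L E]) simp
    also have "(K * F) *\<^sub>v ?v = K *\<^sub>v (F *\<^sub>v ?v)"
      by (rule assoc_mult_mat_vec[OF K F]) simp
    finally show ?thesis .
  qed
  have GSc: "vec_sum m (\<lambda>k. G ^\<^sub>m (r - k) *\<^sub>v w k) {1..r} \<in> carrier_vec m" by (intro vec_sum_carrier) simp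
  have c3: "K *\<^sub>v (F *\<^sub>v (Gh *\<^sub>v u (Suc r))) \<in> carrier_vec m" by simp
  have c4: "L *\<^sub>v er r \<in> carrier_vec m" "L *\<^sub>v T r \<in> carrier_vec m" by simp_all
  have rearrange: "- (a + b) + (- (s - a) - c) = - s - (b + c)"
    if "a \<in> carrier_vec m" "b \<in> carrier_vec m" "c \<in> carrier_vec m" "s \<in> carrier_vec m"
    for a b c s :: "complex vec"
    using that by (intro eq_vecI) auto
  show ?thesis
    unfolding part1 part2 part3
    by (subst (2) part4) (rule rearrange[OF c4(2) c4(1) c3 GSc])
qed

section \<open>From the transition probabilities to the blocks\<close>

lemma has_sum_finite_support:
  fixes f :: "'a \<Rightarrow> real"
  assumes "(f has_sum x) S" "finite F" "F \<subseteq> S" "\<And>s. s \<in> S - F \<Longrightarrow> f s = 0"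
  shows "sum f F = x"
proof -
  have "(f has_sum x) F"
    using assms has_sum_cong_neutral[of F S f f x] by auto
  moreover have "(f has_sum sum f F) F" using assms(2) by simp
  ultimately show ?thesis using has_sum_unique by blast
qed

text \<open>Every row and every column of the transition matrix meets only neighbouring levels, so the infinite
  sums are finite ones. The states of positive stationary probability form a closed set, hence all
  states.\<close>

lemma stationary_qbd_from_chain:
  fixes B Am A0 A1 :: "real mat" and \<pi> :: "nat \<Rightarrow> real vec"
  assumes m: "m \<ge> 1"
    and blocks: "0\<^sub>m m m \<le> B" "0\<^sub>m m m \<le> Am" "0\<^sub>m m m \<le> A0" "0\<^sub>m m m \<le> A1"
    and stochastic: "stochastic_on (UNIV \<times> {..<m}) (qbd_trans B Am A0 A1)"
    and irreducible: "irreducible_on (UNIV \<times> {..<m}) (qbd_trans B Am A0 A1)"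
    and irreducible_A: "irreducible_on {..<m} (\<lambda>a b. (Am + A0 + A1) $$ (a, b))"
    and final: "single_final_class m Am A0 A1 Es"
    and \<pi>: "\<And>i. \<pi> i \<in> carrier_vec m"
      "stationary_distribution (UNIV \<times> {..<m}) (qbd_trans B Am A0 A1) (\<lambda>(i, a). \<pi> i $ a)"
  shows "stationary_qbd m Am A0 A1 B (\<lambda>i. mat 1 m (\<lambda>(_, a). \<pi> i $ a))"
proof -
  let ?S = "(UNIV :: nat set) \<times> {..<m}"
  let ?p = "qbd_trans B Am A0 A1"
  let ?\<mu> = "\<lambda>(i, a). \<pi> i $ a"
  have Bc: "B \<in> carrier_mat m m" and Amc: "Am \<in> carrier_mat m m" and A0c: "A0 \<in> carrier_mat m m" and A1c: "A1 \<in> carrier_mat m m"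
    using blocks by (simp_all only: mat_nonneg_iff)
  have rows: "(\<Sum>s\<in>F. ?p (i, a) s) = 1"
    if "a < m" "finite F" "F \<subseteq> ?S" "\<And>s. s \<in> ?S - F \<Longrightarrow> ?p (i, a) s = 0" for i a F
  proof (rule has_sum_finite_support)
    show "(?p (i, a) has_sum 1) ?S" using stochastic that(1) by (auto simp: stochastic_on_def)
  qed (use that in auto)
  have sum_pairs: "(\<Sum>s\<in>I \<times> J. f s) = (\<Sum>i\<in>I. \<Sum>a\<in>J. f (i, a))"
    for I J :: "nat set" and f :: "nat \<times> nat \<Rightarrow> real"
    by (simp add: sum.cartesian_product split_def)
  have interior: "(\<Sum>b<m. A1 $$ (a, b) + A0 $$ (a, b) + Am $$ (a, b)) = 1" if a: "a < m" for a
  proof -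
    have "(\<Sum>s\<in>{0, 1, 2} \<times> {..<m}. ?p (1, a) s) = 1"
      by (rule rows[OF a]) (auto simp: qbd_trans_def numeral_2_eq_2 split: if_splits)
    moreover have "(\<Sum>s\<in>{0, 1, 2} \<times> {..<m}. ?p (1, a) s) = (\<Sum>i\<in>{0, 1, 2}. \<Sum>b<m. ?p (1, a) (i, b))"
      by (rule sum_pairs)
    ultimately show ?thesis by (simp add: qbd_trans_def sum.distrib add_ac)
  qed
  have boundary: "(\<Sum>b<m. A1 $$ (a, b) + B $$ (a, b)) = 1" if a: "a < m" for a
  proof -
    have "(\<Sum>s\<in>{0, 1} \<times> {..<m}. ?p (0, a) s) = 1"
      by (rule rows[OF a]) (auto simp: qbd_trans_def numeral_2_eq_2 split: if_splits)
    moreover have "(\<Sum>s\<in>{0, 1} \<times> {..<m}. ?p (0, a) s) = (\<Sum>i\<in>{0, 1}. \<Sum>b<m. ?p (0, a) (i, b))"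
      by (rule sum_pairs)
    ultimately show ?thesis by (simp add: qbd_trans_def sum.distrib add_ac)
  qed
  have \<mu>_nonneg: "0 \<le> \<pi> i $ a" if "a < m" for i a
    using \<pi>(2) that by (auto simp: stationary_distribution_def)
  have \<mu>_sum: "(?\<mu> has_sum 1) ?S"
    using \<pi>(2) by (auto simp: stationary_distribution_def)
  have balance: "((\<lambda>s. ?\<mu> s * ?p s t) has_sum ?\<mu> t) ?S" if "t \<in> ?S" for t
    using \<pi>(2) that by (auto simp: stationary_distribution_def)
  have column: "(\<Sum>s\<in>F. ?\<mu> s * ?p s (j, b)) = \<pi> j $ b"
    if "b < m" "finite F" "F \<subseteq> ?S" "\<And>s. s \<in> ?S - F \<Longrightarrow> ?p s (j, b) = 0" for j b F
    using has_sum_finite_support[OF balance[of "(j, b)"], of F] that by auto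
  have p_nonneg: "0 \<le> ?p s t" if "s \<in> ?S" "t \<in> ?S" for s t
    using stochastic that by (auto simp: stochastic_on_def)
  have closed: "state_closed ?S ?p {s \<in> ?S. 0 < ?\<mu> s}"
    unfolding state_closed_def
  proof (intro ballI impI)
    fix s t assume s: "s \<in> {s \<in> ?S. 0 < ?\<mu> s}" and t: "t \<in> ?S" and pos: "0 < ?p s t"
    have "sum (\<lambda>s. ?\<mu> s * ?p s t) {s} \<le> ?\<mu> t"
      by (rule finite_sum_le_has_sum[OF balance[OF t]])
        (use s t p_nonneg \<mu>_nonneg in \<open>auto intro!: mult_nonneg_nonneg\<close>)
    moreover have "0 < ?\<mu> s * ?p s t" using s pos by simp
    ultimately show "t \<in> {s \<in> ?S. 0 < ?\<mu> s}" using t by simp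
  qed
  have "\<exists>s\<in>?S. 0 < ?\<mu> s"
  proof (rule ccontr)
    assume none: "\<not> (\<exists>s\<in>?S. 0 < ?\<mu> s)"
    have "?\<mu> s = 0" if sS: "s \<in> ?S" for s
    proof -
      obtain i a where s: "s = (i, a)" "a < m" using sS by auto
      have "\<not> 0 < \<pi> i $ a" using none s by auto
      then show ?thesis using \<mu>_nonneg[OF s(2), of i] s(1) by simp
    qed
    then have "(?\<mu> has_sum 0) ?S" by (rule has_sum_0)
    then show False using \<mu>_sum has_sum_unique by fastforce
  qed
  then obtain s0 where s0: "s0 \<in> ?S" "0 < ?\<mu> s0" by blast
  have pos: "0 < \<pi> i $ a" if "a < m" for i a
    using irreducible_closed[OF irreducible closed, of s0 "(i, a)"] s0 that by auto
  have summable: "summable (\<lambda>i. \<pi> i $ a)" if a: "a < m" for a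
  proof -
    have "?\<mu> summable_on ?S" using \<mu>_sum by (rule has_sum_imp_summable)
    then have "?\<mu> summable_on ((\<lambda>i. (i, a)) ` UNIV)"
      by (rule summable_on_subset_banach) (use a in auto)
    then have "(?\<mu> \<circ> (\<lambda>i. (i, a))) summable_on UNIV"
      by (subst (asm) summable_on_reindex) (auto simp: inj_on_def)
    then have "(\<lambda>i. \<pi> i $ a) summable_on UNIV" by (simp add: o_def)
    then show ?thesis by (rule summable_on_imp_summable)
  qed
  define \<Pi>r where "\<Pi>r i = mat 1 m (\<lambda>(_ :: nat, a). \<pi> i $ a)" for i
  have \<Pi>c: "\<Pi>r i \<in> carrier_mat 1 m" for i by (simp add: \<Pi>r_def)
  have \<Pi>d: "dim_row (\<Pi>r i) = 1" "dim_col (\<Pi>r i) = m" for i by (simp_all add: \<Pi>r_def)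
  have \<Pi>e: "\<Pi>r i $$ (0, a) = \<pi> i $ a" if "a < m" for i a using that by (simp add: \<Pi>r_def)
  have \<Pi>m: "(\<Pi>r i * X) $$ (0, b) = (\<Sum>a<m. \<pi> i $ a * X $$ (a, b))" if "X \<in> carrier_mat m m" "b < m" for i X b
    by (subst index_mult_mat_sum[OF \<Pi>c that(1) _ that(2)]) (auto simp: \<Pi>e)
  show ?thesis
    unfolding \<Pi>r_def[symmetric]
  proof
    show "0\<^sub>m m m \<le> Am" "0\<^sub>m m m \<le> A0" "0\<^sub>m m m \<le> A1" "0\<^sub>m m m \<le> B" by (fact blocks)+
    show "\<And>a. a < m \<Longrightarrow> (\<Sum>b<m. A1 $$ (a, b) + A0 $$ (a, b) + Am $$ (a, b)) = 1" by (rule interior)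
    show "irreducible_on (UNIV \<times> {..<m}) (doubly_infinite_qbd_trans Am A0 A1)"
      by (rule two_sided_walk_irreducible[OF blocks(2-4) irreducible_A final])
    show "0 < m" using m by simp
    show "\<And>a. a < m \<Longrightarrow> (\<Sum>b<m. A1 $$ (a, b) + B $$ (a, b)) = 1" by (rule boundary)
    show "irreducible_on ?S ?p" by (rule irreducible)
    show "\<And>i. \<Pi>r i \<in> carrier_mat 1 m" by (rule \<Pi>c)
    show "\<And>i a. a < m \<Longrightarrow> 0 < \<Pi>r i $$ (0, a)" using pos by (simp add: \<Pi>e)
    show "\<And>a. a < m \<Longrightarrow> summable (\<lambda>i. \<Pi>r i $$ (0, a))" using summable by (simp add: \<Pi>e)
    show "\<Pi>r 0 = \<Pi>r 0 * B + \<Pi>r 1 * Am"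
    proof (rule eq_matI)
      fix i b assume "i < dim_row (\<Pi>r 0 * B + \<Pi>r 1 * Am)" "b < dim_col (\<Pi>r 0 * B + \<Pi>r 1 * Am)"
      then have i: "i = 0" and b: "b < m" using \<Pi>c[of 1] Amc by auto
      have "(\<Sum>s\<in>{0, 1} \<times> {..<m}. ?\<mu> s * ?p s (0, b)) = \<pi> 0 $ b"
        by (rule column[OF b]) (auto simp: qbd_trans_def numeral_2_eq_2 split: if_splits)
      moreover have "(\<Sum>s\<in>{0, 1} \<times> {..<m}. ?\<mu> s * ?p s (0, b)) = (\<Sum>i\<in>{0, 1}. \<Sum>a<m. ?\<mu> (i, a) * ?p (i, a) (0, b))"
        by (rule sum_pairs)
      ultimately have "\<pi> 0 $ b = (\<Sum>a<m. \<pi> 0 $ a * B $$ (a, b)) + (\<Sum>a<m. \<pi> 1 $ a * Am $$ (a, b))"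
        by (simp add: qbd_trans_def)
      then have "\<Pi>r 0 $$ (0, b) = (\<Pi>r 0 * B) $$ (0, b) + (\<Pi>r 1 * Am) $$ (0, b)"
        unfolding \<Pi>m[OF Bc b] \<Pi>m[OF Amc b] \<Pi>e[OF b] .
      then show "\<Pi>r 0 $$ (i, b) = (\<Pi>r 0 * B + \<Pi>r 1 * Am) $$ (i, b)"
        unfolding i using b \<Pi>d Amc by (simp del: index_mult_mat(1))
    qed (use \<Pi>c[of 0] \<Pi>c[of 1] Amc in auto)
    fix n
    show "\<Pi>r (Suc n) = \<Pi>r n * A1 + \<Pi>r (Suc n) * A0 + \<Pi>r (Suc (Suc n)) * Am"
    proof (rule eq_matI)
      fix i b assume "i < dim_row (\<Pi>r n * A1 + \<Pi>r (Suc n) * A0 + \<Pi>r (Suc (Suc n)) * Am)"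
        "b < dim_col (\<Pi>r n * A1 + \<Pi>r (Suc n) * A0 + \<Pi>r (Suc (Suc n)) * Am)"
      then have i: "i = 0" and b: "b < m" using \<Pi>c[of "Suc (Suc n)"] Amc by auto
      have "(\<Sum>s\<in>{n, Suc n, Suc (Suc n)} \<times> {..<m}. ?\<mu> s * ?p s (Suc n, b)) = \<pi> (Suc n) $ b"
        by (rule column[OF b]) (auto simp: qbd_trans_def numeral_2_eq_2 split: if_splits)
      moreover have "(\<Sum>s\<in>{n, Suc n, Suc (Suc n)} \<times> {..<m}. ?\<mu> s * ?p s (Suc n, b)) =
          (\<Sum>i\<in>{n, Suc n, Suc (Suc n)}. \<Sum>a<m. ?\<mu> (i, a) * ?p (i, a) (Suc n, b))"
        by (rule sum_pairs)
      ultimately have "\<pi> (Suc n) $ b = (\<Sum>a<m. \<pi> n $ a * A1 $$ (a, b)) + (\<Sum>a<m. \<pi> (Suc n) $ a * A0 $$ (a, b))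
          + (\<Sum>a<m. \<pi> (Suc (Suc n)) $ a * Am $$ (a, b))"
        by (simp add: qbd_trans_def)
      then have "\<Pi>r (Suc n) $$ (0, b) = (\<Pi>r n * A1) $$ (0, b) + (\<Pi>r (Suc n) * A0) $$ (0, b) + (\<Pi>r (Suc (Suc n)) * Am) $$ (0, b)"
        unfolding \<Pi>m[OF A1c b] \<Pi>m[OF A0c b] \<Pi>m[OF Amc b] \<Pi>e[OF b] .
      then show "\<Pi>r (Suc n) $$ (i, b) = (\<Pi>r n * A1 + \<Pi>r (Suc n) * A0 + \<Pi>r (Suc (Suc n)) * Am) $$ (i, b)"
        unfolding i using b \<Pi>d Amc A0c by (simp del: index_mult_mat(1))
    qed (use \<Pi>c[of "Suc n"] \<Pi>c[of "Suc (Suc n)"] Amc in auto)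
  qed
qed

context stationary_qbd
begin

text \<open>The row \<open>\<pi>\<^sub>0\<close> does not increase under \<open>B + A1 G\<close>, by \<open>\<pi>\<^sub>0 R \<le> \<pi>\<^sub>1\<close> and the balance equation of
  level 0, and row sums 1 leave no slack.\<close>

lemma \<pi>_invariant:
  assumes G: "solves_G G" and minG: "\<And>Y. solves_G Y \<Longrightarrow> G \<le> Y"
    and R: "solves_R R" and minR: "\<And>Y. solves_R Y \<Longrightarrow> R \<le> Y" and GR: "A1 * G = R * Am"
  shows "\<pi> 0 * (B + A1 * G) = \<pi> 0" and "\<And>a. a < m \<Longrightarrow> (\<Sum>b<m. (B + A1 * G) $$ (a, b)) = 1"
proof -
  have Gn: "0\<^sub>m m m \<le> G" and Rn: "0\<^sub>m m m \<le> R" using G R unfolding solves_G_def solves_R_def by blast+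
  then have Gc [simp]: "G \<in> carrier_mat m m" and Rc [simp]: "R \<in> carrier_mat m m" by (simp_all only: mat_nonneg_iff)
  define P where "P = B + A1 * G"
  have Pc [simp]: "P \<in> carrier_mat m m" by (simp add: P_def)
  have AG: "(A1 * G) $$ (a, b) = (\<Sum>c<m. A1 $$ (a, c) * G $$ (c, b))" if "a < m" "b < m" for a b
    by (rule index_mult_mat_sum[OF carriers(3) Gc that])
  show rows: "(\<Sum>b<m. (B + A1 * G) $$ (a, b)) = 1" if a: "a < m" for a
  proof -
    have "(\<Sum>b<m. (B + A1 * G) $$ (a, b)) = (\<Sum>b<m. B $$ (a, b)) + (\<Sum>b<m. \<Sum>c<m. A1 $$ (a, c) * G $$ (c, b))"
      unfolding sum.distrib[symmetric] using a AG by (intro sum.cong refl) (simp del: index_mult_mat(1))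
    also have "(\<Sum>b<m. \<Sum>c<m. A1 $$ (a, c) * G $$ (c, b)) = (\<Sum>c<m. A1 $$ (a, c) * (\<Sum>b<m. G $$ (c, b)))"
      by (subst sum.swap) (simp add: sum_distrib_left)
    also have "\<dots> = (\<Sum>c<m. A1 $$ (a, c))" by (intro sum.cong) (auto simp: G_row_sums[OF G minG])
    finally show ?thesis using boundary_row_sums[OF a] by (simp add: sum.distrib)
  qed
  have le: "\<pi> 0 * P \<le> \<pi> 0"
  proof -
    have "\<pi> 0 * P = \<pi> 0 * B + \<pi> 0 * R * Am"
      unfolding P_def GR by (simp add: mult_add_distrib_mat[of _ 1 m _ m] del: One_nat_def)
    also have "\<dots> \<le> \<pi> 0 * B + \<pi> 1 * Am"
    proof (rule mat_add_mono[of _ _ _ _ 1 m])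
      have "\<pi> 0 * R \<le> \<pi> 1" using \<pi>_mult_R_le[OF R minR, of 0] by simp
      then show "\<pi> 0 * R * Am \<le> \<pi> 1 * Am"
        by (intro mat_mult_mono[OF mat_mult_nonneg[OF \<pi>_nonneg Rn] _ nonneg(1)]) simp_all
    qed (simp_all del: One_nat_def)
    also have "\<dots> = \<pi> 0" by (rule \<pi>_boundary[symmetric])
    finally show ?thesis .
  qed
  have PP: "(\<pi> 0 * P) $$ (0, b) = (\<Sum>a<m. \<pi> 0 $$ (0, a) * P $$ (a, b))" if "b < m" for b
    by (rule index_mult_mat_sum[OF \<pi>_carrier Pc _ that]) simp
  define \<delta> where "\<delta> b = \<pi> 0 $$ (0, b) - (\<Sum>a<m. \<pi> 0 $$ (0, a) * P $$ (a, b))" for b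
  have "(\<Sum>b<m. \<Sum>a<m. \<pi> 0 $$ (0, a) * P $$ (a, b)) = (\<Sum>a<m. \<pi> 0 $$ (0, a) * (\<Sum>b<m. P $$ (a, b)))"
    by (subst sum.swap) (simp add: sum_distrib_left)
  also have "\<dots> = (\<Sum>a<m. \<pi> 0 $$ (0, a))"
    by (intro sum.cong refl) (simp add: rows[folded P_def])
  finally have "(\<Sum>b<m. \<delta> b) = 0" by (simp add: \<delta>_def sum_subtractf)
  moreover have "0 \<le> \<delta> b" if "b < m" for b
  proof -
    have entries: "\<forall>i<1. \<forall>b<m. (\<pi> 0 * P) $$ (i, b) \<le> \<pi> 0 $$ (i, b)"
      using le unfolding mat_le_iff[OF mult_carrier_mat[OF \<pi>_carrier Pc] \<pi>_carrier] .
    have "(\<pi> 0 * P) $$ (0, b) \<le> \<pi> 0 $$ (0, b)"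
      by (rule entries[rule_format, OF _ that]) simp
    then show ?thesis unfolding \<delta>_def PP[OF that] by linarith
  qed
  ultimately have \<delta>0: "\<delta> b = 0" if "b < m" for b
    using that sum_nonneg_eq_0_iff[of "{..<m}" \<delta>] by auto
  have "(\<pi> 0 * P) $$ (0, b) = \<pi> 0 $$ (0, b)" if "b < m" for b
    unfolding PP[OF that] using \<delta>0[OF that] unfolding \<delta>_def by linarith
  moreover have "\<pi> 0 * P \<in> carrier_mat 1 m" by (rule mult_carrier_mat[OF \<pi>_carrier Pc])
  ultimately show "\<pi> 0 * (B + A1 * G) = \<pi> 0"
    unfolding P_def[symmetric]
    using carrier_matD[OF \<pi>_carrier[of 0]] carrier_matD[OF Pc]
    by (intro eq_matI) (simp_all del: index_mult_mat(1))
qed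

end

section \<open>The group inverse and the block coordinates\<close>

context stationary_qbd
begin

lemma fixed_vector_constant_complex:
  assumes G: "solves_G G" and minG: "\<And>Y. solves_G Y \<Longrightarrow> G \<le> Y"
    and v: "v \<in> carrier_vec m" "cmat (B + A1 * G) *\<^sub>v v = v"
  shows "\<exists>c. v = c \<cdot>\<^sub>v ones_vec m"
proof -
  have "0\<^sub>m m m \<le> G" using G unfolding solves_G_def by blast
  then have Gc [simp]: "G \<in> carrier_mat m m" by (simp only: mat_nonneg_iff)
  define P where "P = B + A1 * G"
  have Pc: "P \<in> carrier_mat m m" by (simp add: P_def)
  have cPc: "cmat P \<in> carrier_mat m m" using Pc by simp
  have eq: "v $ i = (\<Sum>a<m. of_real (P $$ (i, a)) * v $ a)" if i: "i < m" for i
  proof -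
    have "v $ i = (cmat P *\<^sub>v v) $ i" using v(2) by (simp only: P_def)
    also have "\<dots> = (\<Sum>a<m. cmat P $$ (i, a) * v $ a)" by (rule index_mult_mat_vec_sum[OF cPc v(1) i])
    also have "\<dots> = (\<Sum>a<m. of_real (P $$ (i, a)) * v $ a)" using Pc i by (intro sum.cong) auto
    finally show ?thesis .
  qed
  have part: "t (v $ a) = t (v $ b)" if ab: "a < m" "b < m"
    and t: "\<And>(f :: nat \<Rightarrow> complex) A. t (sum f A) = (\<Sum>x\<in>A. t (f x))" "\<And>r z. t (of_real r * z) = r * t z"
    for a b and t :: "complex \<Rightarrow> real"
  proof -
    let ?w = "vec m (\<lambda>a. t (v $ a))"
    have wc: "?w \<in> carrier_vec m" by simp
    have Pw: "P *\<^sub>v ?w = ?w"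
    proof (rule eq_vecI)
      fix i assume "i < dim_vec ?w"
      then have i: "i < m" by simp
      have "(P *\<^sub>v ?w) $ i = (\<Sum>a<m. P $$ (i, a) * ?w $ a)" by (rule index_mult_mat_vec_sum[OF Pc wc i])
      also have "\<dots> = t (v $ i)" by (subst eq[OF i]) (simp add: t)
      finally show "(P *\<^sub>v ?w) $ i = ?w $ i" using i by simp
    qed (use Pc in simp)
    have "?w $ a = ?w $ b"
      by (rule fixed_vector_constant[OF G minG wc Pw[unfolded P_def] ab])
    then show ?thesis using ab by simp
  qed
  define c where "c = v $ 0"
  have "v $ a = c" if a: "a < m" for a
    unfolding c_def
    using part[OF a m_pos, of Re] part[OF a m_pos, of Im] by (simp add: complex_eq_iff)
  then have "v = c \<cdot>\<^sub>v ones_vec m"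
    using v(1) by (intro eq_vecI) (auto simp: ones_vec_def)
  then show ?thesis by blast
qed

text \<open>The constants span the kernel of \<open>H\<close>, and the normalized \<open>\<pi>\<^sub>0\<close> is a left null row that does not
  annihilate them, so the kernel is complemented by the range.\<close>

lemma group_inverse_boundary:
  assumes G: "solves_G G" and minG: "\<And>Y. solves_G Y \<Longrightarrow> G \<le> Y"
    and R: "solves_R R" and minR: "\<And>Y. solves_R Y \<Longrightarrow> R \<le> Y" and GR: "A1 * G = R * Am"
  defines "H \<equiv> 1\<^sub>m m - cmat (B + A1 * G)"
  shows "is_group_inverse H (group_inverse H)"
proof -
  have "0\<^sub>m m m \<le> G" using G unfolding solves_G_def by blast
  then have Gc [simp]: "G \<in> carrier_mat m m" by (simp only: mat_nonneg_iff)
  define P where "P = B + A1 * G"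
  have Pc: "P \<in> carrier_mat m m" by (simp add: P_def)
  have Hc: "H \<in> carrier_mat m m" unfolding H_def by (intro minus_carrier_mat) simp
  have H_nth: "H $$ (a, b) = (if a = b then 1 else 0) - of_real (P $$ (a, b))" if "a < m" "b < m" for a b
    using that Pc by (simp add: H_def flip: P_def)
  define s where "s = (\<Sum>a<m. \<pi> 0 $$ (0, a))"
  have s0: "0 < s" unfolding s_def using m_pos by (intro sum_pos \<pi>_pos) auto
  define e :: "complex mat" where "e = mat m 1 (\<lambda>_. 1)"
  define p where "p = mat 1 m (\<lambda>(_, a). complex_of_real (\<pi> 0 $$ (0, a) / s))"
  have ec: "e \<in> carrier_mat m 1" and pc: "p \<in> carrier_mat 1 m" by (simp_all add: e_def p_def)
  show ?thesis
  proof (rule group_inverse_simple_kernel[OF Hc ec pc])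
    show "H * e = 0\<^sub>m m 1"
    proof (rule eq_matI)
      fix a b assume "a < dim_row (0\<^sub>m m 1 :: complex mat)" "b < dim_col (0\<^sub>m m 1 :: complex mat)"
      then have a: "a < m" and b: "b < 1" by auto
      have "(H * e) $$ (a, b) = (\<Sum>c<m. H $$ (a, c) * e $$ (c, b))" by (rule index_mult_mat_sum[OF Hc ec a b])
      also have "\<dots> = (\<Sum>c<m. (if a = c then 1 else 0) - of_real (P $$ (a, c)))"
        using a b by (intro sum.cong) (auto simp: H_nth e_def)
      also have "\<dots> = 1 - of_real (\<Sum>c<m. P $$ (a, c))" using a by (simp add: sum_subtractf)
      also have "\<dots> = 0" using \<pi>_invariant(2)[OF G minG R minR GR a] by (simp add: P_def)
      finally show "(H * e) $$ (a, b) = 0\<^sub>m m 1 $$ (a, b)" using a b by simp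
    qed (use Hc ec in auto)
    show "p * H = 0\<^sub>m 1 m"
    proof (rule eq_matI)
      fix a b assume "a < dim_row (0\<^sub>m 1 m :: complex mat)" "b < dim_col (0\<^sub>m 1 m :: complex mat)"
      then have a: "a = 0" and b: "b < m" by auto
      have "(\<Sum>c<m. \<pi> 0 $$ (0, c) * P $$ (c, b)) = (\<pi> 0 * P) $$ (0, b)"
        by (rule index_mult_mat_sum[OF \<pi>_carrier Pc _ b, symmetric]) simp
      then have inv: "(\<Sum>c<m. \<pi> 0 $$ (0, c) * P $$ (c, b)) = \<pi> 0 $$ (0, b)"
        using \<pi>_invariant(1)[OF G minG R minR GR] by (simp only: P_def)
      have "(p * H) $$ (a, b) = (\<Sum>c<m. p $$ (0, c) * H $$ (c, b))"
        unfolding a by (rule index_mult_mat_sum[OF pc Hc _ b]) simp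
      also have "\<dots> = (\<Sum>c<m. (if c = b then of_real (\<pi> 0 $$ (0, c) / s) else 0)
          - of_real (\<pi> 0 $$ (0, c) * P $$ (c, b) / s))"
        using b by (intro sum.cong) (auto simp: H_nth p_def algebra_simps)
      also have "\<dots> = of_real (\<pi> 0 $$ (0, b) / s) - of_real ((\<Sum>c<m. \<pi> 0 $$ (0, c) * P $$ (c, b)) / s)"
        using b by (simp add: sum_subtractf sum_divide_distrib)
      also have "\<dots> = 0" unfolding inv by simp
      finally show "(p * H) $$ (a, b) = 0\<^sub>m 1 m $$ (a, b)" using a b by simp
    qed (use Hc pc in auto)
    show "p * e = 1\<^sub>m 1"
    proof (rule eq_matI)
      fix a b assume "a < dim_row (1\<^sub>m 1 :: complex mat)" "b < dim_col (1\<^sub>m 1 :: complex mat)"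
      then have ab: "a = 0" "b = 0" by auto
      have "(p * e) $$ (0, 0) = (\<Sum>c<m. p $$ (0, c) * e $$ (c, 0))"
        by (rule index_mult_mat_sum[OF pc ec]) simp_all
      also have "\<dots> = of_real ((\<Sum>c<m. \<pi> 0 $$ (0, c)) / s)"
        by (simp add: p_def e_def sum_divide_distrib)
      also have "\<dots> = 1" using s0 by (simp add: s_def)
      finally show "(p * e) $$ (a, b) = 1\<^sub>m 1 $$ (a, b)" using ab by simp
    qed (use ec pc in auto)
    fix v assume v: "v \<in> carrier_vec m" "H *\<^sub>v v = 0\<^sub>v m"
    have cP: "cmat P \<in> carrier_mat m m" using Pc by simp
    have Hv: "H *\<^sub>v v = v - cmat P *\<^sub>v v"
      unfolding H_def P_def[symmetric] using v(1) cP by (simp add: minus_mult_distrib_mat_vec[of _ m m] one_mult_mat_vec[of _ m])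
    have "cmat P *\<^sub>v v = v"
    proof (rule eq_vecI)
      fix i assume "i < dim_vec v"
      then have i: "i < m" using v by simp
      have "(v - cmat P *\<^sub>v v) $ i = 0" unfolding Hv[symmetric] v(2) using i by simp
      then show "(cmat P *\<^sub>v v) $ i = v $ i" using i v(1) Pc by (simp del: index_mult_mat_vec)
    qed (use v Pc in simp)
    then obtain c where "v = c \<cdot>\<^sub>v ones_vec m"
      using fixed_vector_constant_complex[OF G minG v(1)] by (auto simp: P_def)
    moreover have "col e 0 = ones_vec m" by (intro eq_vecI) (auto simp: e_def ones_vec_def)
    ultimately show "\<exists>c. v = c \<cdot>\<^sub>v col e 0" by auto
  qed
qed

end

lemma sum_lessThan_add:
  fixes f :: "nat \<Rightarrow> 'a :: comm_monoid_add"
  shows "(\<Sum>a<p + q. f a) = (\<Sum>a<p. f a) + (\<Sum>b<q. f (p + b))"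
  by (induction q) (simp_all add: add.assoc)

text \<open>\<open>A M = M J\<close> means \<open>M\<^sup>-\<^sup>1 A = J M\<^sup>-\<^sup>1\<close>, which is read in blocks of rows.\<close>

lemma block_coordinates:
  fixes A M :: "'a :: field mat"
  assumes V1: "V\<^sub>1 \<in> carrier_mat p p" and V0: "V\<^sub>0 \<in> carrier_mat q q"
    and M: "M \<in> carrier_mat (p + q) (p + q)" "invertible_mat M" and A: "A \<in> carrier_mat (p + q) (p + q)"
    and AM: "A * M = M * diag_block_mat [V\<^sub>1, V\<^sub>0]"
    and LK: "L \<in> carrier_mat (p + q) p" "K \<in> carrier_mat (p + q) q" "M = append_cols L K"
    and EF: "E \<in> carrier_mat p (p + q)" "F \<in> carrier_mat q (p + q)" "mat_inv M = E @\<^sub>r F"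
  shows "V\<^sub>1 * E = E * A" "V\<^sub>0 * F = F * A" "L * E + K * F = 1\<^sub>m (p + q)"
proof -
  let ?m = "p + q"
  define J where "J = diag_block_mat [V\<^sub>1, V\<^sub>0]"
  have J_eq: "J = four_block_mat V\<^sub>1 (0\<^sub>m p q) (0\<^sub>m q p) V\<^sub>0"
    using V1 V0 diag_block_mat_singleton[of V\<^sub>0] by (simp add: J_def Let_def del: diag_block_mat_singleton)
  define I where "I = mat_inv M"
  have Ic: "I \<in> carrier_mat ?m ?m" and MI: "M * I = 1\<^sub>m ?m" and IM: "I * M = 1\<^sub>m ?m"
    using invertible_mat_inv[OF M] by (simp_all add: I_def)
  have J_nth: "J $$ (i, j) = (if i < p then if j < p then V\<^sub>1 $$ (i, j) else 0
      else if j < p then 0 else V\<^sub>0 $$ (i - p, j - p))" if "i < ?m" "j < ?m" for i j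
    unfolding J_eq using that V1 V0 by (simp add: index_mat_four_block)
  have Jc: "J \<in> carrier_mat ?m ?m" unfolding J_eq using V1 V0 by simp
  have I_nth: "I $$ (i, j) = (if i < p then E $$ (i, j) else F $$ (i - p, j))" if "i < ?m" "j < ?m" for i j
    using that EF by (auto simp: I_def append_rows_def)
  have M_nth: "M $$ (i, j) = (if j < p then L $$ (i, j) else K $$ (i, j - p))" if "i < ?m" "j < ?m" for i j
    using that LK by (auto simp: append_cols_def)
  have "I * A = I * (A * (M * I))" using A by (simp add: MI)
  also have "\<dots> = I * ((A * M) * I)" using A M(1) Ic by (simp add: assoc_mult_mat[of _ ?m ?m _ ?m _ ?m])
  also have "\<dots> = (I * M) * (J * I)"
    unfolding AM J_def[symmetric] using M(1) Ic Jc by (simp add: assoc_mult_mat[of _ ?m ?m _ ?m _ ?m])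
  also have "\<dots> = J * I" unfolding IM using Jc Ic by (simp add: left_mult_one_mat[of _ ?m ?m])
  finally have IA: "I * A = J * I" .
  have entry: "(\<Sum>a<?m. I $$ (i, a) * A $$ (a, j)) =
      (\<Sum>a<p. J $$ (i, a) * E $$ (a, j)) + (\<Sum>b<q. J $$ (i, p + b) * F $$ (b, j))" if ij: "i < ?m" "j < ?m" for i j
  proof -
    have "(\<Sum>a<?m. I $$ (i, a) * A $$ (a, j)) = (J * I) $$ (i, j)"
      unfolding IA[symmetric] by (rule index_mult_mat_sum[OF Ic A ij, symmetric])
    also have "\<dots> = (\<Sum>a<?m. J $$ (i, a) * I $$ (a, j))" by (rule index_mult_mat_sum[OF Jc Ic ij])
    also have "\<dots> = (\<Sum>a<p. J $$ (i, a) * E $$ (a, j)) + (\<Sum>b<q. J $$ (i, p + b) * F $$ (b, j))"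
      unfolding sum_lessThan_add using ij
      by (intro arg_cong2[where f = "(+)"] sum.cong refl) (simp_all add: I_nth)
    finally show ?thesis .
  qed
  show "V\<^sub>1 * E = E * A"
  proof (rule eq_matI)
    fix i j assume "i < dim_row (E * A)" "j < dim_col (E * A)"
    then have ij: "i < p" "j < ?m" using EF A by auto
    then have i: "i < ?m" by simp
    have "(E * A) $$ (i, j) = (\<Sum>a<?m. E $$ (i, a) * A $$ (a, j))" by (rule index_mult_mat_sum[OF EF(1) A ij])
    also have "\<dots> = (\<Sum>a<?m. I $$ (i, a) * A $$ (a, j))" using ij i by (intro sum.cong) (auto simp: I_nth)
    also have "\<dots> = (\<Sum>a<p. V\<^sub>1 $$ (i, a) * E $$ (a, j))"
      unfolding entry[OF i ij(2)] using ij i by (simp add: J_nth)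
    also have "\<dots> = (V\<^sub>1 * E) $$ (i, j)" by (rule index_mult_mat_sum[OF V1 EF(1) ij, symmetric])
    finally show "(V\<^sub>1 * E) $$ (i, j) = (E * A) $$ (i, j)" by simp
  qed (use V1 EF A in auto)
  show "V\<^sub>0 * F = F * A"
  proof (rule eq_matI)
    fix i j assume "i < dim_row (F * A)" "j < dim_col (F * A)"
    then have ij: "i < q" "j < ?m" using EF A by auto
    then have i: "p + i < ?m" by simp
    have "(F * A) $$ (i, j) = (\<Sum>a<?m. F $$ (i, a) * A $$ (a, j))" by (rule index_mult_mat_sum[OF EF(2) A ij])
    also have "\<dots> = (\<Sum>a<?m. I $$ (p + i, a) * A $$ (a, j))" using ij i by (intro sum.cong) (auto simp: I_nth)
    also have "\<dots> = (\<Sum>b<q. V\<^sub>0 $$ (i, b) * F $$ (b, j))"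
      unfolding entry[OF i ij(2)] using ij i by (simp add: J_nth)
    also have "\<dots> = (V\<^sub>0 * F) $$ (i, j)" by (rule index_mult_mat_sum[OF V0 EF(2) ij, symmetric])
    finally show "(V\<^sub>0 * F) $$ (i, j) = (F * A) $$ (i, j)" by simp
  qed (use V0 EF A in auto)
  show "L * E + K * F = 1\<^sub>m ?m"
    unfolding MI[symmetric]
  proof (rule eq_matI)
    fix i j assume "i < dim_row (M * I)" "j < dim_col (M * I)"
    then have ij: "i < ?m" "j < ?m" using M Ic by auto
    have "(M * I) $$ (i, j) = (\<Sum>a<?m. M $$ (i, a) * I $$ (a, j))" by (rule index_mult_mat_sum[OF M(1) Ic ij])
    also have "\<dots> = (\<Sum>a<p. L $$ (i, a) * E $$ (a, j)) + (\<Sum>b<q. K $$ (i, b) * F $$ (b, j))"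
      unfolding sum_lessThan_add using ij
      by (intro arg_cong2[where f = "(+)"] sum.cong refl) (simp_all add: I_nth M_nth)
    also have "\<dots> = (L * E) $$ (i, j) + (K * F) $$ (i, j)"
      by (simp only: index_mult_mat_sum[OF LK(1) EF(1) ij] index_mult_mat_sum[OF LK(2) EF(2) ij])
    also have "\<dots> = (L * E + K * F) $$ (i, j)"
      using ij LK EF by (subst index_add_mat(1)) auto
    finally show "(L * E + K * F) $$ (i, j) = (M * I) $$ (i, j)" by simp
  qed (use M Ic LK EF in auto)
qed

section \<open>The representation of the solution\<close>

lemma cmat_add:
  assumes "A \<in> carrier_mat m m" "C \<in> carrier_mat m m"
  shows "cmat (A + C) = cmat A + cmat C"
  using assms by (intro eq_matI) auto

lemma cmat_mult3:
  assumes "A \<in> carrier_mat m m" "C \<in> carrier_mat m m" "D \<in> carrier_mat m m"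
  shows "cmat (A * C * D) = cmat A * cmat C * cmat D"
  unfolding of_real_hom.mat_hom_mult[OF mult_carrier_mat[OF assms(1,2)] assms(3)]
    of_real_hom.mat_hom_mult[OF assms(1,2)] ..

theorem lemma8:
  fixes m p \<nu> :: nat
    and B Am A0 A1 G Ghat R U Pstar :: "real mat"
    and Es :: "nat set"
    and W M V\<^sub>1 V\<^sub>0 L K E F :: "complex mat"
    and \<pi> :: "nat \<Rightarrow> real vec"
    and N :: "complex vec \<Rightarrow> real"
    and g y \<sigma> :: "nat \<Rightarrow> complex vec"
    and \<gamma> ystar :: "complex vec"
    and \<omega> :: "complex \<Rightarrow> nat \<Rightarrow> complex vec"
    and x :: "complex \<Rightarrow> complex vec"
  assumes m: "m \<ge> 1"
    and blocks: "0\<^sub>m m m \<le> B" "0\<^sub>m m m \<le> Am" "0\<^sub>m m m \<le> A0" "0\<^sub>m m m \<le> A1"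
    and stochastic: "stochastic_on (UNIV \<times> {..<m}) (qbd_trans B Am A0 A1)"
    and irreducible: "irreducible_on (UNIV \<times> {..<m}) (qbd_trans B Am A0 A1)"
    and irreducible_A: "irreducible_on {..<m} (\<lambda>a b. (Am + A0 + A1) $$ (a, b))"
    and final: "single_final_class m Am A0 A1 Es"
    and G: "minimal_nonneg_solution m (\<lambda>X. Am + (A0 - 1\<^sub>m m) * X + A1 * X ^\<^sub>m 2) G"
    and Ghat: "minimal_nonneg_solution m (\<lambda>X. A1 + (A0 - 1\<^sub>m m) * X + Am * X ^\<^sub>m 2) Ghat"
    and R: "minimal_nonneg_solution m (\<lambda>X. A1 + X * (A0 - 1\<^sub>m m) + X ^\<^sub>m 2 * Am) R"
    and U: "U = A0 + R * Am"
    and Pstar: "Pstar = B + A1 * G"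
    and W: "W = mat_suminf m (\<lambda>j. cmat G ^\<^sub>m j * mat_inv (cmat U - 1\<^sub>m m) * cmat R ^\<^sub>m j)"
    and p: "p \<le> m"
    and V1: "V\<^sub>1 \<in> carrier_mat p p" "invertible_mat V\<^sub>1"
    and V0: "V\<^sub>0 \<in> carrier_mat (m - p) (m - p)" "p < m \<longrightarrow> spectral_radius V\<^sub>0 = 0"
    and M: "M \<in> carrier_mat m m" "invertible_mat M"
           "cmat Ghat * M = M * diag_block_mat [V\<^sub>1, V\<^sub>0]"
    and LK: "L \<in> carrier_mat m p" "K \<in> carrier_mat m (m - p)" "M = append_cols L K"
    and EF: "E \<in> carrier_mat p m" "F \<in> carrier_mat (m - p) m" "mat_inv M = E @\<^sub>r F"
    and \<nu>: "\<nu> = (LEAST n. 0 < n \<and> V\<^sub>0 ^\<^sub>m n = 0\<^sub>m (m - p) (m - p))"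
    and recurrent: "positive_recurrent (UNIV \<times> {..<m}) (qbd_trans B Am A0 A1)"
    and \<pi>: "\<And>i. \<pi> i \<in> carrier_vec m"
           "stationary_distribution (UNIV \<times> {..<m}) (qbd_trans B Am A0 A1) (\<lambda>(i, a). \<pi> i $ a)"
    and g: "\<And>k. g k \<in> carrier_vec m"
    and norm: "is_vec_norm m N"
    and g_summable: "summable (\<lambda>k. spectral_radius (cmat R) ^ k * N (g k))"
    and g_orthogonal:
      "scalar_prod (map_vec complex_of_real (\<pi> 0))
         (vec_suminf m (\<lambda>k. cmat R ^\<^sub>m k *\<^sub>v g k)) = 0"
    and \<gamma>: "\<gamma> = group_inverse (1\<^sub>m m - cmat Pstar) *\<^sub>v vec_suminf m (\<lambda>k. cmat R ^\<^sub>m k *\<^sub>v g k)"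
    and y: "\<And>r. y r =
      - vec_suminf m (\<lambda>k. vec_sum m (\<lambda>j.
          (cmat G ^\<^sub>m j * mat_inv (cmat U - 1\<^sub>m m) * cmat R ^\<^sub>m k) *\<^sub>v g (r + k - j)) {..<r})"
    and \<omega>: "\<And>c r. \<omega> c r = cmat G ^\<^sub>m r *\<^sub>v \<gamma> + y r + c \<cdot>\<^sub>v ones_vec m"
    and ystar: "ystar = - vec_suminf p (\<lambda>k. (V\<^sub>1 ^\<^sub>m Suc k * E * W) *\<^sub>v g (Suc k))"
    and \<sigma>: "\<And>r. \<sigma> r =
      - vec_sum m (\<lambda>k.
          ((cmat G ^\<^sub>m (r - k) - L * mat_inv V\<^sub>1 ^\<^sub>m (r - k) * E) * W) *\<^sub>v g k) {1..r}
      - vec_sum m (\<lambda>j. (K * V\<^sub>0 ^\<^sub>m j * F * W) *\<^sub>v g (j + r)) {1..\<nu> - 1}"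
    and x: "\<And>\<alpha>. x \<alpha> =
      group_inverse (1\<^sub>m m - cmat Pstar) *\<^sub>v
        ((cmat (B - 1\<^sub>m m) * cmat Ghat + cmat A1) *\<^sub>v (\<sigma> 1 + (L * mat_inv V\<^sub>1) *\<^sub>v ystar) + g 0)
      + \<alpha> \<cdot>\<^sub>v ones_vec m"
  shows "vec_summable p (\<lambda>k. (V\<^sub>1 ^\<^sub>m Suc k * E * W) *\<^sub>v g (Suc k)) \<and>
    (\<forall>c. \<exists>\<alpha>. \<forall>r. \<omega> c r =
       cmat G ^\<^sub>m r *\<^sub>v x \<alpha> + (L * mat_inv V\<^sub>1 ^\<^sub>m r) *\<^sub>v ystar + \<sigma> r)"
proof -
  let ?\<pi> = "\<lambda>i. mat 1 m (\<lambda>(_, a). \<pi> i $ a) :: real mat"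
  interpret qbd: stationary_qbd m Am A0 A1 B ?\<pi>
    by (rule stationary_qbd_from_chain[OF m blocks stochastic irreducible irreducible_A final \<pi>])
  interpret rev: skip_free_walk m A1 A0 Am by (rule qbd.reflected)
  have m0: "0 < m" by (rule qbd.m_pos)
  have GS: "qbd.solves_G G" and minG: "\<And>Y. qbd.solves_G Y \<Longrightarrow> G \<le> Y"
    using G unfolding qbd.minimal_G_iff by blast+
  have RS: "qbd.solves_R R" and minR: "\<And>Y. qbd.solves_R Y \<Longrightarrow> R \<le> Y"
    using R unfolding qbd.minimal_R_iff by blast+
  have GhS: "rev.solves_G Ghat" and minGh: "\<And>Y. rev.solves_G Y \<Longrightarrow> Ghat \<le> Y"
    using Ghat unfolding rev.minimal_G_iff by blast+
  have Gn: "0\<^sub>m m m \<le> G" and Rn: "0\<^sub>m m m \<le> R" and Ghn: "0\<^sub>m m m \<le> Ghat"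
    using GS RS GhS unfolding qbd.solves_G_def qbd.solves_R_def rev.solves_G_def by blast+
  have Bc: "B \<in> carrier_mat m m" and A1c: "A1 \<in> carrier_mat m m" and Amc: "Am \<in> carrier_mat m m"
    and A0c: "A0 \<in> carrier_mat m m" and Gc: "G \<in> carrier_mat m m" and Rc: "R \<in> carrier_mat m m"
    and Ghc: "Ghat \<in> carrier_mat m m"
    using blocks Gn Rn Ghn by (simp_all only: mat_nonneg_iff)
  obtain N' where N': "0\<^sub>m m m \<le> N'" "(1\<^sub>m m - (A0 + A1 * G)) * N' = 1\<^sub>m m"
    "N' * (1\<^sub>m m - (A0 + A1 * G)) = 1\<^sub>m m" "G = N' * Am" "qbd.solves_R (A1 * N')"
    "\<forall>X. qbd.solves_R X \<longrightarrow> X \<le> A1 * N' \<longrightarrow> X = A1 * N'"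
    by (rule qbd.minimal_G_factorization[OF GS minG])
  have N'c: "N' \<in> carrier_mat m m" using N'(1) by (simp only: mat_nonneg_iff)
  have R_eq: "R = A1 * N'" using N'(6) RS minR[OF N'(5)] by blast
  have GR: "A1 * G = R * Am"
    using assoc_mult_mat[OF A1c N'c Amc] by (simp only: R_eq N'(4)[symmetric])
  have U_eq: "U = A0 + A1 * G" unfolding U GR ..
  have R_summable: "summable (\<lambda>k. (R ^\<^sub>m k) $$ (a, b))" if "a < m" "b < m" for a b
    by (rule qbd.R_pow_summable[OF RS minR that])
  have R0: "mat_tendsto m m (\<lambda>k. R ^\<^sub>m k) (0\<^sub>m m m)"
    using R_summable Rc by (auto simp: mat_tendsto_def intro: summable_LIMSEQ_zero)
  obtain Q where Q: "0\<^sub>m m m \<le> Q" "Q = N' + G * Q * R"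
    "\<forall>a<m. \<forall>b<m. (\<lambda>k. (G ^\<^sub>m k * N' * R ^\<^sub>m k) $$ (a, b)) sums Q $$ (a, b)"
    by (rule qbd.green_series[OF Gn qbd.minimal_G_row_sums[OF GS minG] N'(1) Rn R_summable])
  have Qc: "Q \<in> carrier_mat m m" using Q(1) by (simp only: mat_nonneg_iff)
  have QR: "Q * R = Ghat * Q"
    by (rule qbd.green_commutation[OF GS minG GhS minGh N'(1,2,4) R_eq R0 Q(1,2) irreducible_A m0])

  define Gx where "Gx = cmat G"
  define Rx where "Rx = cmat R"
  define Hx where "Hx = cmat Ghat"
  define D where "D = mat_inv (cmat U - 1\<^sub>m m)"
  have Gxc [simp]: "Gx \<in> carrier_mat m m" and Rxc [simp]: "Rx \<in> carrier_mat m m" and Hxc [simp]: "Hx \<in> carrier_mat m m"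
    using Gc Rc Ghc by (simp_all add: Gx_def Rx_def Hx_def)
  have Uc: "A0 + A1 * G \<in> carrier_mat m m" using A0c mult_carrier_mat[OF A1c Gc] by simp
  have D_eq: "D = cmat (- N')"
  proof -
    have Uc': "U \<in> carrier_mat m m" using Uc by (simp only: U_eq)
    have "(1\<^sub>m m - U) * N' = (U - 1\<^sub>m m) * (- N')"
    proof -
      have "U - 1\<^sub>m m = - (1\<^sub>m m - U)" using Uc' by (intro eq_matI) auto
      then show ?thesis using N'c Uc' by simp
    qed
    then have inv: "(U - 1\<^sub>m m) * (- N') = 1\<^sub>m m" using N'(2) by (simp only: U_eq)
    have "cmat (U - 1\<^sub>m m) * cmat (- N') = cmat ((U - 1\<^sub>m m) * (- N'))"
      by (rule of_real_hom.mat_hom_mult[symmetric, of _ m m _ m]) (use N'c in \<open>simp_all add: minus_carrier_mat\<close>)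
    also have "\<dots> = 1\<^sub>m m" by (simp only: inv of_real_hom.mat_hom_one)
    finally have "cmat (U - 1\<^sub>m m) * cmat (- N') = 1\<^sub>m m" .
    moreover have "cmat (U - 1\<^sub>m m) = cmat U - 1\<^sub>m m"
      by (rule eq_matI) (use Uc' in simp_all)
    ultimately have "(cmat U - 1\<^sub>m m) * cmat (- N') = 1\<^sub>m m" by (simp only:)
    then show ?thesis unfolding D_def using N'c by (intro mat_inv_eqs(1)[of _ m]) (auto intro: minus_carrier_mat)
  qed
  have Dc [simp]: "D \<in> carrier_mat m m" using N'c by (simp add: D_eq)
  have W_eq: "W = cmat (- Q)"
  proof (rule eq_matI)
    fix a b assume "a < dim_row (cmat (- Q))" "b < dim_col (cmat (- Q))"
    then have ab: "a < m" "b < m" using Qc by auto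
    have "(cmat G ^\<^sub>m k * D * cmat R ^\<^sub>m k) $$ (a, b) = of_real (- (G ^\<^sub>m k * N' * R ^\<^sub>m k) $$ (a, b))" for k
    proof -
      have "cmat G ^\<^sub>m k * D * cmat R ^\<^sub>m k = cmat (G ^\<^sub>m k * (- N') * R ^\<^sub>m k)"
        unfolding D_eq of_real_hom.mat_hom_pow[OF Gc, symmetric] of_real_hom.mat_hom_pow[OF Rc, symmetric]
        by (rule cmat_mult3[symmetric, of _ m]) (simp_all add: Gc Rc N'c)
      also have "G ^\<^sub>m k * (- N') * R ^\<^sub>m k = - (G ^\<^sub>m k * N' * R ^\<^sub>m k)"
        by (simp only: uminus_mult_left_mat uminus_mult_right_mat index_mult_mat(3) carrier_matD[OF N'c]
            carrier_matD[OF pow_carrier_mat[OF Gc]] carrier_matD[OF pow_carrier_mat[OF Rc]])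
      finally show ?thesis using ab Gc N'c Rc by (simp del: index_mult_mat(1))
    qed
    moreover have "(\<lambda>k. of_real (- (G ^\<^sub>m k * N' * R ^\<^sub>m k) $$ (a, b))) sums (of_real (- Q $$ (a, b)) :: complex)"
      using Q(3) ab by (intro sums_of_real sums_minus) auto
    ultimately show "W $$ (a, b) = cmat (- Q) $$ (a, b)"
      using ab Qc by (simp add: W mat_suminf_def D_def[symmetric] sums_iff)
  qed (use Qc in \<open>auto simp: W mat_suminf_def\<close>)
  have Wc [simp]: "W \<in> carrier_mat m m" using Qc by (simp add: W_eq)
  have W_fix: "W = D + Gx * W * Rx"
  proof -
    have "- Q = - N' + G * (- Q) * R"
    proof -
      have "- Q = - (N' + G * Q * R)" by (subst Q(2)) (rule refl)
      also have "\<dots> = - N' + G * (- Q) * R"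
        using Gc N'c Rc Qc by (intro eq_matI) (auto simp del: index_mult_mat(1))
      finally show ?thesis .
    qed
    then have "cmat (- Q) = cmat (- N' + G * (- Q) * R)" by (rule arg_cong)
    also have "\<dots> = D + Gx * W * Rx"
      unfolding D_eq W_eq Gx_def Rx_def cmat_mult3[OF Gc uminus_carrier_mat[OF Qc] Rc, symmetric]
      by (rule cmat_add[of _ m])
        (simp_all only: uminus_carrier_mat[OF N'c] mult_carrier_mat[OF mult_carrier_mat[OF Gc uminus_carrier_mat[OF Qc]] Rc])
    finally show ?thesis unfolding W_eq .
  qed
  have WR: "W * Rx = Hx * W"
  proof -
    have "(- Q) * R = Ghat * (- Q)" using QR Qc Rc Ghc by simp
    then have "cmat ((- Q) * R) = cmat (Ghat * (- Q))" by (rule arg_cong)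
    then show ?thesis unfolding W_eq Rx_def Hx_def using Qc Rc Ghc
      by (simp add: of_real_hom.mat_hom_mult[of _ m m _ m] del: uminus_mult_left_mat uminus_mult_right_mat)
  qed
  have AD: "cmat A1 * D = - Rx"
  proof -
    have "A1 * (- N') = - R" unfolding R_eq using A1c N'c by simp
    then have "cmat (A1 * (- N')) = cmat (- R)" by (rule arg_cong)
    then have "cmat A1 * D = cmat (- R)" unfolding D_eq using A1c N'c
      by (simp add: of_real_hom.mat_hom_mult[of _ m m _ m] del: uminus_mult_left_mat uminus_mult_right_mat)
    also have "\<dots> = - Rx" unfolding Rx_def by (intro eq_matI) auto
    finally show ?thesis .
  qed

  define \<rho> where "\<rho> = spectral_radius Rx"
  have \<rho>0: "0 \<le> \<rho>" unfolding \<rho>_def by (rule spectral_radius_nonneg[OF Rxc m0])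
  have Rx_bound: "\<exists>C k0. \<forall>k\<ge>k0. cmod ((Rx ^\<^sub>m k) $$ (i, j)) \<le> C * \<rho> ^ k" if ij: "i < m" "j < m" for i j
  proof -
    have "cmod ((Rx ^\<^sub>m k) $$ (i, j)) = (R ^\<^sub>m k) $$ (i, j)" for k
      using mat_pow_nonneg[OF Rn, of k] ij Rc
      by (simp add: Rx_def of_real_hom.mat_hom_pow[OF Rc, symmetric] mat_nonneg_iff)
    then show ?thesis
      using qbd.R_pow_bound[OF RS irreducible_A ij] by (simp add: \<rho>_def Rx_def)
  qed
  \<comment> \<open>The series that occur in \<open>\<gamma>\<close>, \<open>y\<close> and \<open>ystar\<close> are images of the \<open>S n\<close>.\<close>
  define S where "S n = vec_suminf m (\<lambda>k. Rx ^\<^sub>m k *\<^sub>v g (n + k))" for n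
  have S_sums: "vec_sums m (\<lambda>k. Rx ^\<^sub>m k *\<^sub>v g (n + k)) (S n)" for n
    unfolding S_def
    by (intro vec_summable_sums power_series_summable[OF Rxc Rx_bound \<rho>0 norm g])
      (use g_summable in \<open>simp_all add: \<rho>_def Rx_def\<close>)
  then have Sc [simp]: "S n \<in> carrier_vec m" for n by (simp add: vec_sums_def)
  note g [simp]
  have Rg [simp]: "Rx ^\<^sub>m k *\<^sub>v g n \<in> carrier_vec m" for k n
    by (intro mult_mat_vec_carrier[of _ m m]) simp_all
  have S_rec: "S n = g n + Rx *\<^sub>v S (Suc n)" for n
  proof (rule vec_sums_unique[OF S_sums])
    have "vec_sums m (\<lambda>k. Rx *\<^sub>v (Rx ^\<^sub>m k *\<^sub>v g (Suc n + k))) (Rx *\<^sub>v S (Suc n))"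
      by (rule vec_sums_mult[OF Rxc Rg S_sums])
    moreover have "Rx *\<^sub>v (Rx ^\<^sub>m k *\<^sub>v g (Suc n + k)) = Rx ^\<^sub>m Suc k *\<^sub>v g (n + Suc k)" for k
      unfolding mat_pow_Suc_left[OF Rxc] by (simp add: assoc_mult_mat_vec[of _ m m _ m])
    ultimately have "vec_sums m (\<lambda>k. Rx ^\<^sub>m Suc k *\<^sub>v g (n + Suc k)) (Rx *\<^sub>v S (Suc n))" by (simp only:)
    then have "vec_sums m (\<lambda>k. Rx ^\<^sub>m k *\<^sub>v g (n + k)) (Rx ^\<^sub>m 0 *\<^sub>v g (n + 0) + Rx *\<^sub>v S (Suc n))"
      by (rule vec_sums_head) simp
    moreover have "Rx ^\<^sub>m 0 *\<^sub>v g (n + 0) = g n"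
      using carrier_matD(1)[OF Rxc] by (simp add: one_mult_mat_vec[OF g])
    ultimately show "vec_sums m (\<lambda>k. Rx ^\<^sub>m k *\<^sub>v g (n + k)) (g n + Rx *\<^sub>v S (Suc n))" by simp
  qed

  define w where "w n = W *\<^sub>v g n" for n
  define u where "u n = W *\<^sub>v S n" for n
  define d where "d n = D *\<^sub>v S n" for n
  have wc [simp]: "w n \<in> carrier_vec m" and uc [simp]: "u n \<in> carrier_vec m" and dc [simp]: "d n \<in> carrier_vec m" for n
    unfolding w_def u_def d_def by (intro mult_mat_vec_carrier[of _ m m]; simp)+
  have WRS: "W *\<^sub>v (Rx *\<^sub>v S n) = Hx *\<^sub>v u n" for n
  proof -
    have "W *\<^sub>v (Rx *\<^sub>v S n) = (W * Rx) *\<^sub>v S n" by (rule assoc_mult_mat_vec[OF Wc Rxc Sc, symmetric])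
    also have "\<dots> = Hx *\<^sub>v u n" unfolding WR u_def by (rule assoc_mult_mat_vec[OF Hxc Wc Sc])
    finally show ?thesis .
  qed
  have RSc [simp]: "Rx *\<^sub>v S n \<in> carrier_vec m" for n by (rule mult_mat_vec_carrier[OF Rxc Sc])
  have u_rec: "u n = w n + Hx *\<^sub>v u (Suc n)" for n
  proof -
    have "u n = W *\<^sub>v (g n + Rx *\<^sub>v S (Suc n))" unfolding u_def by (subst S_rec) (rule refl)
    also have "\<dots> = w n + W *\<^sub>v (Rx *\<^sub>v S (Suc n))"
      unfolding w_def by (rule mult_add_distrib_mat_vec[OF Wc g RSc])
    finally show ?thesis by (simp only: WRS)
  qed
  have Huc [simp]: "Hx *\<^sub>v u n \<in> carrier_vec m" for n by (rule mult_mat_vec_carrier[OF Hxc uc])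
  have GHuc [simp]: "Gx *\<^sub>v (Hx *\<^sub>v u n) \<in> carrier_vec m" for n by (rule mult_mat_vec_carrier[OF Gxc Huc])
  have d_eq: "d n = u n - Gx *\<^sub>v (Hx *\<^sub>v u n)" for n
  proof -
    have GWR: "Gx * W * Rx \<in> carrier_mat m m"
      by (intro mult_carrier_mat[of _ m m]) simp_all
    have "u n = (D + Gx * W * Rx) *\<^sub>v S n" unfolding u_def by (subst W_fix) (rule refl)
    also have "\<dots> = d n + (Gx * W * Rx) *\<^sub>v S n"
      unfolding d_def by (rule add_mult_distrib_mat_vec[OF Dc GWR Sc])
    also have "(Gx * W * Rx) *\<^sub>v S n = Gx *\<^sub>v (W *\<^sub>v (Rx *\<^sub>v S n))"
      by (simp add: assoc_mult_mat_vec[of _ m m _ m] mult_carrier_mat[of _ m m _ m] assoc_mult_mat[of _ m m _ m _ m])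
    finally have u_d: "u n = d n + Gx *\<^sub>v (Hx *\<^sub>v u n)" by (simp only: WRS)
    have "d n = (d n + Gx *\<^sub>v (Hx *\<^sub>v u n)) - Gx *\<^sub>v (Hx *\<^sub>v u n)"
      using carrier_vecD[OF dc] carrier_vecD[OF GHuc] by (intro eq_vecI) (simp_all del: index_mult_mat_vec)
    then show ?thesis by (simp only: u_d[symmetric])
  qed

  \<comment> \<open>The part of \<open>y r\<close> that turns out to be \<open>L * V\<^sub>1\<^sup>-\<^sup>r ystar + \<sigma> r\<close>; the rest is \<open>G\<^sup>r q\<close>.\<close>
  define Z where "Z r = - vec_sum m (\<lambda>k. Gx ^\<^sub>m (r - k) *\<^sub>v w k) {1..r} - Hx *\<^sub>v u (Suc r)" for r
  define q where "q = Hx *\<^sub>v u 1"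
  have qc [simp]: "q \<in> carrier_vec m" by (simp add: q_def)
  have Zc [simp]: "Z r \<in> carrier_vec m" for r unfolding Z_def
    by (intro minus_carrier_vec) (simp_all add: vec_sum_carrier mult_mat_vec_carrier[of _ m m])
  have y_eq: "y r = Z r + Gx ^\<^sub>m r *\<^sub>v q" for r
  proof -
    have GDc: "Gx ^\<^sub>m j * D \<in> carrier_mat m m" for j by (rule mult_carrier_mat[of _ m m]) simp_all
    have term_eq: "(Gx ^\<^sub>m j * D * Rx ^\<^sub>m k) *\<^sub>v g (r + k - j) = (Gx ^\<^sub>m j * D) *\<^sub>v (Rx ^\<^sub>m k *\<^sub>v g (r - j + k))"
      if "j < r" for j k
    proof -
      have "r + k - j = r - j + k" using that by simp
      then show ?thesis
        by (simp only:) (rule assoc_mult_mat_vec[OF GDc pow_carrier_mat[OF Rxc] g])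
    qed
    have GDRc: "Gx ^\<^sub>m j * D * Rx ^\<^sub>m k \<in> carrier_mat m m" for j k
      by (rule mult_carrier_mat[OF GDc]) simp
    have inner: "vec_sums m (\<lambda>k. (Gx ^\<^sub>m j * D * Rx ^\<^sub>m k) *\<^sub>v g (r + k - j)) (Gx ^\<^sub>m j *\<^sub>v d (r - j))"
      if "j < r" for j
    proof -
      have "vec_sums m (\<lambda>k. (Gx ^\<^sub>m j * D) *\<^sub>v (Rx ^\<^sub>m k *\<^sub>v g (r - j + k))) ((Gx ^\<^sub>m j * D) *\<^sub>v S (r - j))"
        by (rule vec_sums_mult[OF GDc Rg S_sums])
      moreover have "(Gx ^\<^sub>m j * D) *\<^sub>v S (r - j) = Gx ^\<^sub>m j *\<^sub>v d (r - j)"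
        unfolding d_def by (rule assoc_mult_mat_vec[of _ m m _ m]) simp_all
      ultimately show ?thesis by (simp only: term_eq[OF that])
    qed
    have "vec_sums m (\<lambda>k. vec_sum m (\<lambda>j. (Gx ^\<^sub>m j * D * Rx ^\<^sub>m k) *\<^sub>v g (r + k - j)) {..<r})
        (vec_sum m (\<lambda>j. Gx ^\<^sub>m j *\<^sub>v d (r - j)) {..<r})"
      by (rule vec_sums_vec_sum) (use inner mult_mat_vec_carrier[OF GDRc g] in auto)
    then have "y r = - vec_sum m (\<lambda>j. Gx ^\<^sub>m j *\<^sub>v d (r - j)) {..<r}"
      unfolding y D_def[symmetric] Gx_def[symmetric] Rx_def[symmetric] by (simp only: vec_sums_suminf(1))
    then show ?thesis
      unfolding Z_def q_def 
      using convolution_identity[where u = u and w = w and d = d, OF Gxc Hxc uc wc u_rec d_eq] by simp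
  qed

  have pq: "p + (m - p) = m" using p by simp
  have coords: "V\<^sub>1 * E = E * Hx" "V\<^sub>0 * F = F * Hx" "L * E + K * F = 1\<^sub>m m"
    by (fact block_coordinates[of V\<^sub>1 p V\<^sub>0 "m - p" M Hx L K E F, unfolded pq,
      OF V1(1) V0(1) M(1,2) Hxc M(3)[folded Hx_def] LK EF])+
  define V' where "V' = mat_inv V\<^sub>1"
  have V': "V' \<in> carrier_mat p p" "V' * V\<^sub>1 = 1\<^sub>m p"
    using invertible_mat_inv[OF V1] by (simp_all add: V'_def)
  have nil: "0 < \<nu>" "V\<^sub>0 ^\<^sub>m \<nu> = 0\<^sub>m (m - p) (m - p)"
  proof -
    have "\<exists>k>0. V\<^sub>0 ^\<^sub>m k = 0\<^sub>m (m - p) (m - p)"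
      by (rule spectral_radius_zero_nilpotent[OF V0(1)]) (use V0(2) in simp)
    then have "0 < \<nu> \<and> V\<^sub>0 ^\<^sub>m \<nu> = 0\<^sub>m (m - p) (m - p)" unfolding \<nu> by (rule LeastI_ex)
    then show "0 < \<nu>" "V\<^sub>0 ^\<^sub>m \<nu> = 0\<^sub>m (m - p) (m - p)" by simp_all
  qed
  have Hpow: "Hx ^\<^sub>m k * W = W * Rx ^\<^sub>m k" for k
    by (rule intertwining_pow[OF Hxc Wc Rxc WR[symmetric]])
  have EW: "E * W \<in> carrier_mat p m" "E * W * Rx \<in> carrier_mat p m" "E * Hx \<in> carrier_mat p m"
    using EF(1) by (auto intro!: mult_carrier_mat[of _ p m] simp del: assoc_mult_mat)
  have ystar_sums: "vec_sums p (\<lambda>k. (V\<^sub>1 ^\<^sub>m Suc k * E * W) *\<^sub>v g (Suc k)) ((E * Hx) *\<^sub>v u 1)"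
  proof -
    have "vec_sums p (\<lambda>k. (E * W * Rx) *\<^sub>v (Rx ^\<^sub>m k *\<^sub>v g (1 + k))) ((E * W * Rx) *\<^sub>v S 1)"
      by (rule vec_sums_mult[OF EW(2) Rg S_sums])
    moreover have "(E * W * Rx) *\<^sub>v (Rx ^\<^sub>m k *\<^sub>v g (1 + k)) = (V\<^sub>1 ^\<^sub>m Suc k * E * W) *\<^sub>v g (Suc k)" for k
    proof -
      have "V\<^sub>1 ^\<^sub>m Suc k * E * W = E * (Hx ^\<^sub>m Suc k * W)"
        unfolding intertwining_pow[OF V1(1) EF(1) Hxc coords(1)]
        by (rule assoc_mult_mat[of _ p m _ m _ m]) (simp_all add: EF(1) del: pow_mat.simps(2))
      also have "\<dots> = E * W * Rx * Rx ^\<^sub>m k"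
        unfolding Hpow mat_pow_Suc_left[OF Rxc] using EF(1)
        by (simp add: assoc_mult_mat[of _ p m _ m _ m] mult_carrier_mat[of _ p m _ m] mult_carrier_mat[of _ m m _ m] assoc_mult_mat[of _ m m _ m _ m])
      finally show ?thesis
        using assoc_mult_mat_vec[OF EW(2) pow_carrier_mat[OF Rxc] g] by simp
    qed
    moreover have "(E * W * Rx) *\<^sub>v S 1 = (E * Hx) *\<^sub>v u 1"
    proof -
      have "(E * W * Rx) *\<^sub>v S 1 = E *\<^sub>v (W *\<^sub>v (Rx *\<^sub>v S 1))"
        using assoc_mult_mat_vec[OF EW(1) Rxc Sc] assoc_mult_mat_vec[OF EF(1) Wc RSc] by (simp del: assoc_mult_mat_vec)
      also have "\<dots> = (E * Hx) *\<^sub>v u 1"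
        unfolding WRS by (rule assoc_mult_mat_vec[OF EF(1) Hxc uc, symmetric])
      finally show ?thesis .
    qed
    ultimately show ?thesis by (simp only:)
  qed
  have ystar_eq: "ystar = - ((E * Hx) *\<^sub>v u 1)"
    unfolding ystar vec_sums_suminf(1)[OF ystar_sums] ..
  have Z_eq: "(L * V' ^\<^sub>m r) *\<^sub>v ystar + \<sigma> r = Z r" for r
  proof -
    have LVE: "Gx ^\<^sub>m (r - k) - L * V' ^\<^sub>m (r - k) * E \<in> carrier_mat m m" for k
      by (intro minus_carrier_mat mult_carrier_mat[OF mult_carrier_mat[OF LK(1) pow_carrier_mat[OF V'(1)]] EF(1)])
    have KVF: "K * V\<^sub>0 ^\<^sub>m j * F \<in> carrier_mat m m" for j
      by (intro mult_carrier_mat[OF mult_carrier_mat[OF LK(2) pow_carrier_mat[OF V0(1)]] EF(2)])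
    have \<sigma>_eq: "\<sigma> r = - vec_sum m (\<lambda>k. (Gx ^\<^sub>m (r - k) - L * V' ^\<^sub>m (r - k) * E) *\<^sub>v w k) {1..r}
        - vec_sum m (\<lambda>j. (K * V\<^sub>0 ^\<^sub>m j * F) *\<^sub>v w (j + r)) {1..\<nu> - 1}"
      unfolding \<sigma> Gx_def[symmetric] V'_def[symmetric] w_def
        assoc_mult_mat_vec[OF LVE Wc g] assoc_mult_mat_vec[OF KVF Wc g] ..
    show ?thesis
      unfolding \<sigma>_eq ystar_eq Z_def
      by (rule spectral_splitting[where u = u and w = w, OF Gxc Hxc LK(1,2) EF(1,2) V1(1) V'(1) V0(1) V'(2) coords(1,2,3) nil(2,1) uc wc u_rec])
  qed

  define H where "H = 1\<^sub>m m - cmat Pstar"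
  define X where "X = group_inverse H"
  have Pc: "cmat Pstar \<in> carrier_mat m m" unfolding Pstar using Bc mult_carrier_mat[OF A1c Gc] by simp
  have Hc [simp]: "H \<in> carrier_mat m m" unfolding H_def by (rule minus_carrier_mat[OF Pc])
  have "is_group_inverse H X"
    unfolding X_def H_def Pstar by (rule qbd.group_inverse_boundary[OF GS minG RS minR GR])
  then have Xc [simp]: "X \<in> carrier_mat m m" and HXH: "H * X * H = H"
    using carrier_matD(1)[OF Hc] unfolding is_group_inverse_def by auto
  have Hv: "H *\<^sub>v v = v - cmat Pstar *\<^sub>v v" if "v \<in> carrier_vec m" for v
    unfolding H_def using minus_mult_distrib_mat_vec[OF one_carrier_mat Pc that] that by simp
  have kernel: "\<exists>c. v = c \<cdot>\<^sub>v ones_vec m" if v: "v \<in> carrier_vec m" "H *\<^sub>v v = 0\<^sub>v m" for v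
  proof (rule qbd.fixed_vector_constant_complex[OF GS minG v(1)])
    have Pvc: "cmat Pstar *\<^sub>v v \<in> carrier_vec m" by (rule mult_mat_vec_carrier[OF Pc v(1)])
    have "v - cmat Pstar *\<^sub>v v = 0\<^sub>v m" using Hv v by simp
    then have "(v - cmat Pstar *\<^sub>v v) $ i = 0" if "i < m" for i using that by simp
    then have "cmat Pstar *\<^sub>v v = v"
      using carrier_vecD[OF Pvc] carrier_vecD[OF v(1)] by (intro eq_vecI) (auto simp del: index_mult_mat_vec)
    then show "cmat (B + A1 * G) *\<^sub>v v = v" by (simp only: Pstar)
  qed
  have onesc [simp]: "ones_vec m \<in> carrier_vec m" by (simp add: ones_vec_def)
  have G_ones: "Gx ^\<^sub>m r *\<^sub>v ones_vec m = ones_vec m" for r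
  proof (induction r)
    case 0
    then show ?case using carrier_matD(1)[OF Gxc] by (simp add: one_mult_mat_vec[OF onesc])
  next
    case (Suc r)
    have "Gx *\<^sub>v ones_vec m = ones_vec m"
    proof (rule eq_vecI)
      fix i assume "i < dim_vec (ones_vec m)"
      then have i: "i < m" by (simp add: ones_vec_def)
      have "(Gx *\<^sub>v ones_vec m) $ i = (\<Sum>a<m. Gx $$ (i, a) * ones_vec m $ a)"
        by (rule index_mult_mat_vec_sum[OF Gxc onesc i])
      also have "\<dots> = of_real (\<Sum>a<m. G $$ (i, a))"
        using Gc i by (simp add: Gx_def ones_vec_def)
      finally show "(Gx *\<^sub>v ones_vec m) $ i = ones_vec m $ i"
        using i qbd.G_row_sums[OF GS minG i] by (simp add: ones_vec_def)
    qed (use carrier_matD[OF Gxc] in \<open>simp add: ones_vec_def\<close>)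
    moreover have "Gx ^\<^sub>m Suc r *\<^sub>v ones_vec m = Gx ^\<^sub>m r *\<^sub>v (Gx *\<^sub>v ones_vec m)"
      by (simp add: assoc_mult_mat_vec[of _ m m _ m])
    ultimately show ?case using Suc by simp
  qed

  have cB: "cmat B \<in> carrier_mat m m" and cA1: "cmat A1 \<in> carrier_mat m m" using Bc A1c by simp_all
  have Z1: "Z 1 = - u 1"
  proof -
    have "vec_sum m (\<lambda>k. Gx ^\<^sub>m (1 - k) *\<^sub>v w k) {1..1} = w 1"
    proof (rule eq_vecI)
      have GW: "Gx ^\<^sub>m k *\<^sub>v w j \<in> carrier_vec m" for j k by (intro mult_mat_vec_carrier[of _ m m]) simp_all
      then have c: "vec_sum m (\<lambda>k. Gx ^\<^sub>m (1 - k) *\<^sub>v w k) {1..1} \<in> carrier_vec m" by (intro vec_sum_carrier)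
      show "dim_vec (vec_sum m (\<lambda>k. Gx ^\<^sub>m (1 - k) *\<^sub>v w k) {1..1}) = dim_vec (w 1)"
        unfolding carrier_vecD[OF c] carrier_vecD[OF wc] ..
      fix i assume "i < dim_vec (w 1)"
      then have i: "i < m" by (simp add: carrier_vecD[OF wc])
      have "vec_sum m (\<lambda>k. Gx ^\<^sub>m (1 - k) *\<^sub>v w k) {1..1} $ i = (\<Sum>k\<in>{1..1}. (Gx ^\<^sub>m (1 - k) *\<^sub>v w k) $ i)"
        by (intro vec_sum_index GW i) simp
      also have "\<dots> = (Gx ^\<^sub>m 0 *\<^sub>v w 1) $ i" by simp
      also have "Gx ^\<^sub>m 0 *\<^sub>v w 1 = w 1" using carrier_matD(1)[OF Gxc] by (simp add: one_mult_mat_vec[OF wc])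
      finally show "vec_sum m (\<lambda>k. Gx ^\<^sub>m (1 - k) *\<^sub>v w k) {1..1} $ i = w 1 $ i" .
    qed
    then have "Z 1 = - w 1 - Hx *\<^sub>v u (Suc 1)" by (simp only: Z_def)
    also have "\<dots> = - (w 1 + Hx *\<^sub>v u (Suc 1))"
      by (intro eq_vecI) (simp_all add: carrier_vecD[OF wc] carrier_vecD[OF Huc] del: index_mult_mat_vec dim_mult_mat_vec)
    finally show ?thesis by (simp only: u_rec[of 1, symmetric])
  qed
  \<comment> \<open>As \<open>Z 1 = - u 1\<close> and \<open>u 1 = D S\<^sub>1 + G q\<close>, the term \<open>A1 u\<^sub>1\<close> is \<open>A1 G q - R S\<^sub>1\<close>, and \<open>S\<^sub>0 = g\<^sub>0 + R S\<^sub>1\<close>.\<close>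
  have rhs: "(cmat (B - 1\<^sub>m m) * Hx + cmat A1) *\<^sub>v (Z 1) + g 0 = H *\<^sub>v q + S 0"
  proof -
    have BHc: "cmat (B - 1\<^sub>m m) * Hx \<in> carrier_mat m m"
      by (rule mult_carrier_mat[OF _ Hxc]) (use Bc in \<open>simp add: minus_carrier_mat\<close>)
    have BIc: "cmat (B - 1\<^sub>m m) \<in> carrier_mat m m" using Bc by (simp add: minus_carrier_mat)
    have BI: "cmat (B - 1\<^sub>m m) = cmat B - 1\<^sub>m m" using Bc by (intro eq_matI) auto
    have 1: "(cmat (B - 1\<^sub>m m) * Hx) *\<^sub>v u 1 = cmat B *\<^sub>v q - q"
    proof -
      have "(cmat (B - 1\<^sub>m m) * Hx) *\<^sub>v u 1 = cmat (B - 1\<^sub>m m) *\<^sub>v q"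
        unfolding q_def by (rule assoc_mult_mat_vec[OF BIc Hxc uc])
      also have "\<dots> = cmat B *\<^sub>v q - 1\<^sub>m m *\<^sub>v q"
        unfolding BI by (rule minus_mult_distrib_mat_vec[OF cB one_carrier_mat qc])
      finally show ?thesis by simp
    qed
    have Gq: "Gx *\<^sub>v q \<in> carrier_vec m" unfolding q_def by simp
    have Pq: "cmat Pstar *\<^sub>v q = cmat B *\<^sub>v q + cmat A1 *\<^sub>v (Gx *\<^sub>v q)"
    proof -
      have "cmat Pstar = cmat B + cmat A1 * Gx"
        unfolding Pstar Gx_def cmat_add[OF Bc mult_carrier_mat[OF A1c Gc]] of_real_hom.mat_hom_mult[OF A1c Gc] ..
      then show ?thesis
        using add_mult_distrib_mat_vec[OF cB mult_carrier_mat[OF cA1 Gxc] qc] assoc_mult_mat_vec[OF cA1 Gxc qc] by simp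
    qed
    have A1u: "cmat A1 *\<^sub>v u 1 = cmat A1 *\<^sub>v (Gx *\<^sub>v q) - Rx *\<^sub>v S 1"
    proof -
      have "u 1 = d 1 + Gx *\<^sub>v q"
        unfolding d_eq q_def using carrier_vecD[OF uc] carrier_vecD[OF GHuc]
        by (intro eq_vecI) (simp_all del: index_mult_mat_vec)
      then have "cmat A1 *\<^sub>v u 1 = cmat A1 *\<^sub>v d 1 + cmat A1 *\<^sub>v (Gx *\<^sub>v q)"
        using mult_add_distrib_mat_vec[OF cA1 dc Gq] by simp
      also have "cmat A1 *\<^sub>v d 1 = (- Rx) *\<^sub>v S 1"
        unfolding d_def AD[symmetric] by (rule assoc_mult_mat_vec[OF cA1 Dc Sc, symmetric])
      also have "(- Rx) *\<^sub>v S 1 = - (Rx *\<^sub>v S 1)"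
        using carrier_vecD[OF Sc] carrier_matD[OF Rxc] by simp
      also have "- (Rx *\<^sub>v S 1) + cmat A1 *\<^sub>v (Gx *\<^sub>v q) = cmat A1 *\<^sub>v (Gx *\<^sub>v q) - Rx *\<^sub>v S 1"
        using carrier_matD[OF Rxc] carrier_matD[OF cA1] by (intro eq_vecI) (simp_all del: index_mult_mat_vec)
      finally show ?thesis .
    qed
    have "(cmat (B - 1\<^sub>m m) * Hx + cmat A1) *\<^sub>v (Z 1) = - ((cmat (B - 1\<^sub>m m) * Hx + cmat A1) *\<^sub>v u 1)"
      unfolding Z1 by (rule mult_mat_vec_uminus[OF add_carrier_mat[OF cA1] uc])
    also have "(cmat (B - 1\<^sub>m m) * Hx + cmat A1) *\<^sub>v u 1 = (cmat B *\<^sub>v q - q) + (cmat A1 *\<^sub>v (Gx *\<^sub>v q) - Rx *\<^sub>v S 1)"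
      unfolding add_mult_distrib_mat_vec[OF BHc cA1 uc] 1 A1u ..
    finally have lhs: "(cmat (B - 1\<^sub>m m) * Hx + cmat A1) *\<^sub>v (Z 1) = - \<dots>" .
    show ?thesis
      unfolding lhs Hv[OF qc] Pq S_rec[of 0]
      by (intro eq_vecI)
        (simp_all add: carrier_vecD[OF qc] carrier_matD(1)[OF Rxc] carrier_matD(1)[OF cA1] carrier_matD(1)[OF cB]
          carrier_vecD[OF g] algebra_simps del: index_mult_mat_vec)
  qed
  have Hqc: "H *\<^sub>v q \<in> carrier_vec m" by (rule mult_mat_vec_carrier[OF Hc qc])
  have XHq: "X *\<^sub>v (H *\<^sub>v q) \<in> carrier_vec m" by (rule mult_mat_vec_carrier[OF Xc Hqc])
  have \<gamma>_eq: "\<gamma> = X *\<^sub>v S 0" unfolding \<gamma> X_def H_def S_def Rx_def by simp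
  have \<gamma>c: "\<gamma> \<in> carrier_vec m" unfolding \<gamma>_eq by (rule mult_mat_vec_carrier[OF Xc Sc])
  \<comment> \<open>\<open>H * X * H = H\<close> puts the difference into the kernel of \<open>H\<close>.\<close>
  obtain \<beta> where \<beta>: "X *\<^sub>v (H *\<^sub>v q) - q = \<beta> \<cdot>\<^sub>v ones_vec m"
  proof -
    have "H *\<^sub>v (X *\<^sub>v (H *\<^sub>v q)) = (H * X * H) *\<^sub>v q"
      using assoc_mult_mat_vec[OF mult_carrier_mat[OF Hc Xc] Hc qc] assoc_mult_mat_vec[OF Hc Xc Hqc] by (simp del: assoc_mult_mat_vec assoc_mult_mat)
    then have "H *\<^sub>v (X *\<^sub>v (H *\<^sub>v q)) = H *\<^sub>v q" by (simp only: HXH)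
    then have "H *\<^sub>v (X *\<^sub>v (H *\<^sub>v q) - q) = H *\<^sub>v q - H *\<^sub>v q"
      using mult_minus_distrib_mat_vec[OF Hc XHq qc] by simp
    also have "\<dots> = 0\<^sub>v m" using carrier_vecD[OF Hqc] by (intro eq_vecI) (simp_all del: index_mult_mat_vec)
    finally show thesis using kernel[OF minus_carrier_vec[OF XHq qc]] that by blast
  qed
  have x_eq: "x \<alpha> = (q + \<gamma>) + (\<alpha> + \<beta>) \<cdot>\<^sub>v ones_vec m" for \<alpha>
  proof -
    have V1pow: "V' ^\<^sub>m 1 = V'" using V'(1) by (simp add: left_mult_one_mat[of _ p p])
    have LVc: "L * V' ^\<^sub>m r *\<^sub>v ystar \<in> carrier_vec m" for r
      using mult_carrier_mat[OF LK(1) pow_carrier_mat[OF V'(1), of r]] by (rule mult_mat_vec_carrier)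
        (simp add: ystar_eq mult_mat_vec_carrier[OF EW(3) uc])
    have \<sigma>c: "\<sigma> 1 \<in> carrier_vec m"
    proof -
      have "dim_vec ((L * V' ^\<^sub>m 1) *\<^sub>v ystar + \<sigma> 1) = m" unfolding Z_eq by (rule carrier_vecD[OF Zc])
      then show ?thesis by (intro carrier_vecI) (simp only: index_add_vec(2))
    qed
    have "\<sigma> 1 + (L * mat_inv V\<^sub>1) *\<^sub>v ystar = Z 1"
      using comm_add_vec[OF \<sigma>c LVc[of 1]] Z_eq[of 1] unfolding V1pow unfolding V'_def by simp
    then have "x \<alpha> = X *\<^sub>v (H *\<^sub>v q + S 0) + \<alpha> \<cdot>\<^sub>v ones_vec m"
      unfolding x X_def[symmetric] H_def[symmetric] Hx_def[symmetric] by (simp only: rhs)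
    also have "X *\<^sub>v (H *\<^sub>v q + S 0) = X *\<^sub>v (H *\<^sub>v q) + \<gamma>"
      unfolding \<gamma>_eq by (rule mult_add_distrib_mat_vec[OF Xc Hqc Sc])
    also have "X *\<^sub>v (H *\<^sub>v q) = q + (X *\<^sub>v (H *\<^sub>v q) - q)"
      by (intro eq_vecI) (simp_all add: carrier_vecD[OF XHq] carrier_vecD[OF qc] del: index_mult_mat_vec dim_mult_mat_vec)
    also have "(q + (X *\<^sub>v (H *\<^sub>v q) - q)) + \<gamma> + \<alpha> \<cdot>\<^sub>v ones_vec m = (q + \<gamma>) + (\<alpha> + \<beta>) \<cdot>\<^sub>v ones_vec m"
      unfolding \<beta>
      by (intro eq_vecI) (simp_all add: carrier_vecD[OF \<gamma>c] carrier_vecD[OF qc] carrier_vecD[OF onesc] algebra_simps)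
    finally show ?thesis .
  qed
  have Gpc: "Gx ^\<^sub>m r *\<^sub>v v \<in> carrier_vec m" if "v \<in> carrier_vec m" for r v
    using that by (intro mult_mat_vec_carrier[of _ m m]) simp_all
  have main: "\<omega> c r = cmat G ^\<^sub>m r *\<^sub>v x (c - \<beta>) + (L * mat_inv V\<^sub>1 ^\<^sub>m r) *\<^sub>v ystar + \<sigma> r" for c r
  proof -
    have "Gx ^\<^sub>m r *\<^sub>v x (c - \<beta>) = Gx ^\<^sub>m r *\<^sub>v (q + \<gamma>) + Gx ^\<^sub>m r *\<^sub>v (c \<cdot>\<^sub>v ones_vec m)"
      unfolding x_eq using \<gamma>c by (subst mult_add_distrib_mat_vec[of _ m m]) simp_all
    also have "Gx ^\<^sub>m r *\<^sub>v (q + \<gamma>) = Gx ^\<^sub>m r *\<^sub>v q + Gx ^\<^sub>m r *\<^sub>v \<gamma>"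
      by (rule mult_add_distrib_mat_vec[OF pow_carrier_mat[OF Gxc] qc \<gamma>c])
    also have "Gx ^\<^sub>m r *\<^sub>v (c \<cdot>\<^sub>v ones_vec m) = c \<cdot>\<^sub>v ones_vec m"
      using mult_mat_vec[OF pow_carrier_mat[OF Gxc] onesc] by (simp add: G_ones)
    finally have Gx: "Gx ^\<^sub>m r *\<^sub>v x (c - \<beta>) = Gx ^\<^sub>m r *\<^sub>v q + Gx ^\<^sub>m r *\<^sub>v \<gamma> + c \<cdot>\<^sub>v ones_vec m" .
    have dims: "dim_vec (Gx ^\<^sub>m r *\<^sub>v q) = m" "dim_vec (Gx ^\<^sub>m r *\<^sub>v \<gamma>) = m" "dim_vec (Z r) = m"
      "dim_vec (ones_vec m) = m" "dim_vec (L * V' ^\<^sub>m r *\<^sub>v ystar) = m" "dim_vec (\<sigma> r) = m"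
    proof -
      show "dim_vec (Gx ^\<^sub>m r *\<^sub>v q) = m" "dim_vec (Gx ^\<^sub>m r *\<^sub>v \<gamma>) = m" "dim_vec (Z r) = m" "dim_vec (ones_vec m) = m"
        by (fact carrier_vecD[OF Gpc[OF qc]] carrier_vecD[OF Gpc[OF \<gamma>c]] carrier_vecD[OF Zc] carrier_vecD[OF onesc])+
      show "dim_vec (L * V' ^\<^sub>m r *\<^sub>v ystar) = m" using carrier_matD(1)[OF LK(1)] by simp
      have "dim_vec ((L * V' ^\<^sub>m r) *\<^sub>v ystar + \<sigma> r) = m" unfolding Z_eq by (rule carrier_vecD[OF Zc])
      then show "dim_vec (\<sigma> r) = m" by simp
    qed
    have assoc: "a + b + s = a + (b + s)" if "dim_vec a = m" "dim_vec b = m" "dim_vec s = m" for a b s :: "complex vec"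
      using that by (intro eq_vecI) auto
    have "\<omega> c r = Gx ^\<^sub>m r *\<^sub>v \<gamma> + (Z r + Gx ^\<^sub>m r *\<^sub>v q) + c \<cdot>\<^sub>v ones_vec m"
      unfolding \<omega> y_eq Gx_def[symmetric] ..
    also have "\<dots> = (Gx ^\<^sub>m r *\<^sub>v q + Gx ^\<^sub>m r *\<^sub>v \<gamma> + c \<cdot>\<^sub>v ones_vec m) + Z r"
      by (intro eq_vecI) (simp_all add: dims del: index_mult_mat_vec dim_mult_mat_vec)
    also have "\<dots> = Gx ^\<^sub>m r *\<^sub>v x (c - \<beta>) + ((L * V' ^\<^sub>m r) *\<^sub>v ystar + \<sigma> r)"
      unfolding Gx Z_eq ..
    also have "\<dots> = Gx ^\<^sub>m r *\<^sub>v x (c - \<beta>) + (L * V' ^\<^sub>m r) *\<^sub>v ystar + \<sigma> r"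
      by (rule assoc[symmetric]) (simp_all add: Gx dims del: dim_mult_mat_vec)
    finally show ?thesis unfolding Gx_def V'_def .
  qed
  have summable: "vec_summable p (\<lambda>k. (V\<^sub>1 ^\<^sub>m Suc k * E * W) *\<^sub>v g (Suc k))"
    by (rule vec_sums_suminf(2)[OF ystar_sums])
  show ?thesis
  proof (intro conjI allI)
    fix c
    show "\<exists>\<alpha>. \<forall>r. \<omega> c r =
       cmat G ^\<^sub>m r *\<^sub>v x \<alpha> + (L * mat_inv V\<^sub>1 ^\<^sub>m r) *\<^sub>v ystar + \<sigma> r"
      by (rule exI[of _ "c - \<beta>"]) (rule allI, rule main)
  qed (rule summable)
qed

end
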